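(* Let $S$ be a finite quantum stop time and let $\pi = \{ 0 = \pi_0 < \cdots < \pi_{n+1} = \infty \}$ be a finite partition of $[0,\infty]$. The map $$\sigma_{S,\pi} : B(\mathcal{F}) \to B(\mathcal{F}); \quad X \mapsto \sum_{j=1}^{n+1} \sigma_{\pi_j}(X)\, S\bigl( (\pi_{j-1}, \pi_j] \bigr)$$ is a unital $*$-homomorphism, the limit $$\sigma_S(X) := \lim_\pi \sigma_{S,\pi}(X)$$ exists in the strong operator topology for all $X \in B(\mathcal{F})$, where the limit is taken over all finite partitions $\pi$ of $[0,\infty]$ ordered by refinement, and the map $$\sigma_S : B(\mathcal{F}) \to B(\mathcal{F}); \quad X \mapsto \sigma_S(X)$$ is a unital $*$-homomorphism such that $$\sigma_S(X)\, \Gamma_S = \Gamma_S\, X \qquad \text{for all } X \in B(\mathcal{F}).$$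
   Context: Fock space. Fix a complex Hilbert space $\mathsf{k}$. Inner products are linear in the second variable. $B(H)$ denotes the bounded operators on a Hilbert space $H$. For a subinterval $A$ of $\mathbb{R}_+ = [0,\infty)$, $\mathcal{F}_A$ is the Boson (symmetric) Fock space over $L^2(A;\mathsf{k})$, with exponential vectors $\varepsilon(f)$, $f \in L^2(A;\mathsf{k})$, which are total and satisfy $\langle \varepsilon(f), \varepsilon(g)\rangle = \exp\langle f,g\rangle$. Write $\mathcal{F} = \mathcal{F}_{\mathbb{R}_+}$, $\mathcal{F}_{t)} = \mathcal{F}_{[0,t)}$, $\mathcal{F}_{[t} = \mathcal{F}_{[t,\infty)}$, with identity operators $I$, $I_{t)}$, $I_{[t}$ (so $\mathcal{F}_{0)} = \mathbb{C}$), and identify $\mathcal{F} \cong \mathcal{F}_{s)} \otimes \mathcal{F}_{[s}$ via $\varepsilon(f) \leftrightarrow \varepsilon(f|_{[0,s)}) \otimes \varepsilon(f|_{[s,\infty)})$. Stop times. A finite quantum stop time is a map $S$ from the Borel $\sigma$-algebra of $[0,\infty]$ to $B(\mathcal{F})$ such that: each $S(A)$ is an orthogonal projection; $A \mapsto \langle x, S(A) y\rangle$ is a complex measure for all $x,y \in \mathcal{F}$; $S([0,\infty]) = I$; $S([0,t]) \in B(\mathcal{F}_{t)}) \otimes I_{[t}$ for all $t \in (0,\infty)$; $S(\{0\}) = 0$; and $S(\{\infty\}) = 0$ (finiteness). Shifts. For $t \in \mathbb{R}_+$, $\theta_t$ is the isometric right shift on $L^2(\mathbb{R}_+;\mathsf{k})$,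 $(\theta_t f)(s) = f(s-t)$ if $s \ge t$ and $0$ if $s<t$, and $\Gamma_t : \mathcal{F} \to \mathcal{F}$ is the isometry with $\Gamma_t \varepsilon(f) = \varepsilon(\theta_t f)$; it maps $\mathcal{F}$ onto $\varepsilon(0|_{[0,t)}) \otimes \mathcal{F}_{[t} \cong \mathcal{F}_{[t}$. Also $\Gamma_\infty$ is the orthogonal projection onto $\mathbb{C}\varepsilon(0)$. Stopped shift. $\Gamma_S \in B(\mathcal{F})$ is the isometry given by $\Gamma_S x = \lim_\pi \sum_{j=1}^{n+1} S((\pi_{j-1},\pi_j]) \Gamma_{\pi_j} x$ for $x \in \mathcal{F}$ (norm limit over finite partitions $\pi = \{0 = \pi_0 < \cdots < \pi_{n+1} = \infty\}$ of $[0,\infty]$ ordered by refinement; the limit exists). CCR flow. For $t \in \mathbb{R}_+$, $\sigma_t : B(\mathcal{F}) \to B(\mathcal{F})$ is the unital $*$-homomorphism $\sigma_t(X) = I_{t)} \otimes \Gamma_t X \Gamma_t^*$, where here $\Gamma_t$ is regarded as an isometric isomorphism from $\mathcal{F}$ onto $\mathcal{F}_{[t}$ with inverse $\Gamma_t^*$. By convention $\sigma_\infty$ is the constant map on $B(\mathcal{F})$ with value $I$.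
   Formalization: As σ_∞(X)=I for all X, σ_{S,π} need not be linear (σ_{S,π}(0)=S((π_n,∞])); it is proved unital, multiplicative, *-preserving, with σ_{S,π}(cX+dY)=cσ_{S,π}(X)+dσ_{S,π}(Y)+(1−c−d)S((π_n,∞]), so linear when S((π_n,∞])=0. *)

theory Defs
  imports "HOL-Analysis.Analysis"
begin

section \<open>Complex Hilbert spaces and bounded operators\<close>

text \<open>The inner product is linear in the second variable.  Some of the axioms of
  the superclass \<^class>\<open>banach\<close> (e.g. the triangle inequality) are consequences of
  the ones listed here.\<close>

class complex_hilbert = banach +
  fixes scaleC :: "complex \<Rightarrow> 'a \<Rightarrow> 'a"  (infixr "*\<^sub>C" 75)
    and cinner :: "'a \<Rightarrow> 'a \<Rightarrow> complex"
  assumes scaleC_of_real: "complex_of_real r *\<^sub>C x = r *\<^sub>R x"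
    and scaleC_add_right: "c *\<^sub>C (x + y) = c *\<^sub>C x + c *\<^sub>C y"
    and scaleC_add_left: "(c + d) *\<^sub>C x = c *\<^sub>C x + d *\<^sub>C x"
    and scaleC_scaleC: "c *\<^sub>C d *\<^sub>C x = (c * d) *\<^sub>C x"
    and cinner_commute: "cinner x y = cnj (cinner y x)"
    and cinner_add_right: "cinner x (y + z) = cinner x y + cinner x z"
    and cinner_scaleC_right: "cinner x (c *\<^sub>C y) = c * cinner x y"
    and cinner_self: "cinner x x = complex_of_real ((norm x)\<^sup>2)"

instantiation complex :: complex_hilbert
begin
definition scaleC_complex :: "complex \<Rightarrow> complex \<Rightarrow> complex"
  where "scaleC_complex c x = c * x"
definition cinner_complex :: "complex \<Rightarrow> complex \<Rightarrow> complex"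
  where "cinner_complex x y = cnj x * y"
instance
  by standard
    (simp_all add: scaleC_complex_def cinner_complex_def scaleR_conv_of_real algebra_simps
      flip: complex_norm_square)
end

text \<open>Complex linear span, as the real linear span of all complex multiples.\<close>

definition cspan :: "'a::complex_hilbert set \<Rightarrow> 'a set"
  where "cspan A = span {c *\<^sub>C a | c a. a \<in> A}"

definition bounded_clinear :: "('a::complex_hilbert \<Rightarrow> 'b::complex_hilbert) \<Rightarrow> bool"
  where "bounded_clinear T \<longleftrightarrow> bounded_linear T \<and> (\<forall>c x. T (c *\<^sub>C x) = c *\<^sub>C T x)"

definition bounded_ops :: "('a::complex_hilbert \<Rightarrow> 'a) set"
  where "bounded_ops = {T. bounded_clinear T}"

text \<open>Bounded operators of a closed subspace \<open>V\<close> into itself; values off \<open>V\<close> are irrelevant.\<close>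

definition bounded_ops_on :: "'a::complex_hilbert set \<Rightarrow> ('a \<Rightarrow> 'a) set"
  where "bounded_ops_on V = {T. (\<forall>x\<in>V. T x \<in> V) \<and> (\<forall>x\<in>V. \<forall>y\<in>V. T (x + y) = T x + T y)
    \<and> (\<forall>c. \<forall>x\<in>V. T (c *\<^sub>C x) = c *\<^sub>C T x) \<and> (\<exists>K. \<forall>x\<in>V. norm (T x) \<le> K * norm x)}"

definition adj :: "('a::complex_hilbert \<Rightarrow> 'a) \<Rightarrow> 'a \<Rightarrow> 'a"
  where "adj T = (THE T'. T' \<in> bounded_ops \<and> (\<forall>x y. cinner (T' x) y = cinner x (T y)))"

definition orth_projection :: "('a::complex_hilbert \<Rightarrow> 'a) \<Rightarrow> bool"
  where "orth_projection P \<longleftrightarrow> P \<in> bounded_ops \<and> P \<circ> P = P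
    \<and> (\<forall>x y. cinner (P x) y = cinner x (P y))"

text \<open>Unital, multiplicative and adjoint-preserving maps of the algebra of bounded operators
  into itself; linearity is added in the next definition.\<close>

definition unital_star_multiplicative ::
    "(('a::complex_hilbert \<Rightarrow> 'a) \<Rightarrow> 'a \<Rightarrow> 'a) \<Rightarrow> bool"
  where "unital_star_multiplicative \<phi> \<longleftrightarrow>
    (\<forall>X\<in>bounded_ops. \<phi> X \<in> bounded_ops) \<and>
    \<phi> id = id \<and>
    (\<forall>X\<in>bounded_ops. \<forall>Y\<in>bounded_ops. \<phi> (X \<circ> Y) = \<phi> X \<circ> \<phi> Y) \<and>
    (\<forall>X\<in>bounded_ops. \<phi> (adj X) = adj (\<phi> X))"

definition unital_star_hom :: "(('a::complex_hilbert \<Rightarrow> 'a) \<Rightarrow> 'a \<Rightarrow> 'a) \<Rightarrow> bool"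
  where "unital_star_hom \<phi> \<longleftrightarrow> unital_star_multiplicative \<phi> \<and>
    (\<forall>X\<in>bounded_ops. \<forall>Y\<in>bounded_ops. \<phi> (\<lambda>x. X x + Y x) = (\<lambda>x. \<phi> X x + \<phi> Y x)) \<and>
    (\<forall>c. \<forall>X\<in>bounded_ops. \<phi> (\<lambda>x. c *\<^sub>C X x) = (\<lambda>x. c *\<^sub>C \<phi> X x))"


section \<open>Fock space\<close>

text \<open>Square-integrable functions on the half line are functions on the reals whose values on
  the negative half line are ignored.  Functions are not identified when they agree almost
  everywhere; the condition in \<open>fock_space\<close> below forces the exponential map to respect this
  identification.  Measurability is in the sense of Bochner, because the complex Hilbert
  space of values need not be separable.\<close>

abbreviation half_line :: "real measure"
  where "half_line \<equiv> lebesgue_on {0..}"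

definition strongly_measurable :: "'a measure \<Rightarrow> ('a \<Rightarrow> 'b::topological_space) \<Rightarrow> bool"
  where "strongly_measurable M f \<longleftrightarrow>
    (\<exists>s. (\<forall>i::nat. simple_function M (s i)) \<and> (AE t in M. (\<lambda>i. s i t) \<longlonglongrightarrow> f t))"

definition L2 :: "(real \<Rightarrow> 'k::complex_hilbert) set"
  where "L2 = {f. strongly_measurable half_line f \<and> integrable half_line (\<lambda>t. (norm (f t))\<^sup>2)}"

definition L2_inner :: "(real \<Rightarrow> 'k::complex_hilbert) \<Rightarrow> (real \<Rightarrow> 'k) \<Rightarrow> complex"
  where "L2_inner f g = (LINT t|half_line. cinner (f t) (g t))"

definition cut :: "real set \<Rightarrow> (real \<Rightarrow> 'k::complex_hilbert) \<Rightarrow> real \<Rightarrow> 'k"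
  where "cut A f = (\<lambda>s. if s \<in> A then f s else 0)"

definition right_shift :: "real \<Rightarrow> (real \<Rightarrow> 'k::complex_hilbert) \<Rightarrow> real \<Rightarrow> 'k"
  where "right_shift t f = (\<lambda>s. if s \<ge> t then f (s - t) else 0)"

text \<open>The whole type \<open>'f\<close>, with exponential map \<open>\<epsilon>\<close>, is the Boson Fock space over the
  space of square-integrable functions: the exponential vectors are total and have the
  prescribed inner products.  This determines the pair up to a unique unitary operator
  that intertwines the exponential maps.\<close>

definition fock_space :: "((real \<Rightarrow> 'k::complex_hilbert) \<Rightarrow> 'f::complex_hilbert) \<Rightarrow> bool"
  where "fock_space \<epsilon> \<longleftrightarrow>
    (\<forall>f\<in>L2. \<forall>g\<in>L2. cinner (\<epsilon> f) (\<epsilon> g) = exp (L2_inner f g)) \<and>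
    closure (cspan (\<epsilon> ` L2)) = UNIV"

text \<open>The Fock space over the functions on \<open>A\<close>, realised in the full Fock space by extending
  functions by zero.\<close>

definition fock_sub ::
    "((real \<Rightarrow> 'k::complex_hilbert) \<Rightarrow> 'f::complex_hilbert) \<Rightarrow> real set \<Rightarrow> 'f set"
  where "fock_sub \<epsilon> A = closure (cspan ((\<lambda>f. \<epsilon> (cut A f)) ` L2))"

text \<open>The vector corresponding to \<open>x \<otimes> y\<close>, for \<open>x\<close> in the Fock space over \<open>[0,t)\<close> and \<open>y\<close> in
  that over \<open>[t,\<infinity>)\<close>, when \<open>\<epsilon> f\<close> is identified with the tensor product of the exponential
  vectors of the restrictions of \<open>f\<close>: the right-hand side is the inner product of two
  product vectors, and the exponential vectors are total.\<close>

definition fock_tensor ::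
    "((real \<Rightarrow> 'k::complex_hilbert) \<Rightarrow> 'f::complex_hilbert) \<Rightarrow> real \<Rightarrow> 'f \<Rightarrow> 'f \<Rightarrow> 'f"
  where "fock_tensor \<epsilon> t x y = (THE z. \<forall>f\<in>L2.
    cinner (\<epsilon> f) z = cinner (\<epsilon> (cut {0..<t} f)) x * cinner (\<epsilon> (cut {t..} f)) y)"

text \<open>The operator \<open>A \<otimes> B\<close>.\<close>

definition tensor_op ::
    "((real \<Rightarrow> 'k::complex_hilbert) \<Rightarrow> 'f::complex_hilbert) \<Rightarrow> real
      \<Rightarrow> ('f \<Rightarrow> 'f) \<Rightarrow> ('f \<Rightarrow> 'f) \<Rightarrow> 'f \<Rightarrow> 'f"
  where "tensor_op \<epsilon> t A B = (THE T. T \<in> bounded_ops \<and>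
    (\<forall>x\<in>fock_sub \<epsilon> {0..<t}. \<forall>y\<in>fock_sub \<epsilon> {t..}.
      T (fock_tensor \<epsilon> t x y) = fock_tensor \<epsilon> t (A x) (B y)))"


section \<open>Shifts and the CCR flow\<close>

text \<open>Extended times in \<open>[0,\<infinity>]\<close> are elements of \<^typ>\<open>ennreal\<close>.\<close>

definition shift_op ::
    "((real \<Rightarrow> 'k::complex_hilbert) \<Rightarrow> 'f::complex_hilbert) \<Rightarrow> ennreal \<Rightarrow> 'f \<Rightarrow> 'f"
  where "shift_op \<epsilon> t =
    (if t = \<infinity> then (THE P. orth_projection P \<and> range P = range (\<lambda>c. c *\<^sub>C \<epsilon> (\<lambda>_. 0)))
     else (THE T. T \<in> bounded_ops \<and> (\<forall>f\<in>L2. T (\<epsilon> f) = \<epsilon> (right_shift (enn2real t) f))))"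

text \<open>For finite \<open>t\<close> the shift maps the Fock space onto that over \<open>[t,\<infinity>)\<close>, and its adjoint
  restricts to the inverse there.\<close>

definition ccr_flow ::
    "((real \<Rightarrow> 'k::complex_hilbert) \<Rightarrow> 'f::complex_hilbert) \<Rightarrow> ennreal
      \<Rightarrow> ('f \<Rightarrow> 'f) \<Rightarrow> 'f \<Rightarrow> 'f"
  where "ccr_flow \<epsilon> t X =
    (if t = \<infinity> then id
     else tensor_op \<epsilon> (enn2real t) id (shift_op \<epsilon> t \<circ> X \<circ> adj (shift_op \<epsilon> t)))"


section \<open>Quantum stop times\<close>

definition finite_stop_time ::
    "((real \<Rightarrow> 'k::complex_hilbert) \<Rightarrow> 'f::complex_hilbert) \<Rightarrow> (ennreal set \<Rightarrow> 'f \<Rightarrow> 'f) \<Rightarrow> bool"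
  where "finite_stop_time \<epsilon> S \<longleftrightarrow>
    (\<forall>A\<in>sets borel. orth_projection (S A)) \<and>
    (\<forall>x y. \<forall>A::nat \<Rightarrow> ennreal set. range A \<subseteq> sets borel \<and> disjoint_family A \<longrightarrow>
      (\<lambda>n. cinner x (S (A n) y)) sums cinner x (S (\<Union>n. A n) y)) \<and>
    S UNIV = id \<and>
    (\<forall>t>0. \<exists>A\<in>bounded_ops_on (fock_sub \<epsilon> {0..<t}). S {0..ennreal t} = tensor_op \<epsilon> t A id) \<and>
    S {0} = (\<lambda>_. 0) \<and>
    S {\<infinity>} = (\<lambda>_. 0)"


section \<open>Partitions and limits along refinement\<close>

definition time_partition :: "ennreal set \<Rightarrow> bool"
  where "time_partition P \<longleftrightarrow> finite P \<and> 0 \<in> P \<and> \<infinity> \<in> P"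

text \<open>The points \<open>\<pi>\<^sub>0 < \<dots> < \<pi>\<^sub>n\<^sub>+\<^sub>1\<close> of a partition, where \<open>n + 2\<close> is its cardinality.\<close>

definition pt :: "ennreal set \<Rightarrow> nat \<Rightarrow> ennreal"
  where "pt P j = sorted_list_of_set P ! j"

definition refinement :: "ennreal set filter"
  where "refinement =
    (INF P\<in>Collect time_partition. principal {Q. time_partition Q \<and> P \<subseteq> Q})"

lemma eventually_refinement:
  "eventually \<Phi> refinement \<longleftrightarrow>
    (\<exists>P. time_partition P \<and> (\<forall>Q. time_partition Q \<and> P \<subseteq> Q \<longrightarrow> \<Phi> Q))"
  unfolding refinement_def
proof (subst eventually_INF_base)
  show "Collect time_partition \<noteq> {}"
    by (auto simp: time_partition_def intro!: exI[of _ "{0, \<infinity>}"])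
next
  fix P Q assume "P \<in> Collect time_partition" "Q \<in> Collect time_partition"
  then show "\<exists>R\<in>Collect time_partition. principal {Q. time_partition Q \<and> R \<subseteq> Q} \<le>
      inf (principal {R. time_partition R \<and> P \<subseteq> R}) (principal {R. time_partition R \<and> Q \<subseteq> R})"
    by (intro bexI[of _ "P \<union> Q"]) (auto simp: time_partition_def)
qed (auto simp: eventually_principal)

lemma refinement_neq_bot: "refinement \<noteq> bot"
  unfolding trivial_limit_def eventually_refinement by auto


section \<open>The stopped shift and the stopped flow\<close>

definition stopped_shift ::
    "((real \<Rightarrow> 'k::complex_hilbert) \<Rightarrow> 'f::complex_hilbert) \<Rightarrow> (ennreal set \<Rightarrow> 'f \<Rightarrow> 'f)
      \<Rightarrow> 'f \<Rightarrow> 'f"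
  where "stopped_shift \<epsilon> S x = Lim refinement
    (\<lambda>P. \<Sum>j=1..<card P. S {pt P (j - 1)<..pt P j} (shift_op \<epsilon> (pt P j) x))"

text \<open>The flow at time \<open>\<infinity>\<close> is the constant map with value \<^term>\<open>id\<close>, so the last summand of
  \<open>partition_flow\<close> is \<open>S (\<pi>\<^sub>n,\<infinity>]\<close> for every \<open>X\<close>.  Consequently \<open>partition_flow\<close> is unital,
  multiplicative and adjoint-preserving, but its value at a linear combination
  \<open>c X + d Y\<close> differs from the linear combination of its values by
  \<open>(1 - c - d) S (\<pi>\<^sub>n,\<infinity>]\<close>; it is linear exactly when \<open>S (\<pi>\<^sub>n,\<infinity>] = 0\<close>.\<close>

definition partition_flow ::
    "((real \<Rightarrow> 'k::complex_hilbert) \<Rightarrow> 'f::complex_hilbert) \<Rightarrow> (ennreal set \<Rightarrow> 'f \<Rightarrow> 'f)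
      \<Rightarrow> ennreal set \<Rightarrow> ('f \<Rightarrow> 'f) \<Rightarrow> 'f \<Rightarrow> 'f"
  where "partition_flow \<epsilon> S P X =
    (\<lambda>x. \<Sum>j=1..<card P. ccr_flow \<epsilon> (pt P j) X (S {pt P (j - 1)<..pt P j} x))"

text \<open>The limit in the strong operator topology, that is, pointwise in norm.\<close>

definition stopped_flow ::
    "((real \<Rightarrow> 'k::complex_hilbert) \<Rightarrow> 'f::complex_hilbert) \<Rightarrow> (ennreal set \<Rightarrow> 'f \<Rightarrow> 'f)
      \<Rightarrow> ('f \<Rightarrow> 'f) \<Rightarrow> 'f \<Rightarrow> 'f"
  where "stopped_flow \<epsilon> S X = (\<lambda>x. Lim refinement (\<lambda>P. partition_flow \<epsilon> S P X x))"

end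

theory Submission
  imports Defs
begin

text \<open>The operator \<open>ccr_flow \<epsilon> t X\<close> acts on the future factor of the decomposition of the Fock space
  at time \<open>t\<close> and therefore commutes with every operator that is adapted at \<open>t\<close>, in particular
  with the spectral projections of the stop time on intervals ending at \<open>t\<close>.  These projections
  are mutually orthogonal, which makes \<open>partition_flow\<close> multiplicative, \<open>*\<close>-preserving and uniformly
  bounded.  When a partition is refined, an exponential vector \<open>x\<close> moves by a sum of orthogonal
  terms \<open>E (\<sigma>\<^sub>q(X) - \<sigma>\<^sub>p(X)) x\<close> with \<open>q \<le> p\<close> and \<open>E\<close> adapted at \<open>q\<close>.  By the semigroup law the difference
  is \<open>\<sigma>\<^sub>q(X - \<sigma>\<^sub>p\<^sub>-\<^sub>q(X))\<close>, so the norm of each term factorises as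
  \<open>\<parallel>E x\<parallel> \<parallel>(\<sigma>\<^sub>q(X) - \<sigma>\<^sub>p(X)) x\<parallel> / \<parallel>x\<parallel>\<close>; the second factor is uniformly small on bounded time
  intervals by strong continuity of the flow, and finiteness of the stop time controls the tail.
  The stopped shift is treated in the same way, with the vacuum vector in place of \<open>x\<close>.\<close>

subsection \<open>Hilbert space geometry\<close>

text \<open>The objects of the statement are largely definite descriptions: \<open>adj\<close>,
  \<open>fock_tensor\<close>, \<open>tensor_op\<close>, \<open>shift_op\<close>. Nothing can be
  computed before each has a witness and a uniqueness argument. Uniqueness mostly comes from
  totality of the exponential vectors, existence from Riesz representation and from norm-controlled
  extension of maps that are prescribed on generators. The space of values may be non-separable, so
  measurability is Bochner measurability, and continuity of translations is derived from simple
  functions. Exponential vectors are the right test vectors because they factorise at every time at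
  once: a single vector can be split at the end of each cell, whatever the partition. A uniform
  operator bound then carries convergence to all vectors. The convention that the flow at
  \<infinity> is the identity for every operator shapes the algebra: it costs linearity by a term on
  the last cell, forces bounds with \<open>K \<ge> 1\<close>, and disturbs the intertwining with the
  shifts on that same cell. These defects vanish in the limit because the stop time has no mass at
  \<infinity>.\<close>

lemma cinner_add_left: "cinner (x + y) z = cinner x z + cinner y z"
  for x :: "'a::complex_hilbert"
  by (metis cinner_add_right cinner_commute complex_cnj_add)

lemma cinner_scaleC_left: "cinner (c *\<^sub>C x) z = cnj c * cinner x z"
  for x :: "'a::complex_hilbert"
  by (metis cinner_scaleC_right cinner_commute complex_cnj_mult)

lemma cinner_scaleR_right: "cinner x (r *\<^sub>R y) = r *\<^sub>R cinner x y"
  for x :: "'a::complex_hilbert"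
  by (simp add: scaleR_conv_of_real cinner_scaleC_right flip: scaleC_of_real)

lemma cinner_scaleR_left: "cinner (r *\<^sub>R x) y = r *\<^sub>R cinner x y"
  for x :: "'a::complex_hilbert"
  by (simp add: scaleR_conv_of_real cinner_scaleC_left flip: scaleC_of_real)

lemma cinner_zero_right [simp]: "cinner x 0 = 0" for x :: "'a::complex_hilbert"
  using cinner_scaleR_right[of x 0 0] by simp

lemma cinner_zero_left [simp]: "cinner 0 x = 0" for x :: "'a::complex_hilbert"
  using cinner_scaleR_left[of 0 0 x] by simp

lemma cinner_minus_right: "cinner x (- y) = - cinner x y" for x :: "'a::complex_hilbert"
  using cinner_scaleR_right[of x "-1" y] by simp

lemma cinner_minus_left: "cinner (- x) y = - cinner x y" for x :: "'a::complex_hilbert"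
  using cinner_scaleR_left[of "-1" x y] by simp

lemma cinner_diff_right: "cinner x (y - z) = cinner x y - cinner x z"
  for x :: "'a::complex_hilbert"
  using cinner_add_right[of x y "- z"] by (simp add: cinner_minus_right)

lemma cinner_diff_left: "cinner (x - y) z = cinner x z - cinner y z"
  for x :: "'a::complex_hilbert"
  using cinner_add_left[of x "- y" z] by (simp add: cinner_minus_left)

lemmas cinner_simps = cinner_add_left cinner_add_right cinner_diff_left cinner_diff_right
  cinner_scaleC_left cinner_scaleC_right

lemma cinner_sum_right: "cinner x (\<Sum>i\<in>I. f i) = (\<Sum>i\<in>I. cinner x (f i))"
  for x :: "'a::complex_hilbert"
  by (induction I rule: infinite_finite_induct) (auto simp: cinner_add_right)

lemma cinner_sum_left: "cinner (\<Sum>i\<in>I. f i) x = (\<Sum>i\<in>I. cinner (f i) x)"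
  for x :: "'a::complex_hilbert"
  by (induction I rule: infinite_finite_induct) (auto simp: cinner_add_left)

lemma norm_sq_cinner: "(norm x)\<^sup>2 = Re (cinner x x)" for x :: "'a::complex_hilbert"
  by (simp add: cinner_self)

lemma cinner_eq_zero_iff: "cinner x x = 0 \<longleftrightarrow> x = 0" for x :: "'a::complex_hilbert"
  by (simp add: cinner_self)

lemma norm_sq_diff:
  "(norm (x - y))\<^sup>2 = (norm x)\<^sup>2 + (norm y)\<^sup>2 - 2 * Re (cinner x y)"
  for x :: "'a::complex_hilbert"
proof -
  have "Re (cinner y x) = Re (cinner x y)"
    by (metis cinner_commute complex_cnj(1) complex_surj complex.sel(1))
  then show ?thesis by (simp add: norm_sq_cinner cinner_simps)
qed

lemma norm_sq_add:
  "(norm (x + y))\<^sup>2 = (norm x)\<^sup>2 + (norm y)\<^sup>2 + 2 * Re (cinner x y)"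
  for x :: "'a::complex_hilbert"
  using norm_sq_diff[of x "- y"] by (simp add: cinner_minus_right)

text \<open>The class ties the norm to complex scalars only through \<open>cinner_self\<close>, so
  complex homogeneity has to be read off the inner product.\<close>

lemma norm_scaleC [simp]: "norm (c *\<^sub>C x) = cmod c * norm x" for x :: "'a::complex_hilbert"
proof -
  have "(norm (c *\<^sub>C x))\<^sup>2 = Re ((c * cnj c) * cinner x x)"
    by (simp add: norm_sq_cinner[of "c *\<^sub>C x"] cinner_simps mult.assoc mult.left_commute)
  also have "(c * cnj c) * cinner x x = complex_of_real ((cmod c * norm x)\<^sup>2)"
    by (simp add: cinner_self power_mult_distrib flip: complex_norm_square)
  also have "Re \<dots> = (cmod c * norm x)\<^sup>2" by (rule Re_complex_of_real)
  finally show ?thesis by simp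
qed

lemma cauchy_schwarz: "cmod (cinner x y) \<le> norm x * norm y" for x :: "'a::complex_hilbert"
proof (cases "y = 0")
  case False
  \<comment> \<open>The coefficient for which \<open>x - c *\<^sub>C y\<close> is orthogonal to
    \<open>y\<close>; non-negativity of its squared norm is the claim.\<close>
  define c where "c = cinner y x / cinner y y"
  have ny: "norm y > 0" using False by simp
  have "0 \<le> (norm (x - c *\<^sub>C y))\<^sup>2" by simp
  also have "\<dots> = (norm x)\<^sup>2 + (cmod c * norm y)\<^sup>2 - 2 * Re (c * cinner x y)"
    by (simp add: norm_sq_diff cinner_simps)
  also have "c * cinner x y = complex_of_real ((cmod (cinner x y))\<^sup>2 / (norm y)\<^sup>2)"
    using complex_norm_square[of "cinner x y"]
    by (simp add: c_def cinner_self cinner_commute[of y x] mult.commute)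
  also have "cmod c * norm y = cmod (cinner x y) / norm y"
    using ny by (simp add: c_def norm_divide cinner_self cinner_commute[of y x] power2_eq_square
        norm_mult)
  finally have "(cmod (cinner x y))\<^sup>2 / (norm y)\<^sup>2 \<le> (norm x)\<^sup>2"
    by (simp add: power_divide)
  then have "(cmod (cinner x y))\<^sup>2 \<le> (norm x * norm y)\<^sup>2"
    using ny by (simp add: divide_le_eq power_mult_distrib)
  then show ?thesis by (simp add: power2_le_iff_abs_le)
qed simp

lemma bounded_bilinear_cinner: "bounded_bilinear (cinner :: 'a::complex_hilbert \<Rightarrow> 'a \<Rightarrow> complex)"
  by (rule bounded_bilinear.intro)
    (auto simp: cinner_simps cinner_scaleR_left cinner_scaleR_right
      intro!: exI[of _ 1] cauchy_schwarz)

lemma bounded_linear_scaleC: "bounded_linear (\<lambda>x :: 'a::complex_hilbert. c *\<^sub>C x)"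
proof (rule bounded_linear_intro[of _ "cmod c"])
  show "c *\<^sub>C r *\<^sub>R x = r *\<^sub>R c *\<^sub>C x" for r :: real and x :: 'a
    by (metis scaleC_of_real scaleC_scaleC mult.commute)
qed (auto simp: scaleC_add_right)

lemmas tendsto_cinner = bounded_bilinear.tendsto[OF bounded_bilinear_cinner]
lemmas tendsto_scaleC = bounded_linear.tendsto[OF bounded_linear_scaleC]

lemma scaleC_one [simp]: "1 *\<^sub>C x = x" for x :: "'a::complex_hilbert"
  using scaleC_of_real[of 1 x] by simp

lemma scaleC_zero_left [simp]: "0 *\<^sub>C x = 0" for x :: "'a::complex_hilbert"
  using scaleC_of_real[of 0 x] by simp

lemma scaleC_zero_right [simp]: "c *\<^sub>C 0 = (0 :: 'a::complex_hilbert)"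
  using scaleC_scaleC[of c 0 0] by simp

lemma scaleC_diff_left: "(c - d) *\<^sub>C x = c *\<^sub>C x - d *\<^sub>C x" for x :: "'a::complex_hilbert"
  using scaleC_add_left[of "c - d" d x] by (simp add: algebra_simps)

lemma scaleC_sum_right: "c *\<^sub>C (\<Sum>i\<in>I. f i) = (\<Sum>i\<in>I. c *\<^sub>C (f i :: 'a::complex_hilbert))"
  by (rule linear_sum[OF bounded_linear.linear[OF bounded_linear_scaleC]])

lemma scaleC_scaleR: "c *\<^sub>C r *\<^sub>R x = r *\<^sub>R c *\<^sub>C x" for x :: "'a::complex_hilbert"
  by (metis scaleC_of_real scaleC_scaleC mult.commute)

lemma cinner_ext: "x = y" if "\<And>z. cinner z x = cinner z y" for x :: "'a::complex_hilbert"
  using that[of "x - y"] cinner_eq_zero_iff[of "x - y"] by (simp add: cinner_diff_right)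

section \<open>Bounded operators, Riesz representation, adjoints and projections\<close>

lemma bounded_opsI:
  assumes "\<And>x y. T (x + y) = T x + T y" "\<And>c x. T (c *\<^sub>C x) = c *\<^sub>C T x"
    "\<And>x. norm (T x) \<le> K * norm x"
  shows "T \<in> bounded_ops"
  unfolding bounded_ops_def bounded_clinear_def
  using assms by (auto intro!: bounded_linear_intro[of _ K] simp: mult.commute
      simp flip: scaleC_of_real)

lemma bounded_ops_bounded_linear: "T \<in> bounded_ops \<Longrightarrow> bounded_linear T"
  by (simp add: bounded_ops_def bounded_clinear_def)

lemma bounded_ops_scaleC: "T \<in> bounded_ops \<Longrightarrow> T (c *\<^sub>C x) = c *\<^sub>C T x"
  by (simp add: bounded_ops_def bounded_clinear_def)

lemma bounded_ops_add: "T \<in> bounded_ops \<Longrightarrow> T (x + y) = T x + T y"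
  by (simp add: bounded_ops_bounded_linear linear_add bounded_linear.linear)

lemma bounded_ops_diff: "T \<in> bounded_ops \<Longrightarrow> T (x - y) = T x - T y"
  by (simp add: bounded_ops_bounded_linear linear_diff bounded_linear.linear)

lemma bounded_ops_zero: "T \<in> bounded_ops \<Longrightarrow> T 0 = 0"
  by (simp add: bounded_ops_bounded_linear linear_0 bounded_linear.linear)

lemma bounded_ops_sum: "T \<in> bounded_ops \<Longrightarrow> T (\<Sum>i\<in>I. f i) = (\<Sum>i\<in>I. T (f i))"
  by (simp add: bounded_ops_bounded_linear linear_sum bounded_linear.linear)

lemma bounded_ops_bound:
  assumes "T \<in> bounded_ops" obtains K where "K > 0" "\<And>x. norm (T x) \<le> K * norm x"
  using bounded_linear.pos_bounded[OF bounded_ops_bounded_linear[OF assms]]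
  by (metis mult.commute)

lemmas bounded_ops_tendsto = bounded_linear.tendsto[OF bounded_ops_bounded_linear]

lemma bounded_ops_id: "id \<in> bounded_ops"
  by (rule bounded_opsI[where K = 1]) auto

lemma bounded_ops_comp: "A \<in> bounded_ops \<Longrightarrow> B \<in> bounded_ops \<Longrightarrow> A \<circ> B \<in> bounded_ops"
  unfolding bounded_ops_def bounded_clinear_def
  using bounded_linear_compose[of A B] by (auto simp: o_def)

lemma bounded_ops_plus:
  "A \<in> bounded_ops \<Longrightarrow> B \<in> bounded_ops \<Longrightarrow> (\<lambda>x. A x + B x) \<in> bounded_ops"
  unfolding bounded_ops_def bounded_clinear_def
  by (auto intro: bounded_linear_add simp: scaleC_add_right)

lemma bounded_ops_scale: "A \<in> bounded_ops \<Longrightarrow> (\<lambda>x. c *\<^sub>C A x) \<in> bounded_ops"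
  unfolding bounded_ops_def bounded_clinear_def
  by (auto intro: bounded_linear_compose[OF bounded_linear_scaleC] simp: scaleC_scaleC mult.commute)

lemma bounded_ops_zero_op: "(\<lambda>_. 0) \<in> bounded_ops"
  by (rule bounded_opsI[where K = 0]) auto

lemma bounded_ops_sum_ops:
  "(\<And>i. i \<in> I \<Longrightarrow> T i \<in> bounded_ops) \<Longrightarrow> (\<lambda>x. \<Sum>i\<in>I. T i x) \<in> bounded_ops"
  by (induction I rule: infinite_finite_induct)
    (auto intro: bounded_ops_zero_op bounded_ops_plus)

text \<open>The representing vector minimises \<open>\<parallel>x\<parallel>\<^sup>2 - 2 Re (\<phi> x)\<close>.\<close>

lemma riesz:
  fixes \<phi> :: "'a::complex_hilbert \<Rightarrow> complex"
  assumes lin: "bounded_linear \<phi>" and sc: "\<And>c x. \<phi> (c *\<^sub>C x) = c * \<phi> x"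
  shows "\<exists>z. \<forall>x. \<phi> x = cinner z x"
proof -
  obtain K where K: "\<And>x. cmod (\<phi> x) \<le> norm x * K"
    using bounded_linear.bounded[OF lin] by blast
  interpret \<phi>: bounded_linear \<phi> by fact
  define J where "J x = (norm x)\<^sup>2 - 2 * Re (\<phi> x)" for x
  have lower: "- K\<^sup>2 \<le> J x" for x
  proof -
    have "Re (\<phi> x) \<le> norm x * K"
      using K[of x] complex_Re_le_cmod[of "\<phi> x"] by linarith
    moreover have "0 \<le> (norm x - K)\<^sup>2" by simp
    ultimately show ?thesis by (simp add: J_def power2_eq_square algebra_simps)
  qed
  define m where "m = (INF x. J x)"
  have bdd: "bdd_below (range J)" using lower by (intro bdd_belowI[of _ "- K\<^sup>2"]) auto
  have mle: "m \<le> J x" for x unfolding m_def using bdd by (rule cINF_lower) simp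
  have "\<exists>x. J x < m + 1 / real (Suc n)" for n
    using cINF_less_iff[of UNIV J "m + 1 / real (Suc n)"] bdd unfolding m_def by simp
  then obtain X where X: "\<And>n. J (X n) < m + 1 / real (Suc n)" by metis
  \<comment> \<open>The parallelogram law; the linear part of \<open>J\<close> cancels, so two
    near-minimisers must be close to each other.\<close>
  have par: "(norm (x - y))\<^sup>2 = 2 * J x + 2 * J y - 4 * J ((1/2) *\<^sub>R (x + y))" for x y
  proof -
    have "(norm ((1/2) *\<^sub>R (x + y)))\<^sup>2 = (norm (x + y))\<^sup>2 / 4" by (simp add: power_divide)
    then show ?thesis
      by (simp add: J_def norm_sq_diff norm_sq_add \<phi>.add \<phi>.scaleR field_simps)
  qed
  have "Cauchy X"
  proof (rule CauchyI)
    fix e :: real assume "e > 0"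
    \<comment> \<open>Each of the two near-minimisers exceeds \<open>m\<close> by less than
      \<open>1 / real (Suc N)\<close> and enters \<open>par\<close> with weight 2, hence the
      4.\<close>
    obtain N where N: "4 / real (Suc N) < e\<^sup>2"
      using reals_Archimedean[of "e\<^sup>2 / 4"] \<open>e > 0\<close> by (auto simp: field_simps)
    have "norm (X a - X b) < e" if "a \<ge> N" "b \<ge> N" for a b
    proof -
      have "1 / real (Suc k) \<le> 1 / real (Suc N)" if "k \<ge> N" for k
        using that by (simp add: frac_le)
      then have "J (X a) < m + 1 / real (Suc N)" "J (X b) < m + 1 / real (Suc N)"
        using X[of a] X[of b] that by fastforce+
      then have "(norm (X a - X b))\<^sup>2 < 4 / real (Suc N)"
        using mle[of "(1/2) *\<^sub>R (X a + X b)"] unfolding par by linarith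
      then have "(norm (X a - X b))\<^sup>2 < e\<^sup>2" using N by linarith
      then show ?thesis using \<open>e > 0\<close> by (simp add: power2_less_imp_less)
    qed
    then show "\<exists>M. \<forall>a\<ge>M. \<forall>b\<ge>M. norm (X a - X b) < e" by blast
  qed
  then obtain z where z: "X \<longlonglongrightarrow> z" using Cauchy_convergent convergent_def by blast
  have "(\<lambda>n. J (X n)) \<longlonglongrightarrow> J z"
    unfolding J_def by (intro tendsto_intros z \<phi>.tendsto)
  moreover have "(\<lambda>n. m + 1 / real (Suc n)) \<longlonglongrightarrow> m + 0"
    using LIMSEQ_inverse_real_of_nat by (intro tendsto_intros) (simp add: inverse_eq_divide)
  ultimately have "J z \<le> m"
    using LIMSEQ_le[of "\<lambda>n. J (X n)" "J z" "\<lambda>n. m + 1 / real (Suc n)" "m"] X[THEN less_imp_le]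
    by simp
  then have min: "J z \<le> J x" for x using mle[of x] by linarith
  have Re_eq: "Re (\<phi> y) = Re (cinner z y)" for y
  proof -
    define b where "b = Re (cinner z y) - Re (\<phi> y)"
    \<comment> \<open>First variation: along the line \<open>z + r *\<^sub>R y\<close> the
      functional is a quadratic in \<open>r\<close> with minimum at 0, so its linear coefficient has
      to vanish.\<close>
    have *: "0 \<le> r\<^sup>2 * (norm y)\<^sup>2 + 2 * r * b" for r
    proof -
      have "J (z + r *\<^sub>R y) = J z + r\<^sup>2 * (norm y)\<^sup>2 + 2 * r * b"
        by (simp add: J_def b_def norm_sq_add cinner_scaleR_right \<phi>.add \<phi>.scaleR
            power_mult_distrib algebra_simps)
      then show ?thesis using min[of "z + r *\<^sub>R y"] by linarith
    qed
    have "b = 0"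
    proof (rule ccontr)
      assume "b \<noteq> 0"
      \<comment> \<open>The step \<open>r = - b / s\<close> would push the quadratic below 0; adding
        1 keeps \<open>s\<close> positive also for \<open>y = 0\<close>.\<close>
      define s where "s = (norm y)\<^sup>2 + 1"
      have s: "s > 0" "(norm y)\<^sup>2 < 2 * s"
        using zero_le_power2[of "norm y"] by (auto simp: s_def add_nonneg_pos)
      have "(- b / s)\<^sup>2 * (norm y)\<^sup>2 + 2 * (- b / s) * b = (b\<^sup>2 / s\<^sup>2) * ((norm y)\<^sup>2 - 2 * s)"
        using s(1) by (simp add: power_divide right_diff_distrib power2_eq_square)
      also have "\<dots> < 0" using s \<open>b \<noteq> 0\<close> by (intro mult_pos_neg) auto
      finally show False using *[of "- b / s"] by linarith
    qed
    then show ?thesis by (simp add: b_def)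
  qed
  \<comment> \<open>The imaginary part is, up to sign, the real part at
    \<open>\<i> *\<^sub>C x\<close>.\<close>
  have "\<phi> x = cinner z x" for x
    using Re_eq[of x] Re_eq[of "\<i> *\<^sub>C x"] by (simp add: sc cinner_scaleC_right complex_eq_iff)
  then show ?thesis by blast
qed

text \<open>The way to identify the definite description \<open>adj\<close>: a bounded candidate
  with the right inner products is enough.\<close>

lemma adj_unique:
  assumes T': "T' \<in> bounded_ops" and eq: "\<And>x y. cinner (T' x) y = cinner x (T y)"
  shows "adj T = T'"
  unfolding adj_def
proof (rule the_equality)
  fix T'' assume "T'' \<in> bounded_ops \<and> (\<forall>x y. cinner (T'' x) y = cinner x (T y))"
  then have "cinner y (T'' x) = cinner y (T' x)" for x y
    using eq cinner_commute by metis
  then show "T'' = T'" using cinner_ext by blast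
qed (use assms in auto)

text \<open>Riesz representation, applied for each \<open>x\<close> to the functional that sends
  \<open>y\<close> to \<open>cinner x (T y)\<close>. Linearity and the bound of \<open>T'\<close>
  are read off inner products, the bound by testing at \<open>T' x\<close> itself.\<close>

lemma adj_exists:
  assumes T: "T \<in> bounded_ops"
  shows "\<exists>T'. T' \<in> bounded_ops \<and> (\<forall>x y. cinner (T' x) y = cinner x (T y))"
proof -
  obtain K where K: "K > 0" "\<And>x. norm (T x) \<le> K * norm x" using bounded_ops_bound[OF T] by metis
  have "\<exists>z. \<forall>y. cinner x (T y) = cinner z y" for x
  proof (rule riesz)
    show "bounded_linear (\<lambda>y. cinner x (T y))"
      using bounded_linear_compose[OF bounded_bilinear.bounded_linear_right[OF bounded_bilinear_cinner]
          bounded_ops_bounded_linear[OF T]] by blast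
  qed (simp add: bounded_ops_scaleC[OF T] cinner_scaleC_right)
  then obtain T' where T': "\<And>x y. cinner x (T y) = cinner (T' x) y" by metis
  have eqI: "u = v" if "\<And>y. cinner u y = cinner v y" for u v :: 'a
    by (rule cinner_ext) (metis that cinner_commute)
  have "T' \<in> bounded_ops"
  proof (rule bounded_opsI[where K = K])
    show "T' (x + y) = T' x + T' y" for x y
      by (rule eqI) (simp add: cinner_add_left flip: T')
    show "T' (c *\<^sub>C x) = c *\<^sub>C T' x" for c x
      by (rule eqI) (simp add: cinner_scaleC_left flip: T')
    show "norm (T' x) \<le> K * norm x" for x
    proof (cases "T' x = 0")
      case False
      have "complex_of_real ((norm (T' x))\<^sup>2) = cinner x (T (T' x))"
        by (simp add: T' cinner_self)
      then have "(norm (T' x))\<^sup>2 \<le> norm x * norm (T (T' x))"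
        using cauchy_schwarz[of x "T (T' x)"] by (metis norm_of_real abs_power2)
      also have "\<dots> \<le> norm x * (K * norm (T' x))" using K by (intro mult_left_mono) auto
      finally show ?thesis using False by (simp add: power2_eq_square algebra_simps)
    qed (use K in simp)
  qed
  then show ?thesis using T' by metis
qed

lemma adj_bounded: "T \<in> bounded_ops \<Longrightarrow> adj T \<in> bounded_ops"
  and adj_cinner: "T \<in> bounded_ops \<Longrightarrow> cinner (adj T x) y = cinner x (T y)"
proof -
  assume "T \<in> bounded_ops"
  then obtain T' where T': "T' \<in> bounded_ops" "\<And>x y. cinner (T' x) y = cinner x (T y)"
    using adj_exists by blast
  then have "adj T = T'" by (rule adj_unique)
  then show "adj T \<in> bounded_ops" "cinner (adj T x) y = cinner x (T y)" using T' by simp_all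
qed

lemma adj_cinner': "T \<in> bounded_ops \<Longrightarrow> cinner x (adj T y) = cinner (T x) y"
  by (metis adj_cinner cinner_commute)

lemma orth_projection_norm:
  assumes "orth_projection P" shows "(norm (P x))\<^sup>2 = Re (cinner x (P x))"
  using assms unfolding orth_projection_def norm_sq_cinner by (metis comp_apply)

lemma orth_projection_contractive:
  assumes "orth_projection P" shows "norm (P x) \<le> norm x"
proof -
  have "(norm (P x))\<^sup>2 \<le> norm x * norm (P x)"
    using orth_projection_norm[OF assms, of x] cauchy_schwarz[of x "P x"]
      complex_Re_le_cmod[of "cinner x (P x)"] by linarith
  then show ?thesis by (cases "P x = 0") (auto simp: power2_eq_square)
qed

lemma orth_projection_bounded_ops: "orth_projection P \<Longrightarrow> P \<in> bounded_ops"
  by (simp add: orth_projection_def)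

lemma orth_projection_idem: "orth_projection P \<Longrightarrow> P (P x) = P x"
  by (metis orth_projection_def comp_apply)

lemma orth_projection_self_adjoint:
  "orth_projection P \<Longrightarrow> cinner (P x) y = cinner x (P y)"
  by (simp add: orth_projection_def)

text \<open>Pythagoras. It serves twice: for tensors with orthonormal second factors, and for the
  cells of a partition.\<close>

lemma norm_sq_sum_orthogonal:
  fixes v :: "'i \<Rightarrow> 'a::complex_hilbert"
  assumes "finite I" "\<And>i j. i \<in> I \<Longrightarrow> j \<in> I \<Longrightarrow> i \<noteq> j \<Longrightarrow> cinner (v i) (v j) = 0"
  shows "(norm (\<Sum>i\<in>I. v i))\<^sup>2 = (\<Sum>i\<in>I. (norm (v i))\<^sup>2)"
  using assms
proof (induction I rule: finite_induct)
  case (insert i I)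
  have "cinner (v i) (\<Sum>j\<in>I. v j) = 0"
    using insert by (auto simp: cinner_sum_right intro!: sum.neutral)
  then show ?case using insert by (simp add: norm_sq_add)
qed simp

subsection \<open>Extension of operators from total families\<close>

definition csubspace :: "'a::complex_hilbert set \<Rightarrow> bool"
  where "csubspace V \<longleftrightarrow> subspace V \<and> (\<forall>c. \<forall>x\<in>V. c *\<^sub>C x \<in> V)"

lemma csubspaceD:
  assumes "csubspace V"
  shows "0 \<in> V" "x \<in> V \<Longrightarrow> y \<in> V \<Longrightarrow> x + y \<in> V" "x \<in> V \<Longrightarrow> y \<in> V \<Longrightarrow> x - y \<in> V"
    "x \<in> V \<Longrightarrow> c *\<^sub>C x \<in> V" "x \<in> V \<Longrightarrow> r *\<^sub>R x \<in> V"
    "(\<And>i. i \<in> I \<Longrightarrow> f i \<in> V) \<Longrightarrow> (\<Sum>i\<in>I. f i) \<in> V"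
  using assms unfolding csubspace_def
  by (auto intro: subspace_0 subspace_add subspace_diff subspace_scale subspace_sum)

lemma cspan_base: "a \<in> A \<Longrightarrow> a \<in> cspan A"
proof -
  assume "a \<in> A"
  then have "1 *\<^sub>C a \<in> {c *\<^sub>C a | c a. a \<in> A}" by blast
  then show ?thesis unfolding cspan_def by (simp add: span_base)
qed

lemma csubspace_cspan: "csubspace (cspan A)"
  unfolding csubspace_def
proof (intro conjI allI ballI)
  show "subspace (cspan A)" unfolding cspan_def by (rule subspace_span)
  fix c x assume "x \<in> cspan A"
  then show "c *\<^sub>C x \<in> cspan A" unfolding cspan_def
  proof (induction rule: span_induct_alt)
    case base
    then show ?case by (simp add: span_zero)
  next
    case (step r x y)
    then obtain d a where x: "x = d *\<^sub>C a" "a \<in> A" by blast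
    then have "c *\<^sub>C x \<in> {c *\<^sub>C a | c a. a \<in> A}" by (auto simp: scaleC_scaleC)
    then show ?case
      using step by (simp add: scaleC_add_right scaleC_scaleR span_add span_scale span_base)
  qed
qed

lemma closure_subspace:
  fixes V :: "'a::real_normed_vector set"
  assumes "subspace V" shows "subspace (closure V)"
  unfolding subspace_def
proof (intro conjI ballI allI)
  show "0 \<in> closure V" using assms closure_subset subspace_0 by blast
  fix x y assume xy: "x \<in> closure V" "y \<in> closure V"
  then obtain f g where "\<And>n. f n \<in> V" "f \<longlonglongrightarrow> x" "\<And>n. g n \<in> V" "g \<longlonglongrightarrow> y"
    unfolding closure_sequential by blast
  then show "x + y \<in> closure V"
    unfolding closure_sequential using assms
    by (intro exI[of _ "\<lambda>n. f n + g n"]) (auto intro: tendsto_add subspace_add)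
next
  fix r x assume "x \<in> closure V"
  then obtain f where "\<And>n. f n \<in> V" "f \<longlonglongrightarrow> x"
    unfolding closure_sequential by blast
  then show "r *\<^sub>R x \<in> closure V"
    unfolding closure_sequential using assms
    by (intro exI[of _ "\<lambda>n. r *\<^sub>R f n"]) (auto intro: tendsto_intros subspace_scale)
qed

lemma csubspace_closure:
  assumes "csubspace V" shows "csubspace (closure V)"
  unfolding csubspace_def
proof (intro conjI allI ballI)
  show "subspace (closure V)" using assms by (auto simp: csubspace_def closure_subspace)
  fix c x assume "x \<in> closure V"
  then obtain f where f: "\<And>n. f n \<in> V" "f \<longlonglongrightarrow> x" unfolding closure_sequential by blast
  then have "(\<lambda>n. c *\<^sub>C f n) \<longlonglongrightarrow> c *\<^sub>C x" by (intro tendsto_scaleC)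
  then show "c *\<^sub>C x \<in> closure V"
    using f assms unfolding closure_sequential csubspace_def
    by (intro exI[of _ "\<lambda>n. c *\<^sub>C f n"]) auto
qed

lemma closure_cspan_minimal:
  assumes "A \<subseteq> V" "csubspace V" "closed V" shows "closure (cspan A) \<subseteq> V"
proof (rule closure_minimal)
  show "cspan A \<subseteq> V" unfolding cspan_def
    by (rule span_minimal) (use assms in \<open>auto simp: csubspace_def\<close>)
qed fact

text \<open>Turns density arguments into inductions. The cases also provide membership in the closed
  span, because many of the maps treated this way are linear only there.\<close>

lemma closure_cspan_induct [consumes 1, case_names base zero add scale lim]:
  assumes x: "x \<in> closure (cspan A)"
    and base: "\<And>a. a \<in> A \<Longrightarrow> P a" and zero: "P 0"
    and add: "\<And>x y. x \<in> closure (cspan A) \<Longrightarrow> y \<in> closure (cspan A) \<Longrightarrow> P x \<Longrightarrow> P y \<Longrightarrow> P (x + y)"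
    and scale: "\<And>c x. x \<in> closure (cspan A) \<Longrightarrow> P x \<Longrightarrow> P (c *\<^sub>C x)"
    and lim: "\<And>f x. (\<And>n. f n \<in> closure (cspan A)) \<Longrightarrow> (\<And>n. P (f n)) \<Longrightarrow> f \<longlonglongrightarrow> x \<Longrightarrow>
      x \<in> closure (cspan A) \<Longrightarrow> P x"
  shows "P x"
proof -
  let ?V = "{x \<in> closure (cspan A). P x}"
  have C: "csubspace (closure (cspan A))" by (intro csubspace_closure csubspace_cspan)
  have "closure (cspan A) \<subseteq> ?V"
  proof (rule closure_cspan_minimal)
    show "A \<subseteq> ?V" using base cspan_base closure_subset by blast
    have "P (r *\<^sub>R x)" if "x \<in> closure (cspan A)" "P x" for r x
      using scale[of x "complex_of_real r"] that by (simp add: scaleC_of_real)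
    then show "csubspace ?V"
      using C zero add scale unfolding csubspace_def subspace_def by auto
    show "closed ?V" unfolding closed_sequential_limits
    proof safe
      fix f x assume f: "\<forall>n. f n \<in> ?V" "f \<longlonglongrightarrow> x"
      then show "x \<in> closure (cspan A)"
        using closed_closure closed_sequential_limits by blast
      then show "P x" using f lim by blast
    qed
  qed
  then show ?thesis using x by blast
qed

text \<open>The closure of the graph is again a graph, by the norm estimate.\<close>

lemma graph_extension:
  fixes R :: "('a::complex_hilbert \<times> 'b::complex_hilbert) set"
  assumes R: "subspace R" and sc: "\<And>c x y. (x, y) \<in> R \<Longrightarrow> (c *\<^sub>C x, c *\<^sub>C y) \<in> R"
    and bound: "\<And>x y. (x, y) \<in> R \<Longrightarrow> norm y \<le> K * norm x"
  shows "\<exists>T. (\<forall>(x, y)\<in>R. T x = y) \<and>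
    (\<forall>x\<in>closure (fst ` R). \<forall>y\<in>closure (fst ` R). T (x + y) = T x + T y) \<and>
    (\<forall>c. \<forall>x\<in>closure (fst ` R). T (c *\<^sub>C x) = c *\<^sub>C T x) \<and>
    (\<forall>x\<in>closure (fst ` R). norm (T x) \<le> K * norm x)"
proof -
  let ?G = "closure R"
  have G: "subspace ?G" using R by (rule closure_subspace)
  have seq: "\<exists>f g. (\<forall>n. (f n, g n) \<in> R) \<and> f \<longlonglongrightarrow> x \<and> g \<longlonglongrightarrow> y" if xy: "(x, y) \<in> ?G" for x y
  proof -
    obtain h where h: "\<And>n. h n \<in> R" "h \<longlonglongrightarrow> (x, y)" using xy unfolding closure_sequential by blast
    then show ?thesis
      using tendsto_fst[OF h(2)] tendsto_snd[OF h(2)]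
      by (intro exI[of _ "fst \<circ> h"] exI[of _ "snd \<circ> h"]) (auto simp: o_def)
  qed
  have seq': "(x, y) \<in> ?G" if "\<And>n. (f n, g n) \<in> R" "f \<longlonglongrightarrow> x" "g \<longlonglongrightarrow> y" for f g x y
    using that tendsto_Pair[of f x sequentially g y] unfolding closure_sequential
    by (intro exI[of _ "\<lambda>n. (f n, g n)"]) auto
  have Gb: "norm y \<le> K * norm x" if xy: "(x, y) \<in> ?G" for x y
  proof -
    obtain f g where fg: "\<And>n. (f n, g n) \<in> R" "f \<longlonglongrightarrow> x" "g \<longlonglongrightarrow> y" using seq[OF xy] by blast
    have "(\<lambda>n. norm (g n)) \<longlonglongrightarrow> norm y" "(\<lambda>n. K * norm (f n)) \<longlonglongrightarrow> K * norm x"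
      using fg by (auto intro!: tendsto_intros)
    then show ?thesis by (rule LIMSEQ_le) (use bound fg(1) in blast)
  qed
  have Gsc: "(c *\<^sub>C x, c *\<^sub>C y) \<in> ?G" if xy: "(x, y) \<in> ?G" for c x y
  proof -
    obtain f g where "\<And>n. (f n, g n) \<in> R" "f \<longlonglongrightarrow> x" "g \<longlonglongrightarrow> y" using seq[OF xy] by blast
    then show ?thesis
      by (intro seq'[of "\<lambda>n. c *\<^sub>C f n" "\<lambda>n. c *\<^sub>C g n"] sc tendsto_scaleC)
  qed
  have uniq: "y = y'" if "(x, y) \<in> ?G" "(x, y') \<in> ?G" for x y y'
  proof -
    have "(0, y - y') \<in> ?G" using subspace_diff[OF G that] by simp
    from Gb[OF this] show ?thesis by simp
  qed
  \<comment> \<open>The estimate sends Cauchy sequences to Cauchy sequences, so completeness of the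
    codomain yields a value at every point of the closed domain.\<close>
  have ex: "\<exists>y. (x, y) \<in> ?G" if x: "x \<in> closure (fst ` R)" for x
  proof -
    obtain f where f: "\<And>n. f n \<in> fst ` R" "f \<longlonglongrightarrow> x" using x unfolding closure_sequential by blast
    have "\<forall>n. \<exists>y. (f n, y) \<in> R" using f(1) by force
    then obtain g where g: "\<And>n. (f n, g n) \<in> R" by metis
    have Rdiff: "(f n - f m, g n - g m) \<in> R" for n m
      using subspace_diff[OF R g[of n] g[of m]] by simp
    have "Cauchy g"
    proof (rule CauchyI)
      fix e :: real assume e: "e > 0"
      \<comment> \<open>Nothing makes \<open>K\<close> positive here, hence the divisor
        \<open>\<bar>K\<bar> + 1\<close>.\<close>
      obtain M where M: "\<And>m n. m \<ge> M \<Longrightarrow> n \<ge> M \<Longrightarrow> norm (f m - f n) < e / (\<bar>K\<bar> + 1)"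
        using CauchyD[OF LIMSEQ_imp_Cauchy[OF f(2)], of "e / (\<bar>K\<bar> + 1)"] e
        by (auto simp: add_nonneg_pos)
      have "norm (g m - g n) < e" if "m \<ge> M" "n \<ge> M" for m n
      proof -
        have "norm (g m - g n) \<le> K * norm (f m - f n)" using bound Rdiff by blast
        also have "\<dots> \<le> (\<bar>K\<bar> + 1) * norm (f m - f n)" by (intro mult_right_mono) auto
        also have "\<dots> < e" using M[OF that] by (simp add: field_simps add_nonneg_pos)
        finally show ?thesis .
      qed
      then show "\<exists>M. \<forall>m\<ge>M. \<forall>n\<ge>M. norm (g m - g n) < e" by blast
    qed
    then obtain y where "g \<longlonglongrightarrow> y" using Cauchy_convergent convergent_def by blast
    then have "(x, y) \<in> ?G" by (rule seq'[OF g f(2)])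
    then show ?thesis ..
  qed
  then obtain T where T: "\<And>x. x \<in> closure (fst ` R) \<Longrightarrow> (x, T x) \<in> ?G" by metis
  have V: "x + y \<in> closure (fst ` R)" if "x \<in> closure (fst ` R)" "y \<in> closure (fst ` R)" for x y
  proof -
    have "subspace (fst ` R)"
      using R by (intro linear_subspace_image) (auto intro: linear_fst)
    then have "subspace (closure (fst ` R))" by (rule closure_subspace)
    then show ?thesis using that by (simp add: subspace_add)
  qed
  have Vsc: "c *\<^sub>C x \<in> closure (fst ` R)" if x: "x \<in> closure (fst ` R)" for c x
  proof -
    have 1: "c *\<^sub>C z \<in> fst ` R" if "z \<in> fst ` R" for z using that sc by force
    obtain f where f: "\<And>n. f n \<in> fst ` R" "f \<longlonglongrightarrow> x" using x unfolding closure_sequential by blast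
    then show ?thesis unfolding closure_sequential
      by (intro exI[of _ "\<lambda>n. c *\<^sub>C f n"]) (auto intro: 1 tendsto_scaleC)
  qed
  show ?thesis
  proof (intro exI[of _ T] conjI ballI allI; (clarify)?)
    show "T x = y" if "(x, y) \<in> R" for x y
    proof (rule uniq)
      have "x \<in> fst ` R" using that by force
      then show "(x, T x) \<in> ?G" using T closure_subset by blast
      show "(x, y) \<in> ?G" using that closure_subset by blast
    qed
    show "T (x + y) = T x + T y"
      if "x \<in> closure (fst ` R)" "y \<in> closure (fst ` R)" for x y
    proof (rule uniq[OF T[OF V[OF that]]])
      show "(x + y, T x + T y) \<in> ?G" using subspace_add[OF G T[OF that(1)] T[OF that(2)]] by simp
    qed
    show "T (c *\<^sub>C x) = c *\<^sub>C T x" if "x \<in> closure (fst ` R)" for c x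
      by (rule uniq[OF T[OF Vsc[OF that]] Gsc[OF T[OF that]]])
    show "norm (T x) \<le> K * norm x" if "x \<in> closure (fst ` R)" for x
      by (rule Gb[OF T[OF that]])
  qed
qed

text \<open>The uniqueness half of the definite descriptions of shifts and tensor operators rests on
  this.\<close>

lemma bounded_ops_eq_on_total:
  assumes T: "T \<in> bounded_ops" "T' \<in> bounded_ops" and tot: "closure (cspan A) = UNIV"
    and eq: "\<And>a. a \<in> A \<Longrightarrow> T a = T' a"
  shows "T = T'"
proof
  fix x
  have "x \<in> closure (cspan A)" using tot by simp
  then show "T x = T' x"
  proof (induction rule: closure_cspan_induct)
    case (lim f x)
    have "(\<lambda>n. T (f n)) \<longlonglongrightarrow> T x" "(\<lambda>n. T' (f n)) \<longlonglongrightarrow> T' x"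
      by (rule bounded_ops_tendsto[OF T(1) lim(2)], rule bounded_ops_tendsto[OF T(2) lim(2)])
    then show ?case using lim(4) by (simp add: LIMSEQ_unique)
  qed (simp_all add: eq T bounded_ops_zero bounded_ops_add bounded_ops_scaleC)
qed

lemma vector_eq_on_total:
  assumes tot: "closure (cspan A) = UNIV" and eq: "\<And>a. a \<in> A \<Longrightarrow> cinner a x = cinner a y"
  shows "x = y"
proof (rule cinner_ext)
  fix z
  have "z \<in> closure (cspan A)" using tot by simp
  then show "cinner z x = cinner z y"
  proof (induction rule: closure_cspan_induct)
    case (lim f z)
    have "(\<lambda>n. cinner (f n) x) \<longlonglongrightarrow> cinner z x" "(\<lambda>n. cinner (f n) y) \<longlonglongrightarrow> cinner z y"
      by (intro tendsto_cinner tendsto_const lim)+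
    then show ?case using lim by (simp add: LIMSEQ_unique)
  qed (simp_all add: eq cinner_simps)
qed

text \<open>Unlike \<open>bounded_ops_on\<close> this does not ask for an invariant subspace and
  allows another codomain: maps such as tensoring with a fixed vector are controlled on one tensor
  factor and take values outside it.\<close>

definition bounded_clinear_on ::
    "'a::complex_hilbert set \<Rightarrow> ('a \<Rightarrow> 'b::complex_hilbert) \<Rightarrow> bool"
  where "bounded_clinear_on V T \<longleftrightarrow> (\<forall>x\<in>V. \<forall>y\<in>V. T (x + y) = T x + T y)
    \<and> (\<forall>c. \<forall>x\<in>V. T (c *\<^sub>C x) = c *\<^sub>C T x) \<and> (\<exists>K. \<forall>x\<in>V. norm (T x) \<le> K * norm x)"

lemma bounded_ops_on_iff:
  "T \<in> bounded_ops_on V \<longleftrightarrow> (\<forall>x\<in>V. T x \<in> V) \<and> bounded_clinear_on V T"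
  by (simp add: bounded_ops_on_def bounded_clinear_on_def)

lemma bounded_clinear_onD:
  assumes "bounded_clinear_on V T" "csubspace V"
  shows "x \<in> V \<Longrightarrow> y \<in> V \<Longrightarrow> T (x + y) = T x + T y" "x \<in> V \<Longrightarrow> T (c *\<^sub>C x) = c *\<^sub>C T x"
    "T 0 = 0" "x \<in> V \<Longrightarrow> y \<in> V \<Longrightarrow> T (x - y) = T x - T y" "x \<in> V \<Longrightarrow> T (r *\<^sub>R x) = r *\<^sub>R T x"
    "(\<And>i. i \<in> I \<Longrightarrow> f i \<in> V) \<Longrightarrow> T (\<Sum>i\<in>I. f i) = (\<Sum>i\<in>I. T (f i))"
proof -
  note V = csubspaceD[OF assms(2)]
  show add: "T (x + y) = T x + T y" if "x \<in> V" "y \<in> V" for x y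
    using assms that by (simp add: bounded_clinear_on_def)
  show sc: "T (c *\<^sub>C x) = c *\<^sub>C T x" if "x \<in> V" for c x
    using assms that by (simp add: bounded_clinear_on_def)
  show scR: "T (r *\<^sub>R x) = r *\<^sub>R T x" if "x \<in> V" for r x
    using sc[of x "complex_of_real r"] that by (simp add: scaleC_of_real)
  show zero: "T 0 = 0" using scR[of 0 0] V(1) by simp
  show "T (x - y) = T x - T y" if "x \<in> V" "y \<in> V"
    using add[of "x - y" y] that V(3) by simp
  show "T (\<Sum>i\<in>I. f i) = (\<Sum>i\<in>I. T (f i))" if "\<And>i. i \<in> I \<Longrightarrow> f i \<in> V"
    using that by (induction I rule: infinite_finite_induct) (auto simp: zero add V)
qed

lemma bounded_clinear_on_tendsto:
  assumes T: "bounded_clinear_on V T" "csubspace V" and f: "\<And>n. f n \<in> V" "x \<in> V" "f \<longlonglongrightarrow> x"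
  shows "(\<lambda>n. T (f n)) \<longlonglongrightarrow> T x"
proof -
  obtain K where K: "\<And>x. x \<in> V \<Longrightarrow> norm (T x) \<le> K * norm x"
    using T(1) unfolding bounded_clinear_on_def by blast
  have "(\<lambda>n. T (f n) - T x) \<longlonglongrightarrow> 0"
  proof (rule Lim_null_comparison)
    show "\<forall>\<^sub>F n in sequentially. norm (T (f n) - T x) \<le> K * norm (f n - x)"
      using K csubspaceD(3)[OF T(2)] f by (simp flip: bounded_clinear_onD(4)[OF T])
    show "(\<lambda>n. K * norm (f n - x)) \<longlonglongrightarrow> 0"
      using f(3) by (auto intro!: tendsto_mult_right_zero simp: LIM_zero_iff tendsto_norm_zero)
  qed
  then show ?thesis by (simp add: LIM_zero_iff)
qed

lemma bounded_clinear_on_UNIV: "bounded_clinear_on UNIV T \<longleftrightarrow> T \<in> bounded_ops"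
proof
  assume T: "bounded_clinear_on UNIV T"
  then obtain K where "\<And>x. norm (T x) \<le> K * norm x" unfolding bounded_clinear_on_def by blast
  then show "T \<in> bounded_ops" using T
    by (intro bounded_opsI) (auto simp: bounded_clinear_on_def)
next
  assume T: "T \<in> bounded_ops"
  then obtain K where "\<And>x. norm (T x) \<le> K * norm x" by (rule bounded_ops_bound) blast
  then show "bounded_clinear_on UNIV T"
    using T by (auto simp: bounded_clinear_on_def bounded_ops_add bounded_ops_scaleC)
qed

lemma bounded_ops_imp_bounded_clinear_on:
  "T \<in> bounded_ops \<Longrightarrow> bounded_clinear_on V T"
  unfolding bounded_clinear_on_UNIV[symmetric] by (auto simp: bounded_clinear_on_def)

lemma bounded_clinear_on_eqI:
  assumes M: "bounded_clinear_on (closure (cspan A)) M" "bounded_clinear_on (closure (cspan A)) M'"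
    and eq: "\<And>a. a \<in> A \<Longrightarrow> M a = M' a" and x: "x \<in> closure (cspan A)"
  shows "M x = M' x"
  using x
proof (induction rule: closure_cspan_induct)
  case (lim f x)
  have V: "csubspace (closure (cspan A))" by (intro csubspace_closure csubspace_cspan)
  have "(\<lambda>n. M (f n)) \<longlonglongrightarrow> M x" "(\<lambda>n. M' (f n)) \<longlonglongrightarrow> M' x"
    by (rule bounded_clinear_on_tendsto[OF M(1) V lim(1,3,2)],
        rule bounded_clinear_on_tendsto[OF M(2) V lim(1,3,2)])
  then show ?case using lim(4) by (simp add: LIMSEQ_unique)
qed (use M eq bounded_clinear_onD(3)[OF M(1) csubspace_closure[OF csubspace_cspan]]
    bounded_clinear_onD(3)[OF M(2) csubspace_closure[OF csubspace_cspan]]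
    in \<open>auto simp: bounded_clinear_on_def\<close>)

lemma bounded_clinear_on_compose:
  assumes T: "bounded_clinear_on V T" "\<And>x. x \<in> V \<Longrightarrow> T x \<in> V'" and T': "bounded_clinear_on V' T'"
  shows "bounded_clinear_on V (\<lambda>x. T' (T x))"
proof -
  obtain K where K: "\<And>x. x \<in> V \<Longrightarrow> norm (T x) \<le> K * norm x"
    using T(1) unfolding bounded_clinear_on_def by blast
  obtain K' where K': "\<And>x. x \<in> V' \<Longrightarrow> norm (T' x) \<le> K' * norm x"
    using T' unfolding bounded_clinear_on_def by blast
  have "norm (T' (T x)) \<le> (\<bar>K'\<bar> * K) * norm x" if "x \<in> V" for x
  proof -
    have "norm (T' (T x)) \<le> K' * norm (T x)" using K' T(2) that by blast
    also have "\<dots> \<le> \<bar>K'\<bar> * norm (T x)" by (intro mult_right_mono) auto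
    also have "\<dots> \<le> \<bar>K'\<bar> * (K * norm x)" using K[OF that] by (intro mult_left_mono) auto
    finally show ?thesis by simp
  qed
  then have "\<exists>K. \<forall>x\<in>V. norm (T' (T x)) \<le> K * norm x" by blast
  then show ?thesis using T T' unfolding bounded_clinear_on_def by simp
qed

text \<open>The operator is prescribed by argument-value pairs because a vector can have several
  representations by generators. The estimate on the span makes the prescription consistent, and the
  closure of \<open>B\<close> under complex scaling makes its real span a complex one.\<close>

lemma pair_extension:
  fixes B :: "('a::complex_hilbert \<times> 'b::complex_hilbert) set"
  assumes sc: "\<And>c x y. (x, y) \<in> B \<Longrightarrow> (c *\<^sub>C x, c *\<^sub>C y) \<in> B"
    and bound: "\<And>x y. (x, y) \<in> span B \<Longrightarrow> norm y \<le> K * norm x"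
  shows "\<exists>T. (\<forall>x y. (x, y) \<in> B \<longrightarrow> T x = y) \<and> bounded_clinear_on (closure (cspan (fst ` B))) T \<and>
    (\<forall>x\<in>closure (cspan (fst ` B)). norm (T x) \<le> K * norm x)"
proof -
  have "(c *\<^sub>C fst p, c *\<^sub>C snd p) \<in> span B" if "p \<in> span B" for p c
    using that
  proof (induction rule: span_induct_alt)
    case base
    then show ?case using span_zero[of B] by (simp add: zero_prod_def)
  next
    case (step r p q)
    have "(c *\<^sub>C fst p, c *\<^sub>C snd p) \<in> span B" using step(1) sc[of "fst p" "snd p"] by (simp add: span_base)
    from span_add[OF span_scale[OF this, of r] step(2)] show ?case
      by (simp add: scaleC_add_right scaleC_scaleR)
  qed
  then have sc': "(c *\<^sub>C x, c *\<^sub>C y) \<in> span B" if "(x, y) \<in> span B" for c x y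
    using that by fastforce
  have "{c *\<^sub>C a | c a. a \<in> fst ` B} = fst ` B"
  proof (intro equalityI subsetI)
    fix x assume "x \<in> fst ` B"
    then have "x = 1 *\<^sub>C x \<and> x \<in> fst ` B" by simp
    then show "x \<in> {c *\<^sub>C a | c a. a \<in> fst ` B}" by blast
  qed (use sc in force)
  then have "cspan (fst ` B) = fst ` span B"
    unfolding cspan_def by (simp add: linear_fst linear_span_image)
  moreover obtain T where T: "\<forall>(x, y)\<in>span B. T x = y"
    "\<forall>x\<in>closure (fst ` span B). \<forall>y\<in>closure (fst ` span B). T (x + y) = T x + T y"
    "\<forall>c. \<forall>x\<in>closure (fst ` span B). T (c *\<^sub>C x) = c *\<^sub>C T x"
    "\<forall>x\<in>closure (fst ` span B). norm (T x) \<le> K * norm x"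
    using graph_extension[OF subspace_span sc' bound] by blast
  moreover have "T x = y" if "(x, y) \<in> B" for x y
    using bspec[OF T(1) span_base[OF that]] by simp
  ultimately show ?thesis
    unfolding bounded_clinear_on_def by (intro exI[of _ T]) auto
qed

text \<open>Proportional inner products on generators give norms scaled by \<open>sqrt r\<close> on
  all combinations. The factor \<open>r\<close> accommodates tensoring with a fixed vector, which
  scales squared norms by that of the vector; \<open>r = 1\<close> covers the shifts.\<close>

lemma isometric_extension:
  fixes g :: "'i \<Rightarrow> 'a::complex_hilbert" and k :: "'i \<Rightarrow> 'b::complex_hilbert"
  assumes iso: "\<And>i j. i \<in> I \<Longrightarrow> j \<in> I \<Longrightarrow> cinner (k i) (k j) = complex_of_real r * cinner (g i) (g j)"
    and r: "r \<ge> 0"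
  shows "\<exists>T. (\<forall>i\<in>I. T (g i) = k i) \<and> bounded_clinear_on (closure (cspan (g ` I))) T"
proof -
  define B where "B = {(c *\<^sub>C g i, c *\<^sub>C k i) | c i. i \<in> I}"
  have sc: "(c *\<^sub>C x, c *\<^sub>C y) \<in> B" if "(x, y) \<in> B" for c x y
    using that unfolding B_def by (auto simp: scaleC_scaleC) blast
  have inner1: "cinner (snd p) (snd q) = r * cinner (fst p) (fst q)" if "p \<in> span B" "q \<in> B" for p q
    using that
  proof (induction rule: span_induct_alt)
    case (step s p p')
    have "cinner (snd p) (snd q) = r * cinner (fst p) (fst q)"
      using step(1,3) iso by (auto simp: B_def cinner_simps)
    then show ?case using step
      by (simp add: cinner_add_left cinner_scaleR_left scaleR_conv_of_real algebra_simps)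
  qed simp
  have inner2: "cinner (snd p) (snd q) = r * cinner (fst p) (fst q)" if "q \<in> span B" "p \<in> span B" for p q
    using that
  proof (induction rule: span_induct_alt)
    case (step s q q')
    then show ?case using inner1[of p q]
      by (simp add: cinner_add_right cinner_scaleR_right scaleR_conv_of_real algebra_simps)
  qed simp
  have bound: "norm y \<le> sqrt r * norm x" if "(x, y) \<in> span B" for x y
  proof -
    have "(norm y)\<^sup>2 = (sqrt r * norm x)\<^sup>2"
      using inner2[OF that that] r
      by (simp add: cinner_self power_mult_distrib flip: of_real_mult of_real_power)
    then show ?thesis using r by simp
  qed
  have eq: "cspan (fst ` B) = cspan (g ` I)"
    unfolding cspan_def
  proof (rule arg_cong[of _ _ span])
    have "fst ` B = {c *\<^sub>C a | c a. a \<in> g ` I}" by (force simp: B_def)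
    moreover have "{d *\<^sub>C b | d b. b \<in> {c *\<^sub>C a | c a. a \<in> g ` I}} = {c *\<^sub>C a | c a. a \<in> g ` I}"
    proof (intro equalityI subsetI)
      fix x assume x: "x \<in> {c *\<^sub>C a | c a. a \<in> g ` I}"
      then have "x = 1 *\<^sub>C x" by simp
      then show "x \<in> {d *\<^sub>C b | d b. b \<in> {c *\<^sub>C a | c a. a \<in> g ` I}}" using x by blast
    next
      fix x assume "x \<in> {d *\<^sub>C b | d b. b \<in> {c *\<^sub>C a | c a. a \<in> g ` I}}"
      then obtain d c a where "x = d *\<^sub>C c *\<^sub>C a" "a \<in> g ` I" by blast
      then have "x = (d * c) *\<^sub>C a" by (simp add: scaleC_scaleC)
      then show "x \<in> {c *\<^sub>C a | c a. a \<in> g ` I}" using \<open>a \<in> g ` I\<close> by blast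
    qed
    ultimately show "{c *\<^sub>C a | c a. a \<in> fst ` B} = {c *\<^sub>C a | c a. a \<in> g ` I}" by simp
  qed
  obtain T where T: "\<And>x y. (x, y) \<in> B \<Longrightarrow> T x = y"
    "bounded_clinear_on (closure (cspan (g ` I))) T"
    using pair_extension[OF sc bound, unfolded eq] by blast
  have "T (g i) = k i" if "i \<in> I" for i
  proof (rule T(1))
    have "(1 *\<^sub>C g i, 1 *\<^sub>C k i) \<in> B" using that unfolding B_def by blast
    then show "(g i, k i) \<in> B" by simp
  qed
  then show ?thesis using T(2) by blast
qed

text \<open>Sesquilinearity and continuity extend the relation one slot at a time. It recovers the
  inner product formulas for maps that were obtained by extension from generators.\<close>

lemma cinner_eq_on_total:
  assumes M: "bounded_clinear_on (closure (cspan (g ` I))) M"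
      "bounded_clinear_on (closure (cspan (g ` I))) M'"
    and eq: "\<And>i j. i \<in> I \<Longrightarrow> j \<in> I \<Longrightarrow> cinner (M (g i)) (M' (g j)) = c * cinner (g i) (g j)"
    and x: "x \<in> closure (cspan (g ` I))" and y: "y \<in> closure (cspan (g ` I))"
  shows "cinner (M x) (M' y) = c * cinner x y"
proof -
  have V: "csubspace (closure (cspan (g ` I)))" by (intro csubspace_closure csubspace_cspan)
  note D = bounded_clinear_onD[OF M(1) V] bounded_clinear_onD[OF M(2) V]
  have 1: "cinner (M x) (M' (g j)) = c * cinner x (g j)" if "j \<in> I" for j
    using x
  proof (induction rule: closure_cspan_induct)
    case (lim f x)
    have "(\<lambda>n. cinner (M (f n)) (M' (g j))) \<longlonglongrightarrow> cinner (M x) (M' (g j))"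
      by (intro tendsto_cinner tendsto_const bounded_clinear_on_tendsto[OF M(1) V] lim)
    moreover have "(\<lambda>n. c * cinner (f n) (g j)) \<longlonglongrightarrow> c * cinner x (g j)"
      by (intro tendsto_mult tendsto_cinner tendsto_const lim)
    ultimately show ?case using lim by (simp add: LIMSEQ_unique)
  qed (use that eq in \<open>auto simp: D cinner_simps algebra_simps\<close>)
  show ?thesis using y
  proof (induction rule: closure_cspan_induct)
    case (lim f y)
    have "(\<lambda>n. cinner (M x) (M' (f n))) \<longlonglongrightarrow> cinner (M x) (M' y)"
      by (intro tendsto_cinner tendsto_const bounded_clinear_on_tendsto[OF M(2) V] lim)
    moreover have "(\<lambda>n. c * cinner x (f n)) \<longlonglongrightarrow> c * cinner x y"
      by (intro tendsto_mult tendsto_cinner tendsto_const lim)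
    ultimately show ?case using lim by (simp add: LIMSEQ_unique)
  qed (use 1 in \<open>auto simp: D cinner_simps algebra_simps\<close>)
qed

subsection \<open>Tensor decompositions\<close>

text \<open>The Hilbert space tensor product, characterised by bilinearity, multiplicative inner
  products and totality, with both factors and the product realised inside one space.\<close>

locale tensor_pair =
  fixes V W :: "'a::complex_hilbert set" and \<tau> :: "'a \<Rightarrow> 'a \<Rightarrow> 'a"
  assumes V: "csubspace V" and W: "csubspace W"
    and add_left: "x \<in> V \<Longrightarrow> x' \<in> V \<Longrightarrow> y \<in> W \<Longrightarrow> \<tau> (x + x') y = \<tau> x y + \<tau> x' y"
    and scale_left: "x \<in> V \<Longrightarrow> y \<in> W \<Longrightarrow> \<tau> (c *\<^sub>C x) y = c *\<^sub>C \<tau> x y"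
    and add_right: "x \<in> V \<Longrightarrow> y \<in> W \<Longrightarrow> y' \<in> W \<Longrightarrow> \<tau> x (y + y') = \<tau> x y + \<tau> x y'"
    and scale_right: "x \<in> V \<Longrightarrow> y \<in> W \<Longrightarrow> \<tau> x (c *\<^sub>C y) = c *\<^sub>C \<tau> x y"
    and inner: "x \<in> V \<Longrightarrow> y \<in> W \<Longrightarrow> x' \<in> V \<Longrightarrow> y' \<in> W \<Longrightarrow>
      cinner (\<tau> x y) (\<tau> x' y') = cinner x x' * cinner y y'"
    and total: "closure (cspan {\<tau> x y | x y. x \<in> V \<and> y \<in> W}) = UNIV"
begin

lemma norm_tensor: "x \<in> V \<Longrightarrow> y \<in> W \<Longrightarrow> norm (\<tau> x y) = norm x * norm y"
proof -
  assume "x \<in> V" "y \<in> W"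
  then have "cinner (\<tau> x y) (\<tau> x y) = cinner x x * cinner y y" by (simp only: inner)
  then have "(norm (\<tau> x y))\<^sup>2 = (norm x * norm y)\<^sup>2"
    unfolding cinner_self power_mult_distrib of_real_mult[symmetric] of_real_eq_iff .
  then show ?thesis by simp
qed

lemma left_linear: "y \<in> W \<Longrightarrow> bounded_clinear_on V (\<lambda>x. \<tau> x y)"
  unfolding bounded_clinear_on_def
  by (auto simp: add_left scale_left norm_tensor mult.commute intro!: exI[of _ "norm y"])

lemma right_linear: "x \<in> V \<Longrightarrow> bounded_clinear_on W (\<tau> x)"
  unfolding bounded_clinear_on_def
  by (auto simp: add_right scale_right norm_tensor intro!: exI[of _ "norm x"])

text \<open>Symmetry of the axioms; results on the left factor carry over to the right one.\<close>

lemma swap: "tensor_pair W V (\<lambda>y x. \<tau> x y)"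
proof
  have "{\<tau> x y |y x. y \<in> W \<and> x \<in> V} = {\<tau> x y | x y. x \<in> V \<and> y \<in> W}" by blast
  then show "closure (cspan {\<tau> x y |y x. y \<in> W \<and> x \<in> V}) = UNIV" using total by simp
qed (auto simp: V W add_left add_right scale_left scale_right inner)

lemma ops_eqI:
  assumes "T \<in> bounded_ops" "T' \<in> bounded_ops"
    and "\<And>x y. x \<in> V \<Longrightarrow> y \<in> W \<Longrightarrow> T (\<tau> x y) = T' (\<tau> x y)"
  shows "T = T'"
  using bounded_ops_eq_on_total[OF assms(1,2) total] assms(3) by blast

end

text \<open>Gram-Schmidt, one vector at a time: the normalised residual joins the family unless it
  is zero.\<close>

lemma orthonormal_expansion:
  fixes B :: "'a::complex_hilbert set"
  assumes "finite B" "B \<subseteq> W" "csubspace W"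
  shows "\<exists>E. finite E \<and> E \<subseteq> W \<and> (\<forall>e\<in>E. \<forall>e'\<in>E. cinner e e' = (if e = e' then 1 else 0)) \<and>
    (\<forall>w\<in>B. w = (\<Sum>e\<in>E. cinner e w *\<^sub>C e))"
  using assms(1,2)
proof (induction B rule: finite_induct)
  case empty
  show ?case by (intro exI[of _ "{}"]) auto
next
  case (insert w B)
  then have "B \<subseteq> W" by simp
  from insert.IH[OF this] obtain E where E: "finite E" "E \<subseteq> W"
      "\<And>e e'. e \<in> E \<Longrightarrow> e' \<in> E \<Longrightarrow> cinner e e' = (if e = e' then 1 else 0)"
    and exp: "\<And>v. v \<in> B \<Longrightarrow> v = (\<Sum>e\<in>E. cinner e v *\<^sub>C e)" by blast
  define r where "r = w - (\<Sum>e\<in>E. cinner e w *\<^sub>C e)"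
  show ?case
  proof (cases "r = 0")
    case True
    then have "w = (\<Sum>e\<in>E. cinner e w *\<^sub>C e)" by (simp add: r_def)
    then show ?thesis using E exp by (intro exI[of _ E]) blast
  next
    case False
    define n where "n = inverse (norm r) *\<^sub>R r"
    have r_orth: "cinner e r = 0" if "e \<in> E" for e
    proof -
      have "(\<Sum>d\<in>E. cinner d w * cinner e d) = (\<Sum>d\<in>E. if d = e then cinner e w else 0)"
        using that E(3) by (intro sum.cong) auto
      then show ?thesis
        using that E(1) by (simp add: r_def cinner_diff_right cinner_sum_right cinner_scaleC_right)
    qed
    have n_orth: "cinner e n = 0" "cinner n e = 0" if "e \<in> E" for e
      using r_orth[OF that] cinner_commute[of r e] by (auto simp: n_def cinner_scaleR_left cinner_scaleR_right)
    have nn: "cinner n n = 1"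
    proof -
      have "norm n = 1" using False by (simp add: n_def)
      then show ?thesis by (simp add: cinner_self)
    qed
    have "n \<in> W"
    proof -
      have "r \<in> W" unfolding r_def using insert.prems E(2)
        by (auto intro!: csubspaceD[OF assms(3)])
      then show ?thesis unfolding n_def by (rule csubspaceD[OF assms(3)])
    qed
    have "n \<notin> E" using n_orth(1)[of n] nn by auto
    \<comment> \<open>The earlier vectors are combinations of \<open>E\<close>, so the new direction
      does not enter their expansions.\<close>
    have n_exp: "cinner n v = 0" if "v \<in> B" for v
      using n_orth(2) by (subst exp[OF that]) (simp add: cinner_sum_right cinner_scaleC_right)
    have "cinner n w = cinner n (r + (\<Sum>e\<in>E. cinner e w *\<^sub>C e))" by (simp add: r_def)
    also have "\<dots> = cinner n r"
      using n_orth(2) by (simp add: cinner_add_right cinner_sum_right cinner_scaleC_right)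
    also have "\<dots> = complex_of_real (norm r)"
      using False by (simp add: n_def cinner_scaleR_left cinner_self power2_eq_square scaleR_conv_of_real)
    finally have "cinner n w *\<^sub>C n = r"
      using False by (simp add: n_def scaleC_of_real)
    then have w_exp: "w = (\<Sum>e\<in>insert n E. cinner e w *\<^sub>C e)"
      using E(1) \<open>n \<notin> E\<close> by (simp add: r_def)
    have B_exp: "v = (\<Sum>e\<in>insert n E. cinner e v *\<^sub>C e)" if "v \<in> B" for v
    proof -
      have "(\<Sum>e\<in>insert n E. cinner e v *\<^sub>C e) = (\<Sum>e\<in>E. cinner e v *\<^sub>C e)"
        using n_exp[OF that] E(1) \<open>n \<notin> E\<close> by simp
      then show ?thesis by (rule trans[OF exp[OF that] sym])
    qed
    show ?thesis
    proof (intro exI[of _ "insert n E"] conjI ballI)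
      show "v = (\<Sum>e\<in>insert n E. cinner e v *\<^sub>C e)" if "v \<in> insert w B" for v
        using that w_exp B_exp by blast
      show "cinner e e' = (if e = e' then 1 else 0)" if "e \<in> insert n E" "e' \<in> insert n E" for e e'
        using that E(3) n_orth nn \<open>n \<notin> E\<close> by auto
    qed (use E \<open>n \<in> W\<close> in auto)
  qed
qed

context tensor_pair
begin

text \<open>Expanding the second tensor factors in an orthonormal family turns the claimed norm
  estimate into Pythagoras' theorem.\<close>

lemma left_ampliation:
  assumes A: "A \<in> bounded_ops_on V" and K: "K \<ge> 0" "\<And>x. x \<in> V \<Longrightarrow> norm (A x) \<le> K * norm x"
  shows "\<exists>T\<in>bounded_ops. (\<forall>x\<in>V. \<forall>y\<in>W. T (\<tau> x y) = \<tau> (A x) y) \<and> (\<forall>z. norm (T z) \<le> K * norm z)"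
proof -
  have AV: "A x \<in> V" if "x \<in> V" for x using A that by (simp add: bounded_ops_on_def)
  have Alin: "bounded_clinear_on V A" using A by (simp add: bounded_ops_on_iff)
  define B where "B = {(\<tau> x y, \<tau> (A x) y) | x y. x \<in> V \<and> y \<in> W}"
  have sc: "(c *\<^sub>C z, c *\<^sub>C z') \<in> B" if zz: "(z, z') \<in> B" for c z z'
  proof -
    obtain x y where xy: "x \<in> V" "y \<in> W" "z = \<tau> x y" "z' = \<tau> (A x) y"
      using zz unfolding B_def by blast
    have "c *\<^sub>C z = \<tau> (c *\<^sub>C x) y" "c *\<^sub>C z' = \<tau> (A (c *\<^sub>C x)) y" "c *\<^sub>C x \<in> V"
      using xy AV by (auto simp: scale_left bounded_clinear_onD[OF Alin V] csubspaceD[OF V])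
    then show ?thesis using xy(2) unfolding B_def by blast
  qed
  have bound: "norm z' \<le> K * norm z" if zz: "(z, z') \<in> span B" for z z'
  proof -
    obtain t r where t: "finite t" "t \<subseteq> B" "(z, z') = (\<Sum>a\<in>t. r a *\<^sub>R a)"
      using zz unfolding span_explicit by blast
    have "\<forall>a\<in>t. \<exists>x y. x \<in> V \<and> y \<in> W \<and> fst a = \<tau> x y \<and> snd a = \<tau> (A x) y"
      using t(2) unfolding B_def by force
    then obtain p q where pq: "\<And>a. a \<in> t \<Longrightarrow> p a \<in> V" "\<And>a. a \<in> t \<Longrightarrow> q a \<in> W"
      "\<And>a. a \<in> t \<Longrightarrow> fst a = \<tau> (p a) (q a)"
      "\<And>a. a \<in> t \<Longrightarrow> snd a = \<tau> (A (p a)) (q a)" by metis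
    have "finite (q ` t)" "q ` t \<subseteq> W" using t(1) pq(2) by auto
    from orthonormal_expansion[OF this W]
    obtain E where E: "finite E" "E \<subseteq> W"
      "\<forall>e\<in>E. \<forall>e'\<in>E. cinner e e' = (if e = e' then 1 else 0)"
      "\<forall>w\<in>q ` t. w = (\<Sum>e\<in>E. cinner e w *\<^sub>C e)"
      by (elim exE conjE) (rule that)
    \<comment> \<open>The coefficient of \<open>e\<close> after the second factors are expanded, so
      that the combination becomes a sum of \<open>\<tau> (u e) e\<close> with orthogonal
      terms.\<close>
    define u where "u e = (\<Sum>a\<in>t. r a *\<^sub>R cinner e (q a) *\<^sub>C p a)" for e
    have uV: "u e \<in> V" for e
      unfolding u_def using pq by (intro csubspaceD(4-)[OF V])
    \<comment> \<open>Stated for a general \<open>F\<close> in order to rewrite the argument with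
      the identity and the value with \<open>A\<close>.\<close>
    have expand: "(\<Sum>a\<in>t. r a *\<^sub>R \<tau> (F (p a)) (q a)) = (\<Sum>e\<in>E. \<tau> (F (u e)) e)"
      if F: "bounded_clinear_on V F" "\<And>x. x \<in> V \<Longrightarrow> F x \<in> V" for F
    proof -
      have "(\<Sum>e\<in>E. \<tau> (F (u e)) e) = (\<Sum>e\<in>E. \<Sum>a\<in>t. r a *\<^sub>R cinner e (q a) *\<^sub>C \<tau> (F (p a)) e)"
      proof (rule sum.cong[OF refl])
        fix e assume "e \<in> E"
        then have e: "e \<in> W" using E by blast
        have "F (u e) = (\<Sum>a\<in>t. r a *\<^sub>R cinner e (q a) *\<^sub>C F (p a))"
          unfolding u_def using pq(1)
          by (simp add: bounded_clinear_onD[OF F(1) V] csubspaceD[OF V])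
        then show "\<tau> (F (u e)) e = (\<Sum>a\<in>t. r a *\<^sub>R cinner e (q a) *\<^sub>C \<tau> (F (p a)) e)"
          using pq(1) F(2) by (simp add: bounded_clinear_onD[OF left_linear[OF e] V] csubspaceD[OF V])
      qed
      also have "\<dots> = (\<Sum>a\<in>t. \<Sum>e\<in>E. r a *\<^sub>R cinner e (q a) *\<^sub>C \<tau> (F (p a)) e)" by (rule sum.swap)
      also have "\<dots> = (\<Sum>a\<in>t. r a *\<^sub>R \<tau> (F (p a)) (q a))"
      proof (rule sum.cong[OF refl])
        fix a assume a: "a \<in> t"
        then have Fp: "F (p a) \<in> V" using pq F by blast
        have "\<tau> (F (p a)) (q a) = \<tau> (F (p a)) (\<Sum>e\<in>E. cinner e (q a) *\<^sub>C e)"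
          by (rule arg_cong[where f = "\<tau> (F (p a))"]) (rule bspec[OF E(4) imageI[OF a]])
        also have "\<dots> = (\<Sum>e\<in>E. cinner e (q a) *\<^sub>C \<tau> (F (p a)) e)"
          using E(2) by (simp add: bounded_clinear_onD[OF right_linear[OF Fp] W] csubspaceD[OF W] subset_iff)
        finally show "(\<Sum>e\<in>E. r a *\<^sub>R cinner e (q a) *\<^sub>C \<tau> (F (p a)) e) = r a *\<^sub>R \<tau> (F (p a)) (q a)"
          by (simp add: scaleR_sum_right)
      qed
      finally show ?thesis ..
    qed
    have "z = fst (\<Sum>a\<in>t. r a *\<^sub>R a)" "z' = snd (\<Sum>a\<in>t. r a *\<^sub>R a)"
      using t(3)[symmetric] by simp_all
    moreover have "fst (\<Sum>a\<in>t. r a *\<^sub>R a) = (\<Sum>a\<in>t. r a *\<^sub>R \<tau> (p a) (q a))"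
      unfolding fst_sum by (intro sum.cong refl) (simp add: pq(3))
    moreover have "snd (\<Sum>a\<in>t. r a *\<^sub>R a) = (\<Sum>a\<in>t. r a *\<^sub>R \<tau> (A (p a)) (q a))"
      unfolding snd_sum by (intro sum.cong refl) (simp add: pq(4))
    moreover have "bounded_clinear_on V (\<lambda>x. x)"
      by (auto simp: bounded_clinear_on_def intro: exI[of _ 1])
    ultimately have z: "z = (\<Sum>e\<in>E. \<tau> (u e) e)" "z' = (\<Sum>e\<in>E. \<tau> (A (u e)) e)"
      using expand[of "\<lambda>x. x"] expand[OF Alin AV] by simp_all
    have nrm: "(norm (\<Sum>e\<in>E. \<tau> (v e) e))\<^sup>2 = (\<Sum>e\<in>E. (norm (v e))\<^sup>2)" if "\<And>e. v e \<in> V" for v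
    proof -
      have "norm e = 1" if "e \<in> E" for e
        using E(3) that norm_sq_cinner[of e] norm_ge_zero[of e] by (auto simp: power2_eq_1_iff)
      then show ?thesis
        using E that by (subst norm_sq_sum_orthogonal) (auto simp: inner norm_tensor subset_iff)
    qed
    have "(norm z')\<^sup>2 = (\<Sum>e\<in>E. (norm (A (u e)))\<^sup>2)" using nrm[of "\<lambda>e. A (u e)"] AV uV z by simp
    also have "\<dots> \<le> (\<Sum>e\<in>E. (K * norm (u e))\<^sup>2)"
      using K uV by (intro sum_mono power_mono) auto
    also have "\<dots> = (K * norm z)\<^sup>2"
      using nrm[of u] uV z by (simp add: power_mult_distrib sum_distrib_left)
    finally show ?thesis by (rule power2_le_imp_le) (use K in simp)
  qed
  have "fst ` B = {\<tau> x y | x y. x \<in> V \<and> y \<in> W}" by (force simp: B_def)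
  then have eq: "closure (cspan (fst ` B)) = UNIV" using total by simp
  obtain T where T: "\<And>z z'. (z, z') \<in> B \<Longrightarrow> T z = z'" "bounded_clinear_on UNIV T"
    "\<And>z. norm (T z) \<le> K * norm z"
    using pair_extension[OF sc bound, unfolded eq] by blast
  then show ?thesis
    by (intro bexI[of _ T]) (auto simp: bounded_clinear_on_UNIV B_def)
qed

lemma right_ampliation:
  assumes "A \<in> bounded_ops_on W" "K \<ge> 0" "\<And>y. y \<in> W \<Longrightarrow> norm (A y) \<le> K * norm y"
  shows "\<exists>T\<in>bounded_ops. (\<forall>x\<in>V. \<forall>y\<in>W. T (\<tau> x y) = \<tau> x (A y)) \<and> (\<forall>z. norm (T z) \<le> K * norm z)"
  using tensor_pair.left_ampliation[OF swap assms] by blast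

end

text \<open>Two extensions in a row. For a fixed generator \<open>h j\<close> the left slot is
  extended, with norms scaled by that of \<open>h j\<close>; then for each \<open>x\<close> the
  right slot is extended, with norms scaled by that of \<open>x\<close>.\<close>

theorem tensor_pair_exists:
  fixes g :: "'i \<Rightarrow> 'a::complex_hilbert" and h :: "'j \<Rightarrow> 'a" and k :: "'i \<Rightarrow> 'j \<Rightarrow> 'a"
  assumes iso: "\<And>i j i' j'. i \<in> I \<Longrightarrow> j \<in> J \<Longrightarrow> i' \<in> I \<Longrightarrow> j' \<in> J \<Longrightarrow>
      cinner (k i j) (k i' j') = cinner (g i) (g i') * cinner (h j) (h j')"
    and total: "closure (cspan {k i j | i j. i \<in> I \<and> j \<in> J}) = UNIV"
  shows "\<exists>\<tau>. tensor_pair (closure (cspan (g ` I))) (closure (cspan (h ` J))) \<tau> \<and>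
    (\<forall>i\<in>I. \<forall>j\<in>J. \<tau> (g i) (h j) = k i j)"
proof -
  let ?V = "closure (cspan (g ` I))" and ?W = "closure (cspan (h ` J))"
  have V: "csubspace ?V" and W: "csubspace ?W" by (intro csubspace_closure csubspace_cspan)+
  have "\<exists>M. (\<forall>i\<in>I. M (g i) = k i j) \<and> bounded_clinear_on ?V M" if "j \<in> J" for j
    using that by (intro isometric_extension[where r = "(norm (h j))\<^sup>2"])
      (auto simp: iso cinner_self mult.commute)
  then obtain M where M: "\<And>i j. i \<in> I \<Longrightarrow> j \<in> J \<Longrightarrow> M j (g i) = k i j"
    "\<And>j. j \<in> J \<Longrightarrow> bounded_clinear_on ?V (M j)" by metis
  have Minner: "cinner (M j x) (M j' x') = cinner x x' * cinner (h j) (h j')"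
    if "j \<in> J" "j' \<in> J" "x \<in> ?V" "x' \<in> ?V" for j j' x x'
    using cinner_eq_on_total[OF M(2) M(2), of j j' "cinner (h j) (h j')" x x'] that
    by (simp add: M(1) iso mult.commute)
  have "\<exists>L. (\<forall>j\<in>J. L (h j) = M j x) \<and> bounded_clinear_on ?W L" if "x \<in> ?V" for x
    using that by (intro isometric_extension[where r = "(norm x)\<^sup>2"])
      (auto simp: Minner cinner_self)
  then obtain L where L: "\<And>x j. x \<in> ?V \<Longrightarrow> j \<in> J \<Longrightarrow> L x (h j) = M j x"
    "\<And>x. x \<in> ?V \<Longrightarrow> bounded_clinear_on ?W (L x)" by metis
  have Linner: "cinner (L x y) (L x' y') = cinner x x' * cinner y y'"
    if "x \<in> ?V" "x' \<in> ?V" "y \<in> ?W" "y' \<in> ?W" for x x' y y'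
    using cinner_eq_on_total[OF L(2) L(2), of x x' "cinner x x'" y y'] that
    by (simp add: L(1) Minner)
  have Lk: "L (g i) (h j) = k i j" if "i \<in> I" "j \<in> J" for i j
    using that closure_subset cspan_base L(1) M(1) by (metis imageI subsetD)
  have "tensor_pair ?V ?W L"
  proof
    fix x x' y assume xy: "x \<in> ?V" "x' \<in> ?V" "y \<in> ?W"
    \<comment> \<open>Linearity in the left slot is not built into \<open>L\<close>; it follows
      because \<open>Linner\<close> gives the defect norm zero.\<close>
    have "cinner (L (x + x') y - L x y - L x' y) (L (x + x') y - L x y - L x' y) = 0"
      using xy by (simp add: cinner_simps Linner csubspaceD[OF V] algebra_simps)
    then show "L (x + x') y = L x y + L x' y" by (simp add: cinner_eq_zero_iff algebra_simps)
  next
    fix x y c assume xy: "x \<in> ?V" "y \<in> ?W"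
    have "cinner (L (c *\<^sub>C x) y - c *\<^sub>C L x y) (L (c *\<^sub>C x) y - c *\<^sub>C L x y) = 0"
      using xy by (simp add: cinner_simps Linner csubspaceD[OF V] algebra_simps)
    then show "L (c *\<^sub>C x) y = c *\<^sub>C L x y" by (simp add: cinner_eq_zero_iff)
  next
    have "{k i j | i j. i \<in> I \<and> j \<in> J} \<subseteq> {L x y | x y. x \<in> ?V \<and> y \<in> ?W}"
    proof clarify
      fix i j assume "i \<in> I" "j \<in> J"
      then show "\<exists>x y. k i j = L x y \<and> x \<in> ?V \<and> y \<in> ?W"
        using Lk closure_subset cspan_base by (metis imageI subsetD)
    qed
    also have "\<dots> \<subseteq> closure (cspan {L x y | x y. x \<in> ?V \<and> y \<in> ?W})"
      by (intro subsetI subsetD[OF closure_subset]) (rule cspan_base)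
    finally have "closure (cspan {k i j | i j. i \<in> I \<and> j \<in> J})
        \<subseteq> closure (cspan {L x y | x y. x \<in> ?V \<and> y \<in> ?W})"
      by (rule closure_cspan_minimal) (auto intro: csubspace_closure csubspace_cspan)
    then show "closure (cspan {L x y | x y. x \<in> ?V \<and> y \<in> ?W}) = UNIV" using total by blast
  qed (auto simp: V W Linner bounded_clinear_onD[OF L(2) W])
  then show ?thesis using Lk by blast
qed

text \<open>Needed to pass from a constructed tensor map to \<open>fock_tensor\<close>, which is
  compared with it on the two factors only.\<close>

lemma tensor_pair_cong:
  assumes "tensor_pair V W \<tau>" and eq: "\<And>x y. x \<in> V \<Longrightarrow> y \<in> W \<Longrightarrow> \<tau>' x y = \<tau> x y"
  shows "tensor_pair V W \<tau>'"
proof -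
  interpret tensor_pair V W \<tau> by fact
  show ?thesis
  proof
    have "{\<tau>' x y | x y. x \<in> V \<and> y \<in> W} = {\<tau> x y | x y. x \<in> V \<and> y \<in> W}" using eq by force
    then show "closure (cspan {\<tau>' x y | x y. x \<in> V \<and> y \<in> W}) = UNIV" using total by simp
  qed (auto simp: V W eq csubspaceD[OF V] csubspaceD[OF W] add_left add_right scale_left scale_right inner)
qed

subsection \<open>Square-integrable functions\<close>

lemma distr_lebesgue_translation: "distr lebesgue lebesgue ((+) t) = (lebesgue :: real measure)"
  using lebesgue_real_affine[of 1 t] by (simp add: density_1)

lemma measurable_lebesgue_translation: "(+) t \<in> lebesgue \<rightarrow>\<^sub>M (lebesgue :: real measure)"
  using lebesgue_affine_measurable[where c = "\<lambda>x::real. 1" and t = t] by simp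

lemma AE_lebesgue_translation:
  assumes "AE x in lebesgue. P x" shows "AE x in lebesgue. P (t + x :: real)"
proof (rule AE_distrD[OF measurable_lebesgue_translation])
  show "AE x in distr lebesgue lebesgue ((+) t). P x"
    using assms by (simp only: distr_lebesgue_translation)
qed

text \<open>Continuity of \<open>F\<close> is asked for along sequences, matching the almost
  everywhere limits that define strong measurability.\<close>

lemma strongly_measurable_compose2:
  assumes "strongly_measurable M f" "strongly_measurable M g"
    and "\<And>a b u v. a \<longlonglongrightarrow> u \<Longrightarrow> b \<longlonglongrightarrow> v \<Longrightarrow> (\<lambda>n. F (a n) (b n)) \<longlonglongrightarrow> F u v"
  shows "strongly_measurable M (\<lambda>x. F (f x) (g x))"
proof -
  obtain a where a: "\<And>i::nat. simple_function M (a i)" "AE x in M. (\<lambda>i. a i x) \<longlonglongrightarrow> f x"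
    using assms(1) unfolding strongly_measurable_def by blast
  obtain b where b: "\<And>i::nat. simple_function M (b i)" "AE x in M. (\<lambda>i. b i x) \<longlonglongrightarrow> g x"
    using assms(2) unfolding strongly_measurable_def by blast
  show ?thesis unfolding strongly_measurable_def
  proof (intro exI[of _ "\<lambda>i x. F (a i x) (b i x)"] conjI allI)
    show "simple_function M (\<lambda>x. F (a i x) (b i x))" for i
      using a(1) b(1) by (rule simple_function_compose2)
    show "AE x in M. (\<lambda>i. F (a i x) (b i x)) \<longlonglongrightarrow> F (f x) (g x)"
      using a(2) b(2) by eventually_elim (rule assms(3))
  qed
qed

lemma strongly_measurable_const: "strongly_measurable M (\<lambda>_. c)"
  unfolding strongly_measurable_def by (intro exI[of _ "\<lambda>_ _. c"]) auto

lemma strongly_measurable_simple: "simple_function M f \<Longrightarrow> strongly_measurable M f"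
  unfolding strongly_measurable_def by (intro exI[of _ "\<lambda>_. f"]) auto

lemma strongly_measurable_If:
  assumes "strongly_measurable M f" "strongly_measurable M g" "A \<inter> space M \<in> sets M"
  shows "strongly_measurable M (\<lambda>x. if x \<in> A then f x else g x)"
proof -
  obtain a where a: "\<And>i::nat. simple_function M (a i)" "AE x in M. (\<lambda>i. a i x) \<longlonglongrightarrow> f x"
    using assms(1) unfolding strongly_measurable_def by blast
  obtain b where b: "\<And>i::nat. simple_function M (b i)" "AE x in M. (\<lambda>i. b i x) \<longlonglongrightarrow> g x"
    using assms(2) unfolding strongly_measurable_def by blast
  show ?thesis unfolding strongly_measurable_def
  proof (intro exI[of _ "\<lambda>i x. if x \<in> A then a i x else b i x"] conjI allI)
    show "simple_function M (\<lambda>x. if x \<in> A then a i x else b i x)" for i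
      using a(1) b(1) assms(3) by (rule simple_function_If_set)
    show "AE x in M. (\<lambda>i. if x \<in> A then a i x else b i x) \<longlonglongrightarrow> (if x \<in> A then f x else g x)"
      using a(2) b(2) by eventually_elim simp
  qed
qed

lemma strongly_measurable_translation:
  assumes "strongly_measurable lebesgue f"
  shows "strongly_measurable lebesgue (\<lambda>x. f (t + x :: real))"
proof -
  obtain a where a: "\<And>i::nat. simple_function lebesgue (a i)"
      "AE x in lebesgue. (\<lambda>i. a i x) \<longlonglongrightarrow> f x"
    using assms(1) unfolding strongly_measurable_def by blast
  show ?thesis unfolding strongly_measurable_def
  proof (intro exI[of _ "\<lambda>i x. a i (t + x)"] conjI allI)
    show "simple_function lebesgue (\<lambda>x. a i (t + x))" for i
      by (rule simple_function_comp[OF measurable_lebesgue_translation a(1)])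
    show "AE x in lebesgue. (\<lambda>i. a i (t + x)) \<longlonglongrightarrow> f (t + x)"
      by (rule AE_lebesgue_translation) (rule a(2))
  qed
qed

text \<open>The simple functions converge only almost everywhere. Setting \<open>f\<close> to 0 on a
  null set restores convergence everywhere, and completeness of Lebesgue measure brings
  measurability back to \<open>f\<close>.\<close>

lemma strongly_measurable_imp_borel_measurable:
  fixes f :: "real \<Rightarrow> 'b::{second_countable_topology, real_normed_vector}"
  assumes "strongly_measurable lebesgue f" shows "f \<in> borel_measurable lebesgue"
proof -
  obtain a where a: "\<And>i::nat. simple_function lebesgue (a i)"
      "AE x in lebesgue. (\<lambda>i. a i x) \<longlonglongrightarrow> f x"
    using assms(1) unfolding strongly_measurable_def by blast
  obtain N where N: "{x \<in> space lebesgue. \<not> (\<lambda>i. a i x) \<longlonglongrightarrow> f x} \<subseteq> N" "N \<in> sets lebesgue"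
    "emeasure lebesgue N = 0" using a(2) by (rule AE_E)
  define h where "h x = (if x \<in> N then 0 else f x)" for x
  have "h \<in> borel_measurable lebesgue"
  proof (rule borel_measurable_LIMSEQ_metric)
    show "(\<lambda>x. if x \<in> N then 0 else a i x) \<in> borel_measurable lebesgue" for i
      using borel_measurable_simple_function[OF a(1)[of i]] N(2) by measurable
    show "(\<lambda>i. if x \<in> N then 0 else a i x) \<longlonglongrightarrow> h x" for x
      using N(1) by (auto simp: h_def)
  qed
  moreover have "AE x in lebesgue. h x = f x"
  proof (rule AE_I[OF _ N(3,2)])
    show "{x \<in> space lebesgue. h x \<noteq> f x} \<subseteq> N" by (auto simp: h_def)
  qed
  ultimately show ?thesis
  proof (intro measurableI)
    fix B :: "'b set" assume h: "h \<in> borel_measurable lebesgue" and ae: "AE x in lebesgue. h x = f x"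
      and B: "B \<in> sets borel"
    have "AE x in lebesgue. x \<in> h -` B \<inter> space lebesgue \<longleftrightarrow> x \<in> f -` B \<inter> space lebesgue"
      using ae by eventually_elim simp
    then show "f -` B \<inter> space lebesgue \<in> sets lebesgue"
      by (rule completion.in_sets_AE) (use measurable_sets[OF h B] in auto)
  qed simp
qed

lemma strongly_measurable_half_line_iff:
  fixes f :: "real \<Rightarrow> 'k::complex_hilbert"
  shows "strongly_measurable half_line f \<longleftrightarrow> strongly_measurable lebesgue (cut {0..} f)"
proof
  assume "strongly_measurable half_line f"
  then obtain a where a: "\<And>i::nat. simple_function half_line (a i)"
      "AE x in half_line. (\<lambda>i. a i x) \<longlonglongrightarrow> f x"
    unfolding strongly_measurable_def by blast
  show "strongly_measurable lebesgue (cut {0..} f)" unfolding strongly_measurable_def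
  proof (intro exI[of _ "\<lambda>i x. indicator {0..} x *\<^sub>R a i x"] conjI allI)
    show "simple_function lebesgue (\<lambda>x. indicator {0..} x *\<^sub>R a i x)" for i
      using a(1)[of i] by (subst (asm) simple_function_restrict_space) auto
    have "AE x in lebesgue. x \<in> {0..} \<longrightarrow> (\<lambda>i. a i x) \<longlonglongrightarrow> f x"
      using a(2) by (subst (asm) AE_restrict_space_iff) auto
    then show "AE x in lebesgue. (\<lambda>i. indicator {0..} x *\<^sub>R a i x) \<longlonglongrightarrow> cut {0..} f x"
      by eventually_elim (auto simp: cut_def indicator_def)
  qed
next
  assume "strongly_measurable lebesgue (cut {0..} f)"
  then obtain a where a: "\<And>i::nat. simple_function lebesgue (a i)"
      "AE x in lebesgue. (\<lambda>i. a i x) \<longlonglongrightarrow> cut {0..} f x"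
    unfolding strongly_measurable_def by blast
  show "strongly_measurable half_line f" unfolding strongly_measurable_def
  proof (intro exI[of _ a] conjI allI)
    show "simple_function half_line (a i)" for i
    proof (subst simple_function_restrict_space)
      have "simple_function lebesgue (\<lambda>x. if x \<in> {0..} then a i x else 0)"
        by (rule simple_function_If_set) (use a(1) in auto)
      also have "(\<lambda>x. if x \<in> {0..} then a i x else 0) = (\<lambda>x. indicator {0..} x *\<^sub>R a i x)"
        by (auto simp: fun_eq_iff indicator_def)
      finally show "simple_function lebesgue (\<lambda>x. indicator {0..} x *\<^sub>R a i x)" .
    qed simp
    show "AE x in half_line. (\<lambda>i. a i x) \<longlonglongrightarrow> f x"
    proof (subst AE_restrict_space_iff)
      show "AE x in lebesgue. x \<in> {0..} \<longrightarrow> (\<lambda>i. a i x) \<longlonglongrightarrow> f x"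
        using a(2) by eventually_elim (auto simp: cut_def)
    qed simp
  qed
qed

text \<open>The whole line is invariant under translations in both directions; functions on the half
  line enter through \<open>cut {0..}\<close>.\<close>

definition L2_line :: "(real \<Rightarrow> 'k::complex_hilbert) set"
  where "L2_line = {f. strongly_measurable lebesgue f \<and> integrable lebesgue (\<lambda>t. (norm (f t))\<^sup>2)}"

lemma L2_iff: "f \<in> L2 \<longleftrightarrow> cut {0..} f \<in> L2_line"
proof -
  have "integrable half_line (\<lambda>t. (norm (f t))\<^sup>2) \<longleftrightarrow> integrable lebesgue (\<lambda>t. (norm (cut {0..} f t))\<^sup>2)"
  proof (subst integrable_restrict_space)
    have "indicator {0..} t *\<^sub>R (norm (f t))\<^sup>2 = (norm (cut {0..} f t))\<^sup>2" for t
      by (simp add: cut_def)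
    then show "integrable lebesgue (\<lambda>t. indicator {0..} t *\<^sub>R (norm (f t))\<^sup>2) \<longleftrightarrow>
        integrable lebesgue (\<lambda>t. (norm (cut {0..} f t))\<^sup>2)" by simp
  qed simp
  then show ?thesis
    by (simp add: L2_def L2_line_def strongly_measurable_half_line_iff)
qed

lemma L2_inner_line:
  "L2_inner f g = (LINT t|lebesgue. cinner (cut {0..} f t) (cut {0..} g t))"
  unfolding L2_inner_def
  by (subst integral_restrict_space) (auto intro!: Bochner_Integration.integral_cong simp: cut_def indicator_def)

lemma L2_line_borel:
  "f \<in> L2_line \<Longrightarrow> g \<in> L2_line \<Longrightarrow> (\<lambda>t. cinner (f t) (g t)) \<in> borel_measurable lebesgue"
  by (rule strongly_measurable_imp_borel_measurable,
      rule strongly_measurable_compose2[where F = cinner])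
    (auto simp: L2_line_def intro: tendsto_cinner)

lemma L2_line_cinner:
  assumes "f \<in> L2_line" "g \<in> L2_line"
  shows "integrable lebesgue (\<lambda>t. cinner (f t) (g t))"
proof (rule Bochner_Integration.integrable_bound)
  show "integrable lebesgue (\<lambda>t. (norm (f t))\<^sup>2 + (norm (g t))\<^sup>2)"
    using assms by (auto simp: L2_line_def)
  show "AE t in lebesgue. norm (cinner (f t) (g t)) \<le> norm ((norm (f t))\<^sup>2 + (norm (g t))\<^sup>2)"
  proof (intro AE_I2)
    fix t
    have "cmod (cinner (f t) (g t)) \<le> norm (f t) * norm (g t)" by (rule cauchy_schwarz)
    also have "\<dots> \<le> (norm (f t))\<^sup>2 + (norm (g t))\<^sup>2"
      using sum_squares_bound[of "norm (f t)" "norm (g t)"]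
        mult_nonneg_nonneg[OF norm_ge_zero norm_ge_zero, of "f t" "g t"] by linarith
    finally show "norm (cinner (f t) (g t)) \<le> norm ((norm (f t))\<^sup>2 + (norm (g t))\<^sup>2)" by simp
  qed
qed (rule L2_line_borel[OF assms])

lemma norm_sq_le_two: "(norm (x - y))\<^sup>2 \<le> 2 * (norm x)\<^sup>2 + 2 * (norm y)\<^sup>2"
  for x :: "'a::real_normed_vector"
proof -
  have "(norm (x - y))\<^sup>2 \<le> (norm x + norm y)\<^sup>2"
    by (intro power_mono norm_triangle_ineq4) simp
  also have "\<dots> \<le> 2 * (norm x)\<^sup>2 + 2 * (norm y)\<^sup>2"
    using sum_squares_bound[of "norm x" "norm y"] by (simp add: power2_sum)
  finally show ?thesis .
qed

text \<open>A domination test with two dominating functions, shaped so that differences, case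
  distinctions and truncations all fit it.\<close>

lemma L2_lineI:
  assumes "strongly_measurable lebesgue h" "f \<in> L2_line" "g \<in> L2_line"
    and "\<And>t. (norm (h t))\<^sup>2 \<le> 2 * (norm (f t))\<^sup>2 + 2 * (norm (g t))\<^sup>2"
  shows "h \<in> L2_line"
proof -
  have "(\<lambda>t. (norm (h t))\<^sup>2) \<in> borel_measurable lebesgue"
    by (intro strongly_measurable_imp_borel_measurable
        strongly_measurable_compose2[where F = "\<lambda>x _. (norm x)\<^sup>2", OF assms(1,1)]) (intro tendsto_intros)
  moreover have "integrable lebesgue (\<lambda>t. 2 * (norm (f t))\<^sup>2 + 2 * (norm (g t))\<^sup>2)"
    using assms by (auto simp: L2_line_def)
  ultimately have "integrable lebesgue (\<lambda>t. (norm (h t))\<^sup>2)"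
    using assms(4) by (intro Bochner_Integration.integrable_bound[of lebesgue _ "\<lambda>t. (norm (h t))\<^sup>2"] AE_I2) fastforce+
  then show ?thesis using assms(1) by (simp add: L2_line_def)
qed

lemma L2_line_zero: "(\<lambda>_. 0) \<in> L2_line"
  by (simp add: L2_line_def strongly_measurable_const)

lemma L2_line_diff: "f \<in> L2_line \<Longrightarrow> g \<in> L2_line \<Longrightarrow> (\<lambda>t. f t - g t) \<in> L2_line"
  by (rule L2_lineI[of _ f g], rule strongly_measurable_compose2[where F = "(-)"])
    (auto simp: L2_line_def norm_sq_le_two intro: tendsto_diff)

lemma L2_line_If:
  assumes "f \<in> L2_line" "g \<in> L2_line" "A \<in> sets lebesgue"
  shows "(\<lambda>t. if t \<in> A then f t else g t) \<in> L2_line"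
  by (rule L2_lineI[of _ f g], rule strongly_measurable_If)
    (use assms in \<open>auto simp: L2_line_def\<close>)

lemma L2_line_cut: "f \<in> L2_line \<Longrightarrow> A \<in> sets lebesgue \<Longrightarrow> cut A f \<in> L2_line"
  unfolding cut_def by (intro L2_line_If L2_line_zero)

lemma L2_line_translation: "f \<in> L2_line \<Longrightarrow> (\<lambda>x. f (t + x)) \<in> L2_line"
  using lebesgue_integrable_real_affine_iff[of 1 "\<lambda>x. (norm (f x))\<^sup>2" t]
  by (auto simp: L2_line_def intro: strongly_measurable_translation)

lemma integral_lebesgue_translation:
  fixes f :: "real \<Rightarrow> 'a::euclidean_space"
  shows "(LINT x|lebesgue. f (t + x)) = (LINT x|lebesgue. f x)"
  using lebesgue_integral_real_affine[of 1 f t] by simp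

text \<open>Truncating a sequence of simple functions by \<open>2 \<parallel>f\<parallel>\<close> makes its convergence dominated.\<close>

lemma L2_line_simple_approx:
  fixes f :: "real \<Rightarrow> 'k::complex_hilbert"
  assumes f: "f \<in> L2_line" and e: "e > 0"
  shows "\<exists>u. simple_function lebesgue u \<and> u \<in> L2_line \<and> (LINT t|lebesgue. (norm (f t - u t))\<^sup>2) < e"
proof -
  obtain a where a: "\<And>i::nat. simple_function lebesgue (a i)"
      "AE x in lebesgue. (\<lambda>i. a i x) \<longlonglongrightarrow> f x"
    using f unfolding strongly_measurable_def L2_line_def by blast
  have fm: "(\<lambda>x. norm (f x)) \<in> borel_measurable lebesgue"
    by (intro strongly_measurable_imp_borel_measurable
        strongly_measurable_compose2[where F = "\<lambda>x _. norm x" and f = f and g = f] tendsto_norm)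
      (use f in \<open>auto simp: L2_line_def\<close>)
  define u where "u i x = (if x \<in> {x. norm (a i x) \<le> 2 * norm (f x)} then a i x else 0)" for i x
  have su: "simple_function lebesgue (u i)" for i
    unfolding u_def
  proof (intro simple_function_If_set a simple_function_const)
    have [measurable]: "(\<lambda>x. norm (a i x)) \<in> borel_measurable lebesgue"
      by (intro borel_measurable_simple_function simple_function_compose1[OF a(1)])
    note fm [measurable]
    have "{x \<in> space lebesgue. norm (a i x) \<le> 2 * norm (f x)} \<in> sets lebesgue" by measurable
    then show "{x. norm (a i x) \<le> 2 * norm (f x)} \<inter> space lebesgue \<in> sets lebesgue" by simp
  qed
  have ub: "norm (u i x) \<le> 2 * norm (f x)" for i x by (simp add: u_def)
  have uL2: "u i \<in> L2_line" for i
  proof (rule L2_lineI[of _ f f])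
    show "(norm (u i t))\<^sup>2 \<le> 2 * (norm (f t))\<^sup>2 + 2 * (norm (f t))\<^sup>2" for t
      using power_mono[OF ub[of i t] norm_ge_zero, of 2] by (simp add: power_mult_distrib)
  qed (use f su in \<open>auto intro: strongly_measurable_simple\<close>)
  have "(\<lambda>i. LINT t|lebesgue. (norm (f t - u i t))\<^sup>2) \<longlonglongrightarrow> (LINT t|(lebesgue::real measure). (0::real))"
  \<comment> \<open>With \<open>norm (u i t) \<le> 2 * norm (f t)\<close> the squared difference is
    at most \<open>2 + 2 * 4\<close> times the squared norm of \<open>f t\<close>.\<close>
  proof (rule integral_dominated_convergence[where w = "\<lambda>t. 10 * (norm (f t))\<^sup>2"])
    show "(\<lambda>t. (norm (f t - u i t))\<^sup>2) \<in> borel_measurable lebesgue" for i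
      using L2_line_diff[OF f uL2[of i]] by (auto simp: L2_line_def)
    show "integrable lebesgue (\<lambda>t. 10 * (norm (f t))\<^sup>2)" using f by (simp add: L2_line_def)
    show "AE t in lebesgue. (\<lambda>i. (norm (f t - u i t))\<^sup>2) \<longlonglongrightarrow> 0"
      using a(2)
    proof eventually_elim
      case (elim x)
      have "(\<lambda>i. u i x) \<longlonglongrightarrow> f x"
      proof (cases "f x = 0")
        case True
        then have "u i x = 0" for i using ub[of i x] by simp
        then show ?thesis using True by simp
      next
        case False
        have "(\<lambda>i. norm (a i x)) \<longlonglongrightarrow> norm (f x)" using elim by (rule tendsto_norm)
        then have "\<forall>\<^sub>F i in sequentially. norm (a i x) < 2 * norm (f x)"
          by (rule order_tendstoD) (use False in simp)
        then have "\<forall>\<^sub>F i in sequentially. a i x = u i x"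
          by eventually_elim (simp add: u_def)
        with elim show ?thesis by (rule Lim_transform_eventually)
      qed
      then have "(\<lambda>i. (norm (f x - u i x))\<^sup>2) \<longlonglongrightarrow> (norm (f x - f x))\<^sup>2" by (intro tendsto_intros)
      then show ?case by simp
    qed
    show "AE t in lebesgue. norm ((norm (f t - u i t))\<^sup>2) \<le> 10 * (norm (f t))\<^sup>2" for i
    proof (intro AE_I2)
      fix t
      have "(norm (u i t))\<^sup>2 \<le> 4 * (norm (f t))\<^sup>2"
        using power_mono[OF ub[of i t] norm_ge_zero, of 2] by (simp add: power_mult_distrib)
      then show "norm ((norm (f t - u i t))\<^sup>2) \<le> 10 * (norm (f t))\<^sup>2"
        using norm_sq_le_two[of "f t" "u i t"] by simp
    qed
  qed simp
  then have "(\<lambda>i. LINT t|lebesgue. (norm (f t - u i t))\<^sup>2) \<longlonglongrightarrow> 0" by simp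
  then have "\<forall>\<^sub>F i in sequentially. (LINT t|lebesgue. (norm (f t - u i t))\<^sup>2) < e"
    using e by (rule order_tendstoD)
  then obtain i where "(LINT t|lebesgue. (norm (f t - u i t))\<^sup>2) < e"
    by (auto simp: eventually_sequentially)
  then show ?thesis using su uL2 by blast
qed

section \<open>Continuity of translations in mean square\<close>

lemma lmeasurable_integrable_indicator:
  "A \<in> lmeasurable \<Longrightarrow> integrable lebesgue (\<lambda>x. indicator A (t + x) :: real)" for A :: "real set"
  using lebesgue_integrable_real_affine_iff[of 1 "indicator A :: real \<Rightarrow> real" t]
  by (auto simp: fmeasurable_def intro!: integrable_real_indicator)

text \<open>The measure of the symmetric difference is twice that of \<open>U\<close> minus twice
  that of its overlap with the translate. Around a point of an open set all small translations stay
  inside, so dominated convergence applies to the overlap.\<close>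

lemma tendsto_measure_open_translation:
  fixes U :: "real set"
  assumes U: "open U" "U \<in> lmeasurable"
  shows "((\<lambda>t. LINT x|lebesgue. \<bar>indicator U (t + x) - indicator U x\<bar> :: real) \<longlongrightarrow> 0) (at 0)"
proof -
  have int: "integrable lebesgue (\<lambda>x. indicator U (t + x) :: real)" for t
    using U(2) by (rule lmeasurable_integrable_indicator)
  have int0: "integrable lebesgue (indicator U :: real \<Rightarrow> real)" using int[of 0] by simp
  have intm: "integrable lebesgue (\<lambda>x. indicator U (t + x) * indicator U x :: real)" for t
  proof (rule Bochner_Integration.integrable_bound[OF int0])
    show "(\<lambda>x. indicator U (t + x) * indicator U x :: real) \<in> borel_measurable lebesgue"
      using borel_measurable_integrable[OF int[of t]] borel_measurable_integrable[OF int0]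
      by measurable
  qed (auto simp: indicator_def)
  have eq: "(LINT x|lebesgue. \<bar>indicator U (t + x) - indicator U x\<bar> :: real) =
    2 * (LINT x|lebesgue. indicator U x) - 2 * (LINT x|lebesgue. indicator U (t + x) * indicator U x)" for t
  proof -
    have "(LINT x|lebesgue. \<bar>indicator U (t + x) - indicator U x\<bar> :: real) =
      (LINT x|lebesgue. indicator U (t + x) + indicator U x - 2 * (indicator U (t + x) * indicator U x))"
      by (intro Bochner_Integration.integral_cong) (auto simp: indicator_def)
    also have "\<dots> = (LINT x|lebesgue. indicator U (t + x)) + (LINT x|lebesgue. indicator U x)
        - 2 * (LINT x|lebesgue. indicator U (t + x) * indicator U x)"
      using int int0 intm by simp
    also have "(LINT x|lebesgue. indicator U (t + x) :: real) = (LINT x|lebesgue. indicator U x)"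
      using integral_lebesgue_translation[of "indicator U :: real \<Rightarrow> real" t] .
    finally show ?thesis by simp
  qed
  have "((\<lambda>t. LINT x|lebesgue. indicator U (t + x) * indicator U x :: real) \<longlongrightarrow>
      (LINT x|lebesgue. indicator U x)) (at 0)"
    unfolding tendsto_at_iff_sequentially
  proof (intro allI impI, unfold o_def)
    fix X :: "nat \<Rightarrow> real" assume X: "\<forall>i. X i \<in> UNIV - {0}" "X \<longlonglongrightarrow> 0"
    show "(\<lambda>n. LINT x|lebesgue. indicator U (X n + x) * indicator U x :: real) \<longlonglongrightarrow>
      (LINT x|lebesgue. indicator U x)"
    proof (rule integral_dominated_convergence[where w = "indicator U"])
      show "AE x in lebesgue. (\<lambda>i. indicator U (X i + x) * indicator U x) \<longlonglongrightarrow> (indicator U x :: real)"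
      proof (intro AE_I2)
        fix x
        show "(\<lambda>i. indicator U (X i + x) * indicator U x) \<longlonglongrightarrow> (indicator U x :: real)"
        proof (cases "x \<in> U")
          case True
          have "(\<lambda>i. X i + x) \<longlonglongrightarrow> 0 + x" by (intro tendsto_intros X)
          then have "\<forall>\<^sub>F i in sequentially. X i + x \<in> U"
            using U(1) True by (auto dest: topological_tendstoD)
          then have "\<forall>\<^sub>F i in sequentially. 1 = indicator U (X i + x) * (indicator U x :: real)"
            by eventually_elim (use True in simp)
          from Lim_transform_eventually[OF tendsto_const this] show ?thesis using True by simp
        qed simp
      qed
      show "(\<lambda>x. indicator U (X i + x) * indicator U x :: real) \<in> borel_measurable lebesgue" for i
        using intm by (rule borel_measurable_integrable)
      show "AE x in lebesgue. norm (indicator U (X i + x) * indicator U x :: real) \<le> indicator U x" for i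
        by (auto simp: indicator_def)
    qed (use int0 in \<open>auto intro: borel_measurable_integrable\<close>)
  qed
  then have "((\<lambda>t. 2 * (LINT x|lebesgue. indicator U x) -
      2 * (LINT x|lebesgue. indicator U (t + x) * indicator U x) :: real) \<longlongrightarrow>
      2 * (LINT x|lebesgue. indicator U x) - 2 * (LINT x|lebesgue. indicator U x)) (at 0)"
    by (intro tendsto_intros)
  then show ?thesis by (simp add: eq)
qed

text \<open>Outer regularity replaces \<open>A\<close> by an open set. The excess
  \<open>U - A\<close> is counted once at \<open>x\<close> and once at \<open>t + x\<close>, so an
  excess below \<open>e / 4\<close> costs at most \<open>e / 2\<close>.\<close>

lemma tendsto_measure_translation:
  fixes A :: "real set"
  assumes A: "A \<in> lmeasurable"
  shows "((\<lambda>t. LINT x|lebesgue. \<bar>indicator A (t + x) - indicator A x\<bar> :: real) \<longlongrightarrow> 0) (at 0)"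
    (is "(?\<phi> A \<longlongrightarrow> 0) (at 0)")
proof (rule tendstoI)
  fix e :: real assume e: "e > 0"
  have As: "A \<in> sets lebesgue" using A by (simp add: fmeasurable_def)
  obtain U where U: "open U" "A \<subseteq> U" "U - A \<in> lmeasurable" "emeasure lebesgue (U - A) < ennreal (e / 4)"
    using sets_lebesgue_outer_open[OF As, of "e / 4"] e by auto
  have Um: "U \<in> lmeasurable"
  proof -
    have "U = A \<union> (U - A)" using U(2) by blast
    then show ?thesis using fmeasurable.Un[OF A U(3)] by simp
  qed
  have small: "(LINT x|lebesgue. indicator (U - A) x :: real) < e / 4"
    using U(3,4) e by (simp add: emeasure_eq_measure2 ennreal_less_iff)
  have int: "integrable lebesgue (\<lambda>x. indicator B (t + x) :: real)" if "B \<in> lmeasurable" for B and t :: real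
    using that by (rule lmeasurable_integrable_indicator)
  have int0: "integrable lebesgue (\<lambda>x. indicator B x :: real)" if "B \<in> lmeasurable" for B :: "real set"
    using int[OF that, of 0] by simp
  have bound: "?\<phi> A t \<le> ?\<phi> U t + e / 2" for t
  proof -
    have "?\<phi> A t \<le> (LINT x|lebesgue. \<bar>indicator U (t + x) - indicator U x\<bar>
        + indicator (U - A) (t + x) + indicator (U - A) x)"
    proof (rule integral_mono)
      show "integrable lebesgue (\<lambda>x. \<bar>indicator A (t + x) - indicator A x\<bar> :: real)"
        by (intro integrable_abs Bochner_Integration.integrable_diff int int0 A)
      show "integrable lebesgue (\<lambda>x. \<bar>indicator U (t + x) - indicator U x\<bar>
          + indicator (U - A) (t + x) + indicator (U - A) x :: real)"
        by (intro integrable_abs Bochner_Integration.integrable_diff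
            Bochner_Integration.integrable_add int int0 Um U(3))
      show "\<bar>indicator A (t + x) - indicator A x\<bar> \<le> \<bar>indicator U (t + x) - indicator U x\<bar>
          + indicator (U - A) (t + x) + (indicator (U - A) x :: real)" for x
        using U(2) by (auto simp: indicator_def)
    qed
    also have "\<dots> = ?\<phi> U t + (LINT x|lebesgue. indicator (U - A) (t + x))
        + (LINT x|lebesgue. indicator (U - A) x)"
      using Um U(3) int int0 by simp
    also have "(LINT x|lebesgue. indicator (U - A) (t + x) :: real) = (LINT x|lebesgue. indicator (U - A) x)"
      using integral_lebesgue_translation[of "indicator (U - A) :: real \<Rightarrow> real" t] .
    finally show ?thesis using small by linarith
  qed
  have "\<forall>\<^sub>F t in at 0. ?\<phi> U t < e / 2"
    using tendsto_measure_open_translation[OF U(1) Um] by (rule order_tendstoD) (use e in simp)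
  then show "\<forall>\<^sub>F t in at 0. dist (?\<phi> A t) 0 < e"
  proof eventually_elim
    case (elim t)
    have "?\<phi> A t \<ge> 0" by (intro Bochner_Integration.integral_nonneg) auto
    then show ?case using bound[of t] elim by (simp add: dist_real_def)
  qed
qed

text \<open>For a simple function only the boundaries between finitely many level sets matter, so
  the claim reduces to indicators; translation invariance of the integral transfers it to
  \<open>f\<close>.\<close>

theorem L2_translation_continuous:
  fixes f :: "real \<Rightarrow> 'k::complex_hilbert"
  assumes f: "f \<in> L2_line"
  shows "((\<lambda>t. LINT x|lebesgue. (norm (f (t + x) - f x))\<^sup>2) \<longlongrightarrow> 0) (at 0)"
proof (rule tendstoI)
  fix e :: real assume e: "e > 0"
  \<comment> \<open>In \<open>bound\<close> below the approximation error enters with weight 8,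
    since two translates of \<open>f - u\<close> have equal integrals, and the simple function with
    weight 4: together 12.\<close>
  obtain u where u: "simple_function lebesgue u" "u \<in> L2_line"
    "(LINT t|lebesgue. (norm (f t - u t))\<^sup>2) < e / 12"
    using L2_line_simple_approx[OF f, of "e / 12"] e by auto
  have L2I: "integrable lebesgue (\<lambda>x. (norm (g x))\<^sup>2)" if "g \<in> L2_line" for g :: "real \<Rightarrow> 'k"
    using that by (simp add: L2_line_def)
  \<comment> \<open>The level set of a nonzero value has finite measure by integrability of the
    squared norm; that of 0 may be infinite and is left out.\<close>
  define C where "C = range u - {0}"
  have C: "finite C" using simple_functionD(1)[OF u(1)] by (simp add: C_def)
  define A where "A c = u -` {c}" for c
  have A: "A c \<in> lmeasurable" if c: "c \<in> C" for c
  proof -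
    have As: "A c \<in> sets lebesgue" using simple_functionD(2)[OF u(1), of "{c}"] by (simp add: A_def)
    have c0: "(norm c)\<^sup>2 > 0" using c by (simp add: C_def)
    have "integrable lebesgue (\<lambda>x. (1 / (norm c)\<^sup>2) * (norm (u x))\<^sup>2)"
      using L2I[OF u(2)] by simp
    then have "integrable lebesgue (indicator (A c) :: real \<Rightarrow> real)"
      by (rule Bochner_Integration.integrable_bound)
        (use As c0 in \<open>auto simp: A_def indicator_def field_simps\<close>)
    then show ?thesis using As by (simp add: fmeasurable_def integrable_indicator_iff)
  qed
  define M where "M = (\<Sum>c\<in>range u. norm c)"
  have M: "norm (u x) \<le> M" for x
    unfolding M_def using simple_functionD(1)[OF u(1)] by (intro member_le_sum) auto
  have int: "integrable lebesgue (\<lambda>x. \<bar>indicator (A c) (t + x) - indicator (A c) x\<bar> :: real)" if "c \<in> C" for c t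
  proof -
    have "integrable lebesgue (\<lambda>x. indicator (A c) (t + x) :: real)"
      using A[OF that] by (rule lmeasurable_integrable_indicator)
    moreover have "integrable lebesgue (\<lambda>x. indicator (A c) x :: real)"
      using lmeasurable_integrable_indicator[OF A[OF that], of 0] by simp
    ultimately show ?thesis by simp
  qed
  \<comment> \<open>If the two values differ, one of them is nonzero, and the indicator of its level
    set jumps between \<open>x\<close> and \<open>t + x\<close>.\<close>
  have pt: "(norm (u (t + x) - u x))\<^sup>2 \<le> (\<Sum>c\<in>C. (2 * M)\<^sup>2 * \<bar>indicator (A c) (t + x) - indicator (A c) x\<bar>)" for t x
  proof (cases "u (t + x) = u x")
    case True
    then show ?thesis by (auto intro!: sum_nonneg)
  next
    case False
    obtain c where c: "c \<in> C" "\<bar>indicator (A c) (t + x) - indicator (A c) x\<bar> = (1::real)"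
    proof (cases "u x = 0")
      case True
      then show thesis using False by (intro that[of "u (t + x)"]) (auto simp: C_def A_def)
    next
      case f0: False
      then show thesis using False by (intro that[of "u x"]) (auto simp: C_def A_def)
    qed
    have "norm (u (t + x) - u x) \<le> 2 * M"
      using M[of x] M[of "t + x"] norm_triangle_ineq4[of "u (t + x)" "u x"] by linarith
    then have "(norm (u (t + x) - u x))\<^sup>2 \<le> (2 * M)\<^sup>2" by (intro power_mono) auto
    also have "\<dots> = (2 * M)\<^sup>2 * \<bar>indicator (A c) (t + x) - indicator (A c) x\<bar>" using c by simp
    also have "\<dots> \<le> (\<Sum>c\<in>C. (2 * M)\<^sup>2 * \<bar>indicator (A c) (t + x) - indicator (A c) x\<bar>)"
      using c C by (intro member_le_sum) auto
    finally show ?thesis .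
  qed
  have ub: "(LINT x|lebesgue. (norm (u (t + x) - u x))\<^sup>2)
    \<le> (\<Sum>c\<in>C. (2 * M)\<^sup>2 * (LINT x|lebesgue. \<bar>indicator (A c) (t + x) - indicator (A c) x\<bar>))" for t
  proof -
    have "(LINT x|lebesgue. (norm (u (t + x) - u x))\<^sup>2)
      \<le> (LINT x|lebesgue. (\<Sum>c\<in>C. (2 * M)\<^sup>2 * \<bar>indicator (A c) (t + x) - indicator (A c) x\<bar>))"
      using int pt L2I[OF L2_line_diff[OF L2_line_translation[OF u(2)] u(2)]]
      by (intro integral_mono) auto
    then show ?thesis using int by simp
  qed
  have "((\<lambda>t. \<Sum>c\<in>C. (2 * M)\<^sup>2 * (LINT x|lebesgue. \<bar>indicator (A c) (t + x) - indicator (A c) x\<bar> :: real))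
      \<longlongrightarrow> (\<Sum>c\<in>C. (2 * M)\<^sup>2 * 0)) (at 0)"
    by (intro tendsto_sum tendsto_mult tendsto_const tendsto_measure_translation A)
  then have ev: "\<forall>\<^sub>F t in at 0. (\<Sum>c\<in>C. (2 * M)\<^sup>2 * (LINT x|lebesgue. \<bar>indicator (A c) (t + x) - indicator (A c) x\<bar>)) < e / 12"
    by (rule order_tendstoD) (use e in simp)
  have bound: "(LINT x|lebesgue. (norm (f (t + x) - f x))\<^sup>2) \<le>
      8 * (LINT x|lebesgue. (norm (f x - u x))\<^sup>2) + 4 * (LINT x|lebesgue. (norm (u (t + x) - u x))\<^sup>2)" for t
  proof -
    have i1: "integrable lebesgue (\<lambda>x. (norm (f (t + x) - u (t + x)))\<^sup>2)"
      "integrable lebesgue (\<lambda>x. (norm (f x - u x))\<^sup>2)"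
      "integrable lebesgue (\<lambda>x. (norm (u (t + x) - u x))\<^sup>2)"
      "integrable lebesgue (\<lambda>x. (norm (f (t + x) - f x))\<^sup>2)"
      using f u(2) by (auto intro!: L2I L2_line_diff L2_line_translation)
    have "(LINT x|lebesgue. (norm (f (t + x) - f x))\<^sup>2) \<le>
      (LINT x|lebesgue. 4 * (norm (f (t + x) - u (t + x)))\<^sup>2 + 4 * (norm (f x - u x))\<^sup>2
        + 4 * (norm (u (t + x) - u x))\<^sup>2)"
    proof (rule integral_mono)
      fix x
      have "f (t + x) - f x = ((f (t + x) - u (t + x)) - (f x - u x)) - (u x - u (t + x))" by simp
      then have "(norm (f (t + x) - f x))\<^sup>2 \<le>
        2 * (norm ((f (t + x) - u (t + x)) - (f x - u x)))\<^sup>2 + 2 * (norm (u x - u (t + x)))\<^sup>2"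
        by (metis norm_sq_le_two)
      then show "(norm (f (t + x) - f x))\<^sup>2 \<le> 4 * (norm (f (t + x) - u (t + x)))\<^sup>2
        + 4 * (norm (f x - u x))\<^sup>2 + 4 * (norm (u (t + x) - u x))\<^sup>2"
        using norm_sq_le_two[of "f (t + x) - u (t + x)" "f x - u x"]
        unfolding norm_minus_commute[of "u x" "u (t + x)"]
        using zero_le_power2[of "norm (u (t + x) - u x)"] by linarith
    qed (use i1 in auto)
    also have "\<dots> = 4 * (LINT x|lebesgue. (norm (f (t + x) - u (t + x)))\<^sup>2)
        + 4 * (LINT x|lebesgue. (norm (f x - u x))\<^sup>2) + 4 * (LINT x|lebesgue. (norm (u (t + x) - u x))\<^sup>2)"
      using i1 by simp
    also have "(LINT x|lebesgue. (norm (f (t + x) - u (t + x)))\<^sup>2) = (LINT x|lebesgue. (norm (f x - u x))\<^sup>2)"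
      by (rule integral_lebesgue_translation)
    finally show ?thesis by simp
  qed
  show "\<forall>\<^sub>F t in at 0. dist (LINT x|lebesgue. (norm (f (t + x) - f x))\<^sup>2) 0 < e"
    using ev
  proof eventually_elim
    case (elim t)
    have "(LINT x|lebesgue. (norm (f (t + x) - f x))\<^sup>2) \<ge> 0" by (intro Bochner_Integration.integral_nonneg) auto
    then show ?case using bound[of t] ub[of t] u(3) elim by (simp add: dist_real_def)
  qed
qed

section \<open>Cutting, splicing and shifting functions on the half line\<close>

definition splice_at :: "real \<Rightarrow> (real \<Rightarrow> 'k) \<Rightarrow> (real \<Rightarrow> 'k) \<Rightarrow> real \<Rightarrow> 'k"
  where "splice_at t f g = (\<lambda>s. if s < t then f s else g s)"

definition left_shift :: "real \<Rightarrow> (real \<Rightarrow> 'k) \<Rightarrow> real \<Rightarrow> 'k"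
  where "left_shift t f = (\<lambda>s. f (s + t))"

lemma L2_zero: "(\<lambda>_. 0) \<in> L2"
proof -
  have "cut {0..} (\<lambda>_. 0) = (\<lambda>_. 0 :: 'a)" by (simp add: cut_def)
  then show ?thesis by (simp add: L2_iff L2_line_zero)
qed

lemma L2_cut: "f \<in> L2 \<Longrightarrow> A \<in> sets lebesgue \<Longrightarrow> cut A f \<in> L2"
proof -
  have "cut {0..} (cut A f) = cut A (cut {0..} f)" by (auto simp: cut_def)
  then show "f \<in> L2 \<Longrightarrow> A \<in> sets lebesgue \<Longrightarrow> cut A f \<in> L2"
    by (simp add: L2_iff L2_line_cut)
qed

lemma L2_splice:
  assumes "f \<in> L2" "g \<in> L2" shows "splice_at t f g \<in> L2"
proof -
  have "cut {0..} (splice_at t f g) = (\<lambda>s. if s \<in> {..<t} then cut {0..} f s else cut {0..} g s)"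
    by (auto simp: cut_def splice_at_def)
  then show ?thesis using assms by (simp only: L2_iff) (rule L2_line_If, auto)
qed

lemma cut_diff: "cut A (\<lambda>s. f s - g s) = (\<lambda>s. cut A f s - cut A g s)"
  by (auto simp: cut_def)

lemma L2_diff: "f \<in> L2 \<Longrightarrow> g \<in> L2 \<Longrightarrow> (\<lambda>s. f s - g s) \<in> L2"
  unfolding L2_iff cut_diff by (rule L2_line_diff)

lemma cut_right_shift:
  "t \<ge> 0 \<Longrightarrow> cut {0..} (right_shift t f) = (\<lambda>x. cut {0..} f (- t + x))"
  by (auto simp: cut_def right_shift_def fun_eq_iff algebra_simps)

lemma cut_left_shift:
  "t \<ge> 0 \<Longrightarrow> cut {0..} (left_shift t f) = cut {0..} (\<lambda>x. cut {0..} f (t + x))"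
  by (auto simp: cut_def left_shift_def fun_eq_iff add.commute)

lemma L2_right_shift: "t \<ge> 0 \<Longrightarrow> f \<in> L2 \<Longrightarrow> right_shift t f \<in> L2"
  by (simp only: L2_iff cut_right_shift L2_line_translation)

lemma L2_left_shift: "t \<ge> 0 \<Longrightarrow> f \<in> L2 \<Longrightarrow> left_shift t f \<in> L2"
  by (simp add: L2_iff cut_left_shift L2_line_cut L2_line_translation)

text \<open>Puts the part of a function after \<open>t\<close> into the range of the right shift,
  which is why the Fock shift reaches the whole future.\<close>

lemma cut_tail_eq_right_shift: "t \<ge> 0 \<Longrightarrow> cut {t..} f = right_shift t (left_shift t f)"
  by (auto simp: cut_def right_shift_def left_shift_def)

lemma cut_right_shift_tail: "cut {t..} (right_shift t f) = right_shift t f"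
  by (auto simp: cut_def right_shift_def)

lemma L2_inner_right_shift: "t \<ge> 0 \<Longrightarrow> L2_inner (right_shift t f) (right_shift t g) = L2_inner f g"
  unfolding L2_inner_line cut_right_shift
  using integral_lebesgue_translation[of "\<lambda>x. cinner (cut {0..} f x) (cut {0..} g x)" "- t"] by simp

lemma L2_inner_cong:
  assumes "cut {0..} f = cut {0..} f'" "cut {0..} g = cut {0..} g'"
  shows "L2_inner f g = L2_inner f' g'"
  unfolding L2_inner_line assms ..

text \<open>Additivity over disjoint domains; under the exponential it becomes the factorisation of
  inner products of exponential vectors.\<close>

lemma L2_inner_split:
  assumes "f \<in> L2" "g \<in> L2"
  shows "L2_inner f g = L2_inner (cut {0..<t} f) (cut {0..<t} g) + L2_inner (cut {t..} f) (cut {t..} g)"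
proof -
  have "L2_inner f g = (LINT x|lebesgue. cinner (cut {0..} (cut {0..<t} f) x) (cut {0..} (cut {0..<t} g) x)
      + cinner (cut {0..} (cut {t..} f) x) (cut {0..} (cut {t..} g) x))"
    unfolding L2_inner_line by (rule Bochner_Integration.integral_cong) (auto simp: cut_def)
  also have "\<dots> = L2_inner (cut {0..<t} f) (cut {0..<t} g) + L2_inner (cut {t..} f) (cut {t..} g)"
    unfolding L2_inner_line
    by (intro Bochner_Integration.integral_add L2_line_cinner; fold L2_iff)
      (auto intro!: L2_cut assms)
  finally show ?thesis .
qed

lemma L2_integrable: "f \<in> L2 \<Longrightarrow> g \<in> L2 \<Longrightarrow> integrable lebesgue (\<lambda>x. cinner (cut {0..} f x) (cut {0..} g x))"
  by (intro L2_line_cinner; fold L2_iff)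

lemma L2_inner_diff_left:
  "f \<in> L2 \<Longrightarrow> g \<in> L2 \<Longrightarrow> h \<in> L2 \<Longrightarrow> L2_inner (\<lambda>s. f s - g s) h = L2_inner f h - L2_inner g h"
  unfolding L2_inner_line cut_diff by (simp add: cinner_diff_left L2_integrable)

lemma L2_inner_diff_right:
  "f \<in> L2 \<Longrightarrow> g \<in> L2 \<Longrightarrow> h \<in> L2 \<Longrightarrow> L2_inner h (\<lambda>s. f s - g s) = L2_inner h f - L2_inner h g"
  unfolding L2_inner_line cut_diff by (simp add: cinner_diff_right L2_integrable)

definition L2_sq :: "(real \<Rightarrow> 'k::complex_hilbert) \<Rightarrow> real"
  where "L2_sq f = (LINT x|lebesgue. (norm (cut {0..} f x))\<^sup>2)"

lemma L2_sq_nonneg: "L2_sq f \<ge> 0"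
  unfolding L2_sq_def by (intro Bochner_Integration.integral_nonneg) auto

lemma L2_inner_self: "L2_inner f f = complex_of_real (L2_sq f)"
  unfolding L2_inner_line L2_sq_def cinner_self by (rule integral_complex_of_real)

text \<open>A weighted arithmetic-geometric mean estimate under the integral. The free weight lets a
  small argument in one slot win against a fixed one in the other.\<close>

lemma L2_inner_bound:
  assumes "f \<in> L2" "g \<in> L2" "K > 0"
  shows "cmod (L2_inner f g) \<le> K * L2_sq f + L2_sq g / K"
proof -
  have i: "integrable lebesgue (\<lambda>x. (norm (cut {0..} f x))\<^sup>2)"
    "integrable lebesgue (\<lambda>x. (norm (cut {0..} g x))\<^sup>2)"
    using assms by (auto simp: L2_iff L2_line_def)
  have "cmod (L2_inner f g) \<le> (LINT x|lebesgue. cmod (cinner (cut {0..} f x) (cut {0..} g x)))"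
    unfolding L2_inner_line by (rule integral_norm_bound)
  also have "\<dots> \<le> (LINT x|lebesgue. K * (norm (cut {0..} f x))\<^sup>2 + (norm (cut {0..} g x))\<^sup>2 / K)"
  proof (rule integral_mono)
    fix x
    define a where "a = sqrt K * norm (cut {0..} f x)"
    define b where "b = norm (cut {0..} g x) / sqrt K"
    have ab: "a \<ge> 0" "b \<ge> 0" "a * b = norm (cut {0..} f x) * norm (cut {0..} g x)"
      using assms(3) by (auto simp: a_def b_def)
    have "cmod (cinner (cut {0..} f x) (cut {0..} g x)) \<le> a * b"
      unfolding ab by (rule cauchy_schwarz)
    also have "\<dots> \<le> a\<^sup>2 + b\<^sup>2"
      using sum_squares_bound[of a b] mult_nonneg_nonneg[OF ab(1,2)] by linarith
    also have "\<dots> = K * (norm (cut {0..} f x))\<^sup>2 + (norm (cut {0..} g x))\<^sup>2 / K"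
      using assms(3) by (simp add: a_def b_def power_mult_distrib power_divide)
    finally show "cmod (cinner (cut {0..} f x) (cut {0..} g x))
      \<le> K * (norm (cut {0..} f x))\<^sup>2 + (norm (cut {0..} g x))\<^sup>2 / K" .
  qed (use i L2_integrable[OF assms(1,2)] in auto)
  also have "\<dots> = K * L2_sq f + L2_sq g / K" using i by (simp add: L2_sq_def)
  finally show ?thesis .
qed

lemma L2_inner_tendsto:
  fixes u :: "'i \<Rightarrow> real \<Rightarrow> 'k::complex_hilbert"
  assumes u: "\<forall>\<^sub>F n in F. u n \<in> L2" and v: "v \<in> L2" and w: "w \<in> L2"
    and lim: "((\<lambda>n. L2_sq (\<lambda>s. u n s - v s)) \<longlongrightarrow> 0) F"
  shows "((\<lambda>n. L2_inner (u n) w) \<longlongrightarrow> L2_inner v w) F"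
    and "((\<lambda>n. L2_inner w (u n)) \<longlongrightarrow> L2_inner w v) F"
proof -
  have *: "\<forall>\<^sub>F n in F. cmod (L2_inner (\<lambda>s. u n s - v s) w) < e \<and> cmod (L2_inner w (\<lambda>s. u n s - v s)) < e"
    if e: "e > 0" for e
  proof -
    \<comment> \<open>Makes the contribution of \<open>w\<close> less than \<open>e / 2\<close>;
      with the slots interchanged, \<open>inverse K\<close> plays the same role.\<close>
    define K where "K = 2 * (L2_sq w + 1) / e"
    have K: "K > 0" using L2_sq_nonneg[of w] e by (simp add: K_def)
    have wK: "L2_sq w / K < e / 2"
      using L2_sq_nonneg[of w] e by (simp add: K_def field_simps)
    have "\<forall>\<^sub>F n in F. L2_sq (\<lambda>s. u n s - v s) < e / (2 * K)"
      using lim by (rule order_tendstoD) (use e K in simp)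
    with u show ?thesis
    proof eventually_elim
      case (elim n)
      have d: "(\<lambda>s. u n s - v s) \<in> L2" using elim v by (intro L2_diff)
      have "K * L2_sq (\<lambda>s. u n s - v s) < e / 2" using elim(2) K by (simp add: field_simps)
      moreover have "L2_sq (\<lambda>s. u n s - v s) / inverse K = K * L2_sq (\<lambda>s. u n s - v s)"
        using K by (simp add: field_simps)
      moreover have "inverse K * L2_sq w = L2_sq w / K" by (simp add: field_simps)
      moreover have "inverse K > 0" using K by simp
      ultimately show ?case
        using L2_inner_bound[OF d w K] L2_inner_bound[OF w d, of "inverse K"] wK by linarith
    qed
  qed
  show "((\<lambda>n. L2_inner (u n) w) \<longlongrightarrow> L2_inner v w) F"
  proof (rule tendstoI)
    fix e :: real assume "e > 0"
    from *[OF this] u show "\<forall>\<^sub>F n in F. dist (L2_inner (u n) w) (L2_inner v w) < e"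
      by eventually_elim (simp add: L2_inner_diff_left v w dist_norm)
  qed
  show "((\<lambda>n. L2_inner w (u n)) \<longlongrightarrow> L2_inner w v) F"
  proof (rule tendstoI)
    fix e :: real assume "e > 0"
    from *[OF this] u show "\<forall>\<^sub>F n in F. dist (L2_inner w (u n)) (L2_inner w v) < e"
      by eventually_elim (simp add: L2_inner_diff_right v w dist_norm)
  qed
qed

text \<open>Expanding the squared distance between \<open>u n\<close> and \<open>v\<close> expresses
  the quadratic term through terms that are linear in \<open>u n\<close>.\<close>

lemma L2_inner_tendsto_self:
  fixes u :: "'i \<Rightarrow> real \<Rightarrow> 'k::complex_hilbert"
  assumes u: "\<forall>\<^sub>F n in F. u n \<in> L2" and v: "v \<in> L2"
    and lim: "((\<lambda>n. L2_sq (\<lambda>s. u n s - v s)) \<longlongrightarrow> 0) F"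
  shows "((\<lambda>n. L2_inner (u n) (u n)) \<longlongrightarrow> L2_inner v v) F"
proof -
  have "((\<lambda>n. complex_of_real (L2_sq (\<lambda>s. u n s - v s)) + L2_inner (u n) v + L2_inner v (u n) - L2_inner v v)
      \<longlongrightarrow> complex_of_real 0 + L2_inner v v + L2_inner v v - L2_inner v v) F"
    by (intro tendsto_intros L2_inner_tendsto[OF u v v lim] lim)
  moreover have "\<forall>\<^sub>F n in F. complex_of_real (L2_sq (\<lambda>s. u n s - v s)) + L2_inner (u n) v
      + L2_inner v (u n) - L2_inner v v = L2_inner (u n) (u n)"
    using u by eventually_elim
      (simp add: L2_inner_diff_left L2_inner_diff_right L2_diff v flip: L2_inner_self)
  ultimately show ?thesis by (simp add: tendsto_cong)
qed

lemma isCont_L2_translation: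
  assumes "f \<in> L2_line"
  shows "isCont (\<lambda>t. LINT x|lebesgue. (norm (f (t + x) - f x))\<^sup>2) 0"
  using L2_translation_continuous[OF assms] by (simp add: isCont_def)

lemma tendsto_left_shift:
  fixes f :: "real \<Rightarrow> 'k::complex_hilbert"
  assumes f: "f \<in> L2" and s: "s \<ge> 0"
  shows "((\<lambda>t. L2_sq (\<lambda>x. left_shift t f x - left_shift s f x)) \<longlongrightarrow> 0) (at s within {0..})"
proof -
  let ?F = "cut {0..} f"
  let ?G = "\<lambda>t. LINT x|lebesgue. (norm (?F (t + x) - ?F x))\<^sup>2"
  have F: "?F \<in> L2_line" using f by (simp add: L2_iff)
  \<comment> \<open>Only an inequality: restriction to the half line discards whatever has moved to
    negative times.\<close>
  have le: "L2_sq (\<lambda>x. left_shift t f x - left_shift s f x) \<le> ?G (t - s)" if t: "t \<ge> 0" for t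
  proof -
    have "L2_sq (\<lambda>x. left_shift t f x - left_shift s f x)
        \<le> (LINT x|lebesgue. (norm (?F (t + x) - ?F (s + x)))\<^sup>2)"
      unfolding L2_sq_def cut_diff
    proof (rule integral_mono)
      have "(\<lambda>x. left_shift t f x - left_shift s f x) \<in> L2" using f s t by (intro L2_diff L2_left_shift)
      then show "integrable lebesgue (\<lambda>x. (norm (cut {0..} (left_shift t f) x - cut {0..} (left_shift s f) x))\<^sup>2)"
        unfolding L2_iff cut_diff by (simp add: L2_line_def)
      have "(\<lambda>x. ?F (t + x) - ?F (s + x)) \<in> L2_line" by (intro L2_line_diff L2_line_translation F)
      then show "integrable lebesgue (\<lambda>x. (norm (?F (t + x) - ?F (s + x)))\<^sup>2)" by (simp add: L2_line_def)
    qed (use s t in \<open>auto simp: cut_def left_shift_def add.commute\<close>)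
    also have "\<dots> = ?G (t - s)"
      using integral_lebesgue_translation[of "\<lambda>x. (norm (?F (t - s + x) - ?F x))\<^sup>2" s]
      by (simp add: add.assoc[symmetric])
    finally show ?thesis .
  qed
  have "((\<lambda>t. t - s) \<longlongrightarrow> s - s) (at s within {0..})" by (intro tendsto_intros)
  then have "((\<lambda>t. t - s) \<longlongrightarrow> 0) (at s within {0..})" by simp
  from isCont_tendsto_compose[OF isCont_L2_translation[OF F] this]
  have "((\<lambda>t. ?G (t - s)) \<longlongrightarrow> 0) (at s within {0..})" by simp
  then show ?thesis
  proof (rule Lim_null_comparison[rotated])
    have "\<forall>\<^sub>F t in at s within {0..}. t \<in> {0..}" by (simp add: eventually_at_filter)
    then show "\<forall>\<^sub>F t in at s within {0..}. norm (L2_sq (\<lambda>x. left_shift t f x - left_shift s f x)) \<le> ?G (t - s)"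
      by eventually_elim (simp add: L2_sq_nonneg le)
  qed
qed

text \<open>Time 0 suffices, because isometry and the semigroup law reduce increments of the shift
  to increments from 0.\<close>

lemma tendsto_right_shift:
  fixes f :: "real \<Rightarrow> 'k::complex_hilbert"
  assumes f: "f \<in> L2"
  shows "((\<lambda>t. L2_sq (\<lambda>x. right_shift t f x - f x)) \<longlongrightarrow> 0) (at 0 within {0..})"
proof -
  let ?F = "cut {0..} f"
  let ?G = "\<lambda>t. LINT x|lebesgue. (norm (?F (t + x) - ?F x))\<^sup>2"
  have F: "?F \<in> L2_line" using f by (simp add: L2_iff)
  have "((\<lambda>t. - t) \<longlongrightarrow> - 0) (at 0 within {0::real..})" by (intro tendsto_intros)
  then have "((\<lambda>t. - t) \<longlongrightarrow> 0) (at 0 within {0::real..})" by simp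
  from isCont_tendsto_compose[OF isCont_L2_translation[OF F] this]
  have "((\<lambda>t. ?G (- t)) \<longlongrightarrow> 0) (at 0 within {0..})" by simp
  moreover have "\<forall>\<^sub>F t in at 0 within {0..}. ?G (- t) = L2_sq (\<lambda>x. right_shift t f x - f x)"
  proof -
    have "\<forall>\<^sub>F t in at 0 within {0..}. t \<in> {0::real..}" by (simp add: eventually_at_filter)
    then show ?thesis by eventually_elim (simp add: L2_sq_def cut_diff cut_right_shift)
  qed
  ultimately show ?thesis by (rule Lim_transform_eventually)
qed

subsection \<open>Strong limits of bounded nets\<close>

text \<open>The three-epsilon argument, with the bound on the operators required only eventually
  along the net.\<close>

lemma strong_tendsto_closed:
  fixes T :: "'i \<Rightarrow> 'a::complex_hilbert \<Rightarrow> 'b::complex_hilbert"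
  assumes T: "\<forall>\<^sub>F i in F. bounded_clinear_on UNIV (T i) \<and> (\<forall>x. norm (T i x) \<le> K * norm x)"
    and lim: "\<And>n. ((\<lambda>i. T i (f n)) \<longlongrightarrow> y n) F" "f \<longlonglongrightarrow> x" "y \<longlonglongrightarrow> z"
  shows "((\<lambda>i. T i x) \<longlongrightarrow> z) F"
proof (rule tendstoI)
  fix e :: real assume e: "e > 0"
  have "(\<lambda>n. \<bar>K\<bar> * norm (f n - x)) \<longlonglongrightarrow> \<bar>K\<bar> * norm (x - x)" by (intro tendsto_intros lim)
  then have 1: "\<forall>\<^sub>F n in sequentially. \<bar>K\<bar> * norm (f n - x) < e / 3"
    by (rule order_tendstoD) (use e in simp)
  have 2: "\<forall>\<^sub>F n in sequentially. dist (y n) z < e / 3"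
    using lim(3) e by (intro tendstoD) auto
  obtain n where n: "\<bar>K\<bar> * norm (f n - x) < e / 3" "dist (y n) z < e / 3"
    using eventually_happens[OF eventually_conj[OF 1 2]] by auto
  have "\<forall>\<^sub>F i in F. dist (T i (f n)) (y n) < e / 3" using lim(1) e by (intro tendstoD) auto
  with T show "\<forall>\<^sub>F i in F. dist (T i x) z < e"
  proof eventually_elim
    case (elim i)
    have "T i (x - f n) = T i x - T i (f n)"
      using bounded_clinear_onD(4)[of UNIV "T i" x "f n"] elim by (simp add: csubspace_def)
    then have "norm (T i x - T i (f n)) \<le> K * norm (x - f n)" using elim by metis
    also have "\<dots> \<le> \<bar>K\<bar> * norm (f n - x)" by (simp add: norm_minus_commute mult_right_mono)
    finally have "dist (T i x) (T i (f n)) < e / 3" using n by (simp add: dist_norm)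
    then show ?case using elim(2) n(2) dist_triangle[of "T i x" z "T i (f n)"]
      dist_triangle[of "T i (f n)" z "y n"] by linarith
  qed
qed

lemma strong_tendsto_on_total:
  fixes T :: "'i \<Rightarrow> 'a::complex_hilbert \<Rightarrow> 'b::complex_hilbert"
  assumes T: "\<forall>\<^sub>F i in F. bounded_clinear_on UNIV (T i) \<and> (\<forall>x. norm (T i x) \<le> K * norm x)"
    and L: "bounded_clinear_on UNIV L" and tot: "closure (cspan A) = UNIV"
    and lim: "\<And>a. a \<in> A \<Longrightarrow> ((\<lambda>i. T i a) \<longlongrightarrow> L a) F"
  shows "((\<lambda>i. T i x) \<longlongrightarrow> L x) F"
proof -
  have U: "csubspace (UNIV :: 'a set)" by (simp add: csubspace_def)
  note LD = bounded_clinear_onD[OF L U, simplified]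
  have "x \<in> closure (cspan A)" using tot by simp
  then show ?thesis
  proof (induction rule: closure_cspan_induct)
    case zero
    have "\<forall>\<^sub>F i in F. 0 = T i 0"
      using T by eventually_elim (simp add: bounded_clinear_onD(3)[OF _ U])
    from Lim_transform_eventually[OF tendsto_const this] show ?case using LD by simp
  next
    case (add x y)
    have "\<forall>\<^sub>F i in F. T i x + T i y = T i (x + y)"
      using T by eventually_elim (simp add: bounded_clinear_on_def)
    from Lim_transform_eventually[OF tendsto_add[OF add(3,4)] this] show ?case using LD by simp
  next
    case (scale c x)
    have "\<forall>\<^sub>F i in F. c *\<^sub>C T i x = T i (c *\<^sub>C x)"
      using T by eventually_elim (simp add: bounded_clinear_on_def)
    from Lim_transform_eventually[OF tendsto_scaleC[OF scale(2)] this] show ?case using LD by simp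
  next
    case (lim f x)
    show ?case
      by (rule strong_tendsto_closed[OF T lim(4) lim(2)])
        (rule bounded_clinear_on_tendsto[OF L U _ _ lim(2)], auto)
  qed (rule lim)
qed

text \<open>No candidate limit is given. In the limit case the values along an approximating
  sequence form a Cauchy sequence by the uniform bound, and completeness supplies the limit.\<close>

lemma strong_convergent_on_total:
  fixes T :: "'i \<Rightarrow> 'a::complex_hilbert \<Rightarrow> 'b::complex_hilbert"
  assumes F: "F \<noteq> bot"
    and T: "\<forall>\<^sub>F i in F. bounded_clinear_on UNIV (T i) \<and> (\<forall>x. norm (T i x) \<le> K * norm x)"
    and tot: "closure (cspan A) = UNIV"
    and lim: "\<And>a. a \<in> A \<Longrightarrow> \<exists>y. ((\<lambda>i. T i a) \<longlongrightarrow> y) F"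
  shows "\<exists>y. ((\<lambda>i. T i x) \<longlongrightarrow> y) F"
proof -
  have U: "csubspace (UNIV :: 'a set)" by (simp add: csubspace_def)
  have "x \<in> closure (cspan A)" using tot by simp
  then show ?thesis
  proof (induction rule: closure_cspan_induct)
    case zero
    have "\<forall>\<^sub>F i in F. 0 = T i 0"
      using T by eventually_elim (simp add: bounded_clinear_onD(3)[OF _ U])
    from Lim_transform_eventually[OF tendsto_const this] show ?case by blast
  next
    case (add x y)
    then obtain u v where uv: "((\<lambda>i. T i x) \<longlongrightarrow> u) F" "((\<lambda>i. T i y) \<longlongrightarrow> v) F" by blast
    have "\<forall>\<^sub>F i in F. T i x + T i y = T i (x + y)"
      using T by eventually_elim (simp add: bounded_clinear_on_def)
    from Lim_transform_eventually[OF tendsto_add[OF uv] this] show ?case by blast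
  next
    case (scale c x)
    then obtain u where u: "((\<lambda>i. T i x) \<longlongrightarrow> u) F" by blast
    have "\<forall>\<^sub>F i in F. c *\<^sub>C T i x = T i (c *\<^sub>C x)"
      using T by eventually_elim (simp add: bounded_clinear_on_def)
    from Lim_transform_eventually[OF tendsto_scaleC[OF u] this] show ?case by blast
  next
    case (lim f x)
    have "\<forall>n. \<exists>y. ((\<lambda>i. T i (f n)) \<longlongrightarrow> y) F" using lim(4) by blast
    then obtain y where y: "\<And>n. ((\<lambda>i. T i (f n)) \<longlongrightarrow> y n) F" by metis
    have ydiff: "norm (y m - y n) \<le> \<bar>K\<bar> * norm (f m - f n)" for m n
    proof (rule tendsto_upperbound[OF tendsto_norm[OF tendsto_diff[OF y y]] _ F])
      show "\<forall>\<^sub>F i in F. norm (T i (f m) - T i (f n)) \<le> \<bar>K\<bar> * norm (f m - f n)"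
        using T
      proof eventually_elim
        case (elim i)
        have "T i (f m - f n) = T i (f m) - T i (f n)"
          using bounded_clinear_onD(4)[of UNIV "T i" "f m" "f n"] elim U by simp
        then have "norm (T i (f m) - T i (f n)) \<le> K * norm (f m - f n)" using elim by metis
        also have "\<dots> \<le> \<bar>K\<bar> * norm (f m - f n)" by (intro mult_right_mono) auto
        finally show ?case .
      qed
    qed
    have "Cauchy y"
    proof (rule CauchyI)
      fix e :: real assume e: "e > 0"
      obtain M where M: "\<And>m n. m \<ge> M \<Longrightarrow> n \<ge> M \<Longrightarrow> norm (f m - f n) < e / (\<bar>K\<bar> + 1)"
        using CauchyD[OF LIMSEQ_imp_Cauchy[OF lim(2)], of "e / (\<bar>K\<bar> + 1)"] e
        by (auto simp: add_nonneg_pos)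
      have "norm (y m - y n) < e" if "m \<ge> M" "n \<ge> M" for m n
      proof -
        have "norm (y m - y n) \<le> \<bar>K\<bar> * norm (f m - f n)" by (rule ydiff)
        also have "\<dots> \<le> (\<bar>K\<bar> + 1) * norm (f m - f n)" by (intro mult_right_mono) auto
        also have "\<dots> < e" using M[OF that] by (simp add: field_simps add_nonneg_pos)
        finally show ?thesis .
      qed
      then show "\<exists>M. \<forall>m\<ge>M. \<forall>n\<ge>M. norm (y m - y n) < e" by blast
    qed
    then obtain z where "y \<longlonglongrightarrow> z" using Cauchy_convergent convergent_def by blast
    with strong_tendsto_closed[OF T y lim(2)] show ?case by blast
  qed (rule lim)
qed

text \<open>Conjugation moves the net into the first slot, where it becomes a bounded family of
  linear functionals and the strong version applies.\<close>

lemma weak_tendsto_on_total: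
  fixes u :: "'i \<Rightarrow> 'a::complex_hilbert"
  assumes tot: "closure (cspan A) = UNIV" and bound: "\<forall>\<^sub>F i in F. norm (u i) \<le> K"
    and lim: "\<And>a. a \<in> A \<Longrightarrow> ((\<lambda>i. cinner a (u i)) \<longlongrightarrow> cinner a v) F"
  shows "((\<lambda>i. cinner z (u i)) \<longlongrightarrow> cinner z v) F"
proof -
  have lin: "bounded_clinear_on UNIV (cinner w)" for w :: 'a
    unfolding bounded_clinear_on_def
    using cauchy_schwarz[of w] by (auto simp: cinner_simps scaleC_complex_def)
  have "((\<lambda>i. cinner (u i) z) \<longlongrightarrow> cinner v z) F"
  proof (rule strong_tendsto_on_total[OF _ lin tot])
    show "\<forall>\<^sub>F i in F. bounded_clinear_on UNIV (cinner (u i)) \<and> (\<forall>x. norm (cinner (u i) x) \<le> K * norm x)"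
      using bound
    proof eventually_elim
      case (elim i)
      have "norm (cinner (u i) x) \<le> K * norm x" for x
        using cauchy_schwarz[of "u i" x] mult_right_mono[OF elim, of "norm x"] by simp
      then show ?case using lin by blast
    qed
    fix a assume "a \<in> A"
    from tendsto_cnj[OF lim[OF this]] show "((\<lambda>i. cinner (u i) a) \<longlongrightarrow> cinner v a) F"
      by (simp flip: cinner_commute)
  qed
  from tendsto_cnj[OF this] show ?thesis by (simp flip: cinner_commute)
qed

subsection \<open>Fock space\<close>

lemma cut_splice:
  "cut {0..<t} (splice_at t f g) = cut {0..<t} f" "cut {t..} (splice_at t f g) = cut {t..} g"
  by (auto simp: cut_def splice_at_def)

locale fock =
  fixes \<epsilon> :: "(real \<Rightarrow> 'k::complex_hilbert) \<Rightarrow> 'f::complex_hilbert"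
  assumes fock: "fock_space \<epsilon>"
begin

abbreviation "past t \<equiv> fock_sub \<epsilon> {0..<t}"
abbreviation "future t \<equiv> fock_sub \<epsilon> {t..}"
abbreviation "ten t \<equiv> fock_tensor \<epsilon> t"
abbreviation "vac \<equiv> \<epsilon> (\<lambda>_. 0)"
abbreviation "shift t \<equiv> shift_op \<epsilon> (ennreal t)"
abbreviation "flow t \<equiv> ccr_flow \<epsilon> (ennreal t)"

lemma eps_inner: "f \<in> L2 \<Longrightarrow> g \<in> L2 \<Longrightarrow> cinner (\<epsilon> f) (\<epsilon> g) = exp (L2_inner f g)"
  using fock by (simp add: fock_space_def)

lemma eps_total: "closure (cspan (\<epsilon> ` L2)) = UNIV"
  using fock by (simp add: fock_space_def)

text \<open>Functions that differ at negative times are distinct elements of \<open>L2\<close>, and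
  splicing and cutting do produce such pairs; inner products do not see the difference.\<close>

lemma eps_cong:
  assumes "f \<in> L2" "g \<in> L2" "\<And>s. s \<ge> 0 \<Longrightarrow> f s = g s" shows "\<epsilon> f = \<epsilon> g"
proof -
  have c: "cut {0..} f = cut {0..} g" using assms(3) by (auto simp: cut_def)
  have "L2_inner f f = L2_inner g g" "L2_inner f g = L2_inner g g" "L2_inner g f = L2_inner g g"
    by (rule L2_inner_cong; simp add: c)+
  then have "cinner (\<epsilon> f - \<epsilon> g) (\<epsilon> f - \<epsilon> g) = 0"
    using assms by (simp add: cinner_simps eps_inner)
  then show ?thesis by (simp add: cinner_eq_zero_iff)
qed

lemma eps_nonzero: "f \<in> L2 \<Longrightarrow> norm (\<epsilon> f) > 0"
  using eps_inner[of f f] cinner_zero_left[of "\<epsilon> f"] by (metis exp_not_eq_zero zero_less_norm_iff)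

lemma norm_vac: "norm vac = 1"
proof -
  have "L2_inner (\<lambda>_. 0) (\<lambda>_. 0 :: 'k) = 0" by (simp add: L2_inner_def)
  then have "cinner vac vac = 1" by (simp add: eps_inner L2_zero)
  then have "(norm vac)\<^sup>2 = 1" by (simp add: norm_sq_cinner)
  then show ?thesis using norm_ge_zero[of vac] by (auto simp: power2_eq_1_iff)
qed

lemma L2_cut_Ico: "f \<in> L2 \<Longrightarrow> cut {0..<t} f \<in> L2" and L2_cut_Ici: "f \<in> L2 \<Longrightarrow> cut {t..} f \<in> L2"
  by (rule L2_cut; simp)+

lemma eps_past: "f \<in> L2 \<Longrightarrow> \<epsilon> (cut {0..<t} f) \<in> past t"
  and eps_future: "f \<in> L2 \<Longrightarrow> \<epsilon> (cut {t..} f) \<in> future t"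
  unfolding fock_sub_def by (rule subsetD[OF closure_subset], rule cspan_base, blast)+

lemma vac_past: "vac \<in> past t" and vac_future: "vac \<in> future t"
proof -
  have "cut A (\<lambda>_. 0 :: 'k) = (\<lambda>_. 0)" for A by (simp add: cut_def)
  then show "vac \<in> past t" "vac \<in> future t"
    using eps_past[OF L2_zero, of t] eps_future[OF L2_zero, of t] by simp_all
qed

lemma csubspace_fock_sub: "csubspace (fock_sub \<epsilon> A)"
  unfolding fock_sub_def by (intro csubspace_closure csubspace_cspan)

lemma fock_sub_eqI:
  assumes "bounded_clinear_on (fock_sub \<epsilon> A) M" "bounded_clinear_on (fock_sub \<epsilon> A) M'"
    "\<And>f. f \<in> L2 \<Longrightarrow> M (\<epsilon> (cut A f)) = M' (\<epsilon> (cut A f))" "x \<in> fock_sub \<epsilon> A"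
  shows "M x = M' x"
  by (rule bounded_clinear_on_eqI[OF assms(1,2)[unfolded fock_sub_def] _ assms(4)[unfolded fock_sub_def]])
    (use assms(3) in auto)

lemma fock_sub_range:
  assumes M: "bounded_clinear_on (fock_sub \<epsilon> A) M" and V: "csubspace V" "closed V"
    and gen: "\<And>f. f \<in> L2 \<Longrightarrow> M (\<epsilon> (cut A f)) \<in> V" and x: "x \<in> fock_sub \<epsilon> A"
  shows "M x \<in> V"
proof -
  note D = bounded_clinear_onD[OF M csubspace_fock_sub]
  show ?thesis using x[unfolded fock_sub_def]
  proof (induction rule: closure_cspan_induct)
    case (lim f x)
    have "(\<lambda>n. M (f n)) \<longlonglongrightarrow> M x"
      by (rule bounded_clinear_on_tendsto[OF M csubspace_fock_sub])
        (use lim(1,2,3) in \<open>auto simp: fock_sub_def\<close>)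
    from closed_sequentially[OF V(2) lim(4) this] show ?case .
  qed (use gen D csubspaceD[OF V(1)] in \<open>auto simp: fock_sub_def\<close>)
qed

lemma closed_fock_sub: "closed (fock_sub \<epsilon> A)"
  by (simp add: fock_sub_def)

lemma ops_eqI:
  assumes "T \<in> bounded_ops" "T' \<in> bounded_ops" "\<And>f. f \<in> L2 \<Longrightarrow> T (\<epsilon> f) = T' (\<epsilon> f)"
  shows "T = T'"
  using bounded_ops_eq_on_total[OF assms(1,2) eps_total] assms(3) by blast

text \<open>The exponential turns \<open>L2_inner_split\<close> into a product, so spliced
  exponential vectors form a tensor product of past and future. The witness supplies both
  conclusions at once.\<close>

lemma ten_pair_and_eps:
  "tensor_pair (past t) (future t) (ten t) \<and>
    (\<forall>f\<in>L2. \<forall>g\<in>L2. ten t (\<epsilon> (cut {0..<t} f)) (\<epsilon> (cut {t..} g)) = \<epsilon> (splice_at t f g))"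
proof -
  have iso: "cinner (\<epsilon> (splice_at t f g)) (\<epsilon> (splice_at t f' g')) =
      cinner (\<epsilon> (cut {0..<t} f)) (\<epsilon> (cut {0..<t} f')) * cinner (\<epsilon> (cut {t..} g)) (\<epsilon> (cut {t..} g'))"
    if "f \<in> L2" "g \<in> L2" "f' \<in> L2" "g' \<in> L2" for f g f' g'
    using that L2_inner_split[of "splice_at t f g" "splice_at t f' g'" t]
    by (simp add: eps_inner L2_splice L2_cut_Ico L2_cut_Ici cut_splice exp_add)
  have tot: "closure (cspan {\<epsilon> (splice_at t f g) | f g. f \<in> L2 \<and> g \<in> L2}) = UNIV"
  proof -
    have "\<epsilon> ` L2 \<subseteq> {\<epsilon> (splice_at t f g) | f g. f \<in> L2 \<and> g \<in> L2}"
    proof clarify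
      fix f :: "real \<Rightarrow> 'k" assume "f \<in> L2"
      moreover have "splice_at t f f = f" by (auto simp: splice_at_def)
      ultimately show "\<exists>g h. \<epsilon> f = \<epsilon> (splice_at t g h) \<and> g \<in> L2 \<and> h \<in> L2" by metis
    qed
    also have "\<dots> \<subseteq> closure (cspan {\<epsilon> (splice_at t f g) | f g. f \<in> L2 \<and> g \<in> L2})"
      by (intro subsetI subsetD[OF closure_subset]) (rule cspan_base)
    finally have "closure (cspan (\<epsilon> ` L2)) \<subseteq> closure (cspan {\<epsilon> (splice_at t f g) | f g. f \<in> L2 \<and> g \<in> L2})"
      by (rule closure_cspan_minimal) (auto intro: csubspace_closure csubspace_cspan)
    then show ?thesis using eps_total by blast
  qed
  obtain \<tau> where \<tau>: "tensor_pair (past t) (future t) \<tau>"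
    "\<forall>f\<in>L2. \<forall>g\<in>L2. \<tau> (\<epsilon> (cut {0..<t} f)) (\<epsilon> (cut {t..} g)) = \<epsilon> (splice_at t f g)"
    using tensor_pair_exists[where I = L2 and J = L2 and k = "\<lambda>f g. \<epsilon> (splice_at t f g)"
        and g = "\<lambda>f. \<epsilon> (cut {0..<t} f)" and h = "\<lambda>f. \<epsilon> (cut {t..} f)", OF iso tot]
    unfolding fock_sub_def by blast
  interpret tensor_pair "past t" "future t" \<tau> by fact
  \<comment> \<open>The definite description is met because inner products with exponential vectors
    determine a vector.\<close>
  have eq: "ten t x y = \<tau> x y" if xy: "x \<in> past t" "y \<in> future t" for x y
    unfolding fock_tensor_def
  proof (rule the_equality)
    have *: "cinner (\<epsilon> f) (\<tau> x y) = cinner (\<epsilon> (cut {0..<t} f)) x * cinner (\<epsilon> (cut {t..} f)) y"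
      if f: "f \<in> L2" for f
    proof -
      have "splice_at t f f = f" by (auto simp: splice_at_def)
      then have "\<epsilon> f = \<tau> (\<epsilon> (cut {0..<t} f)) (\<epsilon> (cut {t..} f))" using \<tau>(2) f by simp
      then show ?thesis using inner[OF eps_past[OF f] eps_future[OF f] xy] by simp
    qed
    then show "\<forall>f\<in>L2. cinner (\<epsilon> f) (\<tau> x y) =
      cinner (\<epsilon> (cut {0..<t} f)) x * cinner (\<epsilon> (cut {t..} f)) y" by blast
    fix z assume z: "\<forall>f\<in>L2. cinner (\<epsilon> f) z = cinner (\<epsilon> (cut {0..<t} f)) x * cinner (\<epsilon> (cut {t..} f)) y"
    show "z = \<tau> x y"
      by (rule vector_eq_on_total[OF eps_total]) (use z * in auto)
  qed
  then have "tensor_pair (past t) (future t) (ten t)" by (rule tensor_pair_cong[OF \<tau>(1)])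
  then show ?thesis using eq \<tau>(2) eps_past eps_future by simp
qed

lemma ten_pair: "tensor_pair (past t) (future t) (ten t)"
  and ten_eps: "f \<in> L2 \<Longrightarrow> g \<in> L2 \<Longrightarrow>
    ten t (\<epsilon> (cut {0..<t} f)) (\<epsilon> (cut {t..} g)) = \<epsilon> (splice_at t f g)"
  using ten_pair_and_eps by blast+

lemmas ten_left_linear = tensor_pair.left_linear[OF ten_pair]
  and ten_right_linear = tensor_pair.right_linear[OF ten_pair]
  and ten_inner = tensor_pair.inner[OF ten_pair]
  and norm_ten = tensor_pair.norm_tensor[OF ten_pair]

lemma eps_ten: "f \<in> L2 \<Longrightarrow> \<epsilon> f = ten t (\<epsilon> (cut {0..<t} f)) (\<epsilon> (cut {t..} f))"
proof -
  have "splice_at t f f = f" by (auto simp: splice_at_def)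
  then show "f \<in> L2 \<Longrightarrow> ?thesis" by (simp add: ten_eps)
qed

lemma bounded_clinear_on_ident: "bounded_clinear_on V (\<lambda>x. x)"
  by (auto simp: bounded_clinear_on_def intro: exI[of _ 1])

text \<open>The vacuum is the unit for the splitting, so an operator on the past factor can be
  evaluated directly on vectors of the Fock space.\<close>

lemma ten_vac_right: "v \<in> past t \<Longrightarrow> ten t v vac = v"
proof (rule fock_sub_eqI[OF ten_left_linear[OF vac_future] bounded_clinear_on_ident])
  fix f :: "real \<Rightarrow> 'k" assume f: "f \<in> L2"
  have "cut {t..} (\<lambda>_. 0 :: 'k) = (\<lambda>_. 0)" by (simp add: cut_def)
  then have "ten t (\<epsilon> (cut {0..<t} f)) vac = \<epsilon> (splice_at t f (\<lambda>_. 0))"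
    using ten_eps[OF f L2_zero, of t] by simp
  also have "\<dots> = \<epsilon> (cut {0..<t} f)"
    by (intro eps_cong L2_splice L2_cut_Ico f L2_zero) (auto simp: splice_at_def cut_def)
  finally show "ten t (\<epsilon> (cut {0..<t} f)) vac = \<epsilon> (cut {0..<t} f)" .
qed

lemma ten_vac_left: "t \<ge> 0 \<Longrightarrow> w \<in> future t \<Longrightarrow> ten t vac w = w"
proof (rule fock_sub_eqI[OF ten_right_linear[OF vac_past] bounded_clinear_on_ident])
  fix f :: "real \<Rightarrow> 'k" assume f: "f \<in> L2"
  have "cut {0..<t} (\<lambda>_. 0 :: 'k) = (\<lambda>_. 0)" by (simp add: cut_def)
  then have "ten t vac (\<epsilon> (cut {t..} f)) = \<epsilon> (splice_at t (\<lambda>_. 0) f)"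
    using ten_eps[OF L2_zero f, of t] by simp
  also have "\<dots> = \<epsilon> (cut {t..} f)"
    by (intro eps_cong L2_splice L2_cut_Ici f L2_zero) (auto simp: splice_at_def cut_def)
  finally show "ten t vac (\<epsilon> (cut {t..} f)) = \<epsilon> (cut {t..} f)" .
qed

subsection \<open>Shifts and flow\<close>

lemma shift_exists:
  assumes "t \<ge> 0"
  shows "\<exists>T\<in>bounded_ops. \<forall>f\<in>L2. T (\<epsilon> f) = \<epsilon> (right_shift t f)"
proof -
  have "\<exists>T. (\<forall>f\<in>L2. T (\<epsilon> f) = \<epsilon> (right_shift t f)) \<and> bounded_clinear_on (closure (cspan (\<epsilon> ` L2))) T"
    by (rule isometric_extension[where r = 1])
      (use assms in \<open>auto simp: eps_inner L2_right_shift L2_inner_right_shift\<close>)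
  then show ?thesis by (auto simp: eps_total bounded_clinear_on_UNIV)
qed

lemma shift_ops: "t \<ge> 0 \<Longrightarrow> shift t \<in> bounded_ops"
  and shift_eps: "t \<ge> 0 \<Longrightarrow> f \<in> L2 \<Longrightarrow> shift t (\<epsilon> f) = \<epsilon> (right_shift t f)"
proof -
  assume t: "t \<ge> 0"
  then obtain T where T: "T \<in> bounded_ops" "\<forall>f\<in>L2. T (\<epsilon> f) = \<epsilon> (right_shift t f)"
    using shift_exists by blast
  have "shift t = T"
    unfolding shift_op_def using t
  proof (simp, intro the_equality)
    show "T' = T" if "T' \<in> bounded_ops \<and> (\<forall>f\<in>L2. T' (\<epsilon> f) = \<epsilon> (right_shift t f))" for T'
      by (rule ops_eqI) (use that T in auto)
  qed (use T in auto)
  then show "shift t \<in> bounded_ops" "f \<in> L2 \<Longrightarrow> shift t (\<epsilon> f) = \<epsilon> (right_shift t f)"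
    using T by auto
qed

lemma shift_inner: "t \<ge> 0 \<Longrightarrow> cinner (shift t x) (shift t y) = cinner x y"
  using cinner_eq_on_total[of \<epsilon> L2 "shift t" "shift t" 1 x y]
  by (simp add: eps_total bounded_clinear_on_UNIV shift_ops shift_eps eps_inner L2_right_shift
      L2_inner_right_shift)

lemma norm_shift: "t \<ge> 0 \<Longrightarrow> norm (shift t x) = norm x"
  using shift_inner[of t x x] norm_sq_cinner[of "shift t x"] norm_sq_cinner[of x]
  by (metis norm_ge_zero power2_eq_imp_eq)

lemma shift_future: "t \<ge> 0 \<Longrightarrow> shift t x \<in> future t"
proof -
  assume t: "t \<ge> 0"
  have "x \<in> closure (cspan (\<epsilon> ` L2))" using eps_total by simp
  then show ?thesis
  proof (induction rule: closure_cspan_induct)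
    case (base a)
    then obtain f where f: "f \<in> L2" "a = \<epsilon> f" by blast
    have "\<epsilon> (cut {t..} (right_shift t f)) \<in> future t"
      using t f by (intro eps_future L2_right_shift)
    then show ?case using f t by (simp add: cut_right_shift_tail shift_eps)
  next
    case (lim f x)
    have "(\<lambda>n. shift t (f n)) \<longlonglongrightarrow> shift t x"
      by (rule bounded_ops_tendsto[OF shift_ops[OF t] lim(2)])
    from closed_sequentially[OF closed_fock_sub lim(4) this] show ?case .
  qed (auto simp: bounded_ops_zero bounded_ops_add bounded_ops_scaleC shift_ops t
      csubspaceD[OF csubspace_fock_sub])
qed

lemma adj_shift_shift: "t \<ge> 0 \<Longrightarrow> adj (shift t) (shift t x) = x"
  by (rule cinner_ext) (simp add: adj_cinner' shift_ops shift_inner)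

text \<open>Generators of the future are shifted exponential vectors, so the shift is onto the
  future and its adjoint inverts it there.\<close>

lemma shift_adj_shift: "t \<ge> 0 \<Longrightarrow> w \<in> future t \<Longrightarrow> shift t (adj (shift t) w) = w"
proof (rule fock_sub_eqI[where M = "\<lambda>w. shift t (adj (shift t) w)" and M' = "\<lambda>w. w"])
  assume t: "t \<ge> 0"
  show "bounded_clinear_on (future t) (\<lambda>w. shift t (adj (shift t) w))"
    using bounded_ops_comp[OF shift_ops[OF t] adj_bounded[OF shift_ops[OF t]]]
    by (intro bounded_ops_imp_bounded_clinear_on) (simp add: o_def)
  fix f :: "real \<Rightarrow> 'k" assume f: "f \<in> L2"
  have "\<epsilon> (cut {t..} f) = shift t (\<epsilon> (left_shift t f))"
    using t f by (simp add: cut_tail_eq_right_shift shift_eps L2_left_shift)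
  then show "shift t (adj (shift t) (\<epsilon> (cut {t..} f))) = \<epsilon> (cut {t..} f)"
    using t by (simp add: adj_shift_shift)
qed (rule bounded_clinear_on_ident)

lemma shift_add: "s \<ge> 0 \<Longrightarrow> t \<ge> 0 \<Longrightarrow> shift (s + t) x = shift s (shift t x)"
proof -
  assume st: "s \<ge> 0" "t \<ge> 0"
  have "shift (s + t) = shift s \<circ> shift t"
  proof (rule ops_eqI)
    fix f :: "real \<Rightarrow> 'k" assume f: "f \<in> L2"
    have "right_shift (s + t) f = right_shift s (right_shift t f)"
      using st by (auto simp: right_shift_def fun_eq_iff algebra_simps)
    then show "shift (s + t) (\<epsilon> f) = (shift s \<circ> shift t) (\<epsilon> f)"
      using st f by (simp add: shift_eps L2_right_shift del: ennreal_plus)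
  qed (use st in \<open>auto intro!: shift_ops bounded_ops_comp simp del: ennreal_plus\<close>)
  then show ?thesis by (metis comp_apply)
qed

lemma shift_eq_ten: "t \<ge> 0 \<Longrightarrow> shift t x = ten t vac (shift t x)"
  by (simp add: ten_vac_left shift_future)

text \<open>The normal form for computing with the flow at \<open>t\<close>: the past factor stays
  put and \<open>X\<close> acts under the shift.\<close>

lemma eps_ten_shift: "t \<ge> 0 \<Longrightarrow> f \<in> L2 \<Longrightarrow>
    \<epsilon> f = ten t (\<epsilon> (cut {0..<t} f)) (shift t (\<epsilon> (left_shift t f)))"
  using eps_ten[of f t] by (simp add: shift_eps L2_left_shift cut_tail_eq_right_shift)

lemma ten_shift_linear: "t \<ge> 0 \<Longrightarrow> v \<in> past t \<Longrightarrow> bounded_clinear_on UNIV (\<lambda>x. ten t v (shift t x))"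
  by (rule bounded_clinear_on_compose[OF _ _ ten_right_linear])
    (auto simp: bounded_clinear_on_UNIV shift_ops shift_future)

lemma ops_eq_on_ten_shift:
  assumes t: "t \<ge> 0" and T: "T \<in> bounded_ops" "T' \<in> bounded_ops"
    and eq: "\<And>v x. v \<in> past t \<Longrightarrow> T (ten t v (shift t x)) = T' (ten t v (shift t x))"
  shows "T = T'"
  by (rule ops_eqI[OF T]) (use eps_ten_shift[OF t] eq eps_past in metis)

text \<open>Stated with all three conclusions because the witness for the definite description, an
  ampliation from the future factor, comes with its formula and its norm bound.\<close>

lemma flow_exists:
  assumes t: "t \<ge> 0" and X: "X \<in> bounded_ops" and K: "K \<ge> 0" "\<And>x. norm (X x) \<le> K * norm x"
  shows "flow t X \<in> bounded_ops \<and> (\<forall>v\<in>past t. \<forall>x. flow t X (ten t v (shift t x)) = ten t v (shift t (X x)))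
    \<and> (\<forall>z. norm (flow t X z) \<le> K * norm z)"
proof -
  let ?B = "shift t \<circ> X \<circ> adj (shift t)"
  have B: "?B \<in> bounded_ops" using t X by (intro bounded_ops_comp shift_ops adj_bounded)
  have "?B \<in> bounded_ops_on (future t)"
    using bounded_ops_imp_bounded_clinear_on[OF B] shift_future[OF t] by (auto simp: bounded_ops_on_iff)
  moreover have "norm (?B w) \<le> K * norm w" if "w \<in> future t" for w
  proof -
    have "norm (?B w) \<le> K * norm (adj (shift t) w)" using t K by (simp add: norm_shift)
    \<comment> \<open>The adjoint preserves norms on the future because the shift undoes it
      there.\<close>
    also have "norm (adj (shift t) w) = norm w"
      using norm_shift[OF t, of "adj (shift t) w"] shift_adj_shift[OF t that] by simp
    finally show ?thesis .
  qed
  ultimately obtain T where T: "T \<in> bounded_ops"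
    "\<forall>v\<in>past t. \<forall>w\<in>future t. T (ten t v w) = ten t v (?B w)" "\<forall>z. norm (T z) \<le> K * norm z"
    using tensor_pair.right_ampliation[OF ten_pair _ K(1)] by blast
  have "flow t X = tensor_op \<epsilon> t id ?B" using t by (simp add: ccr_flow_def)
  also have "\<dots> = T" unfolding tensor_op_def
  proof (rule the_equality)
    show "T \<in> bounded_ops \<and> (\<forall>x\<in>past t. \<forall>y\<in>future t. T (ten t x y) = ten t (id x) (?B y))"
      using T by simp
    show "T' = T" if "T' \<in> bounded_ops \<and> (\<forall>x\<in>past t. \<forall>y\<in>future t. T' (ten t x y) = ten t (id x) (?B y))" for T'
      by (rule tensor_pair.ops_eqI[OF ten_pair]) (use that T in auto)
  qed
  finally have "flow t X = T" .
  then show ?thesis using T t by (simp add: shift_future adj_shift_shift)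
qed

lemma flow_ops: "t \<ge> 0 \<Longrightarrow> X \<in> bounded_ops \<Longrightarrow> flow t X \<in> bounded_ops"
  and flow_ten: "t \<ge> 0 \<Longrightarrow> X \<in> bounded_ops \<Longrightarrow> v \<in> past t \<Longrightarrow>
    flow t X (ten t v (shift t x)) = ten t v (shift t (X x))"
proof -
  assume t: "t \<ge> 0" and X: "X \<in> bounded_ops"
  obtain K where "K > 0" "\<And>x. norm (X x) \<le> K * norm x" using bounded_ops_bound[OF X] by metis
  then show "flow t X \<in> bounded_ops"
    "v \<in> past t \<Longrightarrow> flow t X (ten t v (shift t x)) = ten t v (shift t (X x))"
    using flow_exists[OF t X, of K] by auto
qed

lemma flow_norm: "t \<ge> 0 \<Longrightarrow> X \<in> bounded_ops \<Longrightarrow> K \<ge> 0 \<Longrightarrow> (\<And>x. norm (X x) \<le> K * norm x) \<Longrightarrow>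
    norm (flow t X z) \<le> K * norm z"
  using flow_exists by blast

text \<open>Vectors \<open>ten t v (shift t x)\<close> include all exponential vectors; algebraic
  laws of the flow are checked on them alone.\<close>

lemma flow_eqI:
  assumes "t \<ge> 0" "X \<in> bounded_ops" "T \<in> bounded_ops"
    "\<And>v x. v \<in> past t \<Longrightarrow> T (ten t v (shift t x)) = ten t v (shift t (X x))"
  shows "flow t X = T"
  by (rule ops_eq_on_ten_shift[OF assms(1)]) (use assms in \<open>auto simp: flow_ops flow_ten\<close>)

lemma flow_id: "t \<ge> 0 \<Longrightarrow> flow t id = id"
  by (rule flow_eqI) (auto simp: bounded_ops_id)

lemma flow_comp:
  "t \<ge> 0 \<Longrightarrow> X \<in> bounded_ops \<Longrightarrow> Y \<in> bounded_ops \<Longrightarrow> flow t (X \<circ> Y) = flow t X \<circ> flow t Y"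
  by (rule flow_eqI) (auto simp: bounded_ops_comp flow_ops flow_ten)

lemma flow_add:
  assumes "t \<ge> 0" "X \<in> bounded_ops" "Y \<in> bounded_ops"
  shows "flow t (\<lambda>x. X x + Y x) = (\<lambda>x. flow t X x + flow t Y x)"
proof (rule flow_eqI)
  fix v x assume v: "v \<in> past t"
  note D = bounded_clinear_onD[OF ten_shift_linear[OF assms(1) v]]
  show "flow t X (ten t v (shift t x)) + flow t Y (ten t v (shift t x)) = ten t v (shift t (X x + Y x))"
    using assms v D(1)[of "X x" "Y x"] by (simp add: flow_ten csubspace_def)
qed (use assms in \<open>auto intro!: bounded_ops_plus flow_ops\<close>)

lemma flow_scale:
  assumes "t \<ge> 0" "X \<in> bounded_ops"
  shows "flow t (\<lambda>x. c *\<^sub>C X x) = (\<lambda>x. c *\<^sub>C flow t X x)"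
proof (rule flow_eqI)
  fix v x assume v: "v \<in> past t"
  note D = bounded_clinear_onD[OF ten_shift_linear[OF assms(1) v]]
  show "c *\<^sub>C flow t X (ten t v (shift t x)) = ten t v (shift t (c *\<^sub>C X x))"
    using assms v D(2)[of "X x" c] by (simp add: flow_ten csubspace_def)
qed (use assms in \<open>auto intro!: bounded_ops_scale flow_ops\<close>)

lemma flow_adj:
  assumes t: "t \<ge> 0" and X: "X \<in> bounded_ops"
  shows "flow t (adj X) = adj (flow t X)"
proof (rule flow_eqI[OF t adj_bounded[OF X] adj_bounded[OF flow_ops[OF t X]]])
  fix v x assume v: "v \<in> past t"
  show "adj (flow t X) (ten t v (shift t x)) = ten t v (shift t (adj X x))"
  proof (rule vector_eq_on_total[OF eps_total])
    fix a assume "a \<in> \<epsilon> ` L2"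
    then obtain w y where a: "w \<in> past t" "a = ten t w (shift t y)"
      using eps_ten_shift[OF t] eps_past by blast
    have "cinner a (adj (flow t X) (ten t v (shift t x))) = cinner (flow t X a) (ten t v (shift t x))"
      by (rule adj_cinner'[OF flow_ops[OF t X]])
    also have "\<dots> = cinner w v * cinner (X y) x"
      using t X v a by (simp add: flow_ten ten_inner shift_future shift_inner)
    also have "\<dots> = cinner a (ten t v (shift t (adj X x)))"
      using t X v a by (simp add: ten_inner shift_future shift_inner adj_cinner')
    finally show "cinner a (adj (flow t X) (ten t v (shift t x))) = cinner a (ten t v (shift t (adj X x)))" .
  qed
qed

lemma flow_shift: "t \<ge> 0 \<Longrightarrow> X \<in> bounded_ops \<Longrightarrow> flow t X (shift t x) = shift t (X x)"
  using flow_ten[of t X vac x] by (simp add: vac_past flip: shift_eq_ten)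

text \<open>The splitting at \<open>s + t\<close> has to be rewritten as one at \<open>s\<close>
  whose future is split again at \<open>t\<close> of its own time.\<close>

lemma flow_semigroup:
  assumes s: "s \<ge> 0" and t: "t \<ge> 0" and X: "X \<in> bounded_ops"
  shows "flow (s + t) X = flow s (flow t X)"
proof (rule flow_eqI)
  have st: "s + t \<ge> 0" using s t by simp
  show "flow s (flow t X) \<in> bounded_ops" using s t X by (intro flow_ops)
  fix v x assume v: "v \<in> past (s + t)"
  define \<phi> where "\<phi> = flow s (flow t X)"
  have \<phi>: "\<phi> \<in> bounded_ops" unfolding \<phi>_def using s t X by (intro flow_ops)
  \<comment> \<open>Associativity of the two splittings: for exponential \<open>y\<close> both sides
    are exponential vectors of the same spliced function.\<close>
  have assoc: "ten s (\<epsilon> (cut {0..<s} f)) (shift s (ten t (\<epsilon> (cut {0..<t} (left_shift s f))) (shift t y)))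
      = ten (s + t) (\<epsilon> (cut {0..<s + t} f)) (shift (s + t) y)" if f: "f \<in> L2" for f y
  proof (rule fun_cong[where x = y], rule ops_eqI)
    have ls: "left_shift s f \<in> L2" by (rule L2_left_shift[OF s f])
    show "(\<lambda>y. ten (s + t) (\<epsilon> (cut {0..<s + t} f)) (shift (s + t) y)) \<in> bounded_ops"
      unfolding bounded_clinear_on_UNIV[symmetric] by (intro ten_shift_linear st eps_past f)
    show "(\<lambda>y. ten s (\<epsilon> (cut {0..<s} f)) (shift s (ten t (\<epsilon> (cut {0..<t} (left_shift s f))) (shift t y))))
        \<in> bounded_ops"
      unfolding bounded_clinear_on_UNIV[symmetric]
      by (rule bounded_clinear_on_compose[OF ten_shift_linear[OF t eps_past[OF ls]] UNIV_I
            ten_shift_linear[OF s eps_past[OF f]]])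
    fix h :: "real \<Rightarrow> 'k" assume h: "h \<in> L2"
    define a where "a = \<epsilon> h"
    have ten_sh: "ten r (\<epsilon> (cut {0..<r} g)) (shift r (\<epsilon> h)) = \<epsilon> (splice_at r g (right_shift r h))"
      if "r \<ge> 0" "g \<in> L2" "h \<in> L2" for r g h
      using that ten_eps[OF that(2) L2_right_shift[OF that(1,3)], of r]
      by (simp add: shift_eps cut_right_shift_tail)
    have "ten s (\<epsilon> (cut {0..<s} f)) (shift s (ten t (\<epsilon> (cut {0..<t} (left_shift s f))) (shift t a)))
      = \<epsilon> (splice_at s f (right_shift s (splice_at t (left_shift s f) (right_shift t h))))"
      using s t f h ls by (simp add: ten_sh L2_splice L2_right_shift a_def)
    also have "splice_at s f (right_shift s (splice_at t (left_shift s f) (right_shift t h)))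
        = splice_at (s + t) f (right_shift (s + t) h)"
      using s t by (auto simp: splice_at_def right_shift_def left_shift_def fun_eq_iff algebra_simps)
    also have "\<epsilon> \<dots> = ten (s + t) (\<epsilon> (cut {0..<s + t} f)) (shift (s + t) a)"
      using st f h by (simp add: ten_sh a_def del: ennreal_plus)
    finally show "ten s (\<epsilon> (cut {0..<s} f)) (shift s (ten t (\<epsilon> (cut {0..<t} (left_shift s f))) (shift t (\<epsilon> h))))
      = ten (s + t) (\<epsilon> (cut {0..<s + t} f)) (shift (s + t) (\<epsilon> h))" by (simp only: a_def)
  qed
  show "flow s (flow t X) (ten (s + t) v (shift (s + t) x)) = ten (s + t) v (shift (s + t) (X x))"
    unfolding \<phi>_def[symmetric]
  proof (rule fock_sub_eqI[where M = "\<lambda>v. \<phi> (ten (s + t) v (shift (s + t) x))"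
        and M' = "\<lambda>v. ten (s + t) v (shift (s + t) (X x))", OF _ _ _ v])
    show "bounded_clinear_on (past (s + t)) (\<lambda>v. \<phi> (ten (s + t) v (shift (s + t) x)))"
      by (rule bounded_clinear_on_compose[OF ten_left_linear[OF shift_future[OF st]] UNIV_I])
        (simp add: bounded_clinear_on_UNIV \<phi>)
    show "bounded_clinear_on (past (s + t)) (\<lambda>v. ten (s + t) v (shift (s + t) (X x)))"
      by (rule ten_left_linear[OF shift_future[OF st]])
    fix f :: "real \<Rightarrow> 'k" assume f: "f \<in> L2"
    show "\<phi> (ten (s + t) (\<epsilon> (cut {0..<s + t} f)) (shift (s + t) x))
      = ten (s + t) (\<epsilon> (cut {0..<s + t} f)) (shift (s + t) (X x))"
      unfolding assoc[OF f, symmetric] \<phi>_def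
      using s t X f by (simp add: flow_ten flow_ops eps_past L2_left_shift)
  qed
qed (use s t X in auto)

text \<open>Action on the left tensor factor, formulated without \<open>tensor_op\<close>: the
  operator on the factor is the restriction of \<open>P\<close> itself, by way of
  \<open>ten_vac_right\<close>.\<close>

definition adapted :: "real \<Rightarrow> ('f \<Rightarrow> 'f) \<Rightarrow> bool"
  where "adapted t P \<longleftrightarrow> P \<in> bounded_ops \<and> (\<forall>v\<in>past t. P v \<in> past t) \<and>
    (\<forall>v\<in>past t. \<forall>w\<in>future t. P (ten t v w) = ten t (P v) w)"

lemma adaptedD:
  assumes "adapted t P"
  shows "P \<in> bounded_ops" "v \<in> past t \<Longrightarrow> P v \<in> past t"
    "v \<in> past t \<Longrightarrow> w \<in> future t \<Longrightarrow> P (ten t v w) = ten t (P v) w"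
  using assms by (auto simp: adapted_def)

lemma adapted_tensor_op:
  assumes A: "A \<in> bounded_ops_on (past t)"
  shows "adapted t (tensor_op \<epsilon> t A id)"
proof -
  obtain K where K: "\<And>v. v \<in> past t \<Longrightarrow> norm (A v) \<le> K * norm v"
    using A unfolding bounded_ops_on_def by blast
  have K': "norm (A v) \<le> \<bar>K\<bar> * norm v" if "v \<in> past t" for v
    using K[OF that] mult_right_mono[OF abs_ge_self[of K] norm_ge_zero[of v]] by linarith
  obtain T where T: "T \<in> bounded_ops" "\<forall>v\<in>past t. \<forall>w\<in>future t. T (ten t v w) = ten t (A v) w"
    using tensor_pair.left_ampliation[OF ten_pair A abs_ge_zero K'] by blast
  have "tensor_op \<epsilon> t A id = T" unfolding tensor_op_def
  proof (rule the_equality)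
    show "T \<in> bounded_ops \<and> (\<forall>x\<in>past t. \<forall>y\<in>future t. T (ten t x y) = ten t (A x) (id y))"
      using T by simp
    show "T' = T" if "T' \<in> bounded_ops \<and> (\<forall>x\<in>past t. \<forall>y\<in>future t. T' (ten t x y) = ten t (A x) (id y))" for T'
      by (rule tensor_pair.ops_eqI[OF ten_pair]) (use that T in auto)
  qed
  moreover have AV: "A v \<in> past t" if "v \<in> past t" for v using A that by (simp add: bounded_ops_on_def)
  \<comment> \<open>Evaluate the ampliation at \<open>v\<close> tensor the vacuum.\<close>
  moreover have "T v = A v" if v: "v \<in> past t" for v
    using T(2) v vac_future ten_vac_right[OF v] ten_vac_right[OF AV[OF v]] by metis
  ultimately show ?thesis using T by (simp add: adapted_def)
qed

lemma adapted_commute: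
  assumes t: "t \<ge> 0" and P: "adapted t P" and X: "X \<in> bounded_ops"
  shows "P (flow t X z) = flow t X (P z)"
proof -
  note P = adaptedD[OF P]
  have "P \<circ> flow t X = flow t X \<circ> P"
    by (rule ops_eq_on_ten_shift[OF t])
      (use t X in \<open>auto simp: P flow_ten shift_future intro!: bounded_ops_comp flow_ops P\<close>)
  then show ?thesis by (metis comp_apply)
qed

lemma adapted_diff:
  assumes "adapted t P" "adapted t Q" shows "adapted t (\<lambda>x. P x - Q x)"
  unfolding adapted_def
proof (intro conjI ballI)
  note P = adaptedD[OF assms(1)] and Q = adaptedD[OF assms(2)]
  show "(\<lambda>x. P x - Q x) \<in> bounded_ops"
    using bounded_ops_plus[OF P(1) bounded_ops_scale[OF Q(1), of "-1"]]
    by (simp add: scaleC_of_real[of "-1", simplified])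
  fix v assume v: "v \<in> past t"
  show "P v - Q v \<in> past t" using v P Q by (intro csubspaceD(3)[OF csubspace_fock_sub])
  fix w assume w: "w \<in> future t"
  show "P (ten t v w) - Q (ten t v w) = ten t (P v - Q v) w"
    using P Q v w by (simp add: bounded_clinear_onD(4)[OF ten_left_linear[OF w] csubspace_fock_sub])
qed

text \<open>The past at \<open>t\<close> splits further into the past at \<open>s\<close> and the
  piece between \<open>s\<close> and \<open>t\<close>, and \<open>P\<close> touches only the first
  of these. The rest is associativity, checked on generators.\<close>

lemma adapted_mono:
  assumes st: "s \<le> t" and P: "adapted s P"
  shows "adapted t P"
proof -
  note P = adaptedD[OF P]
  \<comment> \<open>The exponential vector of the part of \<open>f\<close> between \<open>s\<close>
    and \<open>t\<close>, as a vector of the future at \<open>s\<close>.\<close>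
  define mid where "mid f = \<epsilon> (cut {s..} (cut {0..<t} f))" for f :: "real \<Rightarrow> 'k"
  have mid: "mid f \<in> future s" if "f \<in> L2" for f unfolding mid_def by (intro eps_future L2_cut_Ico that)
  have spl: "ten s (\<epsilon> (cut {0..<s} g)) (mid f) = \<epsilon> (cut {0..<t} (splice_at s g f))" if "f \<in> L2" "g \<in> L2" for f g
  proof -
    have "ten s (\<epsilon> (cut {0..<s} g)) (mid f) = \<epsilon> (splice_at s g (cut {0..<t} f))"
      unfolding mid_def by (intro ten_eps L2_cut_Ico that)
    also have "\<dots> = \<epsilon> (cut {0..<t} (splice_at s g f))"
      by (intro eps_cong L2_splice L2_cut_Ico that) (use st in \<open>auto simp: splice_at_def cut_def\<close>)
    finally show ?thesis .
  qed
  have mid_past: "ten s v (mid f) \<in> past t" if v: "v \<in> past s" and f: "f \<in> L2" for v f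
    by (rule fock_sub_range[OF ten_left_linear[OF mid[OF f]] csubspace_fock_sub closed_fock_sub _ v])
      (use f in \<open>simp add: spl eps_past L2_splice\<close>)
  have dec: "\<epsilon> (cut {0..<t} f) = ten s (\<epsilon> (cut {0..<s} f)) (mid f)" if f: "f \<in> L2" for f
  proof -
    have "splice_at s f f = f" by (auto simp: splice_at_def)
    then show ?thesis using spl[OF f f] by simp
  qed
  have gen: "P (\<epsilon> (cut {0..<t} f)) = ten s (P (\<epsilon> (cut {0..<s} f))) (mid f)" if f: "f \<in> L2" for f
    unfolding dec[OF f] by (rule P(3)[OF eps_past[OF f] mid[OF f]])
  have past: "P v \<in> past t" if v: "v \<in> past t" for v
    by (rule fock_sub_range[OF bounded_ops_imp_bounded_clinear_on[OF P(1)] csubspace_fock_sub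
          closed_fock_sub _ v])
      (simp add: gen mid_past P(2) eps_past)
  \<comment> \<open>Moves the middle factor from the past at \<open>t\<close> into the future at
    \<open>s\<close>, where \<open>P\<close> leaves it alone.\<close>
  have assoc: "ten t (ten s u (mid f)) (\<epsilon> (cut {t..} h)) = ten s u (\<epsilon> (cut {s..} (splice_at t f h)))"
    if u: "u \<in> past s" and f: "f \<in> L2" and h: "h \<in> L2" for u f h
  proof (rule fock_sub_eqI[where M = "\<lambda>u. ten t (ten s u (mid f)) (\<epsilon> (cut {t..} h))"
        and M' = "\<lambda>u. ten s u (\<epsilon> (cut {s..} (splice_at t f h)))", OF _ _ _ u])
    show "bounded_clinear_on (past s) (\<lambda>u. ten t (ten s u (mid f)) (\<epsilon> (cut {t..} h)))"
      by (rule bounded_clinear_on_compose[OF ten_left_linear[OF mid[OF f]] mid_past[OF _ f]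
            ten_left_linear[OF eps_future[OF h]]])
    show "bounded_clinear_on (past s) (\<lambda>u. ten s u (\<epsilon> (cut {s..} (splice_at t f h))))"
      by (intro ten_left_linear eps_future L2_splice f h)
    fix g :: "real \<Rightarrow> 'k" assume g: "g \<in> L2"
    have "splice_at t (splice_at s g f) h = splice_at s g (splice_at t f h)"
      using st by (auto simp: splice_at_def)
    then show "ten t (ten s (\<epsilon> (cut {0..<s} g)) (mid f)) (\<epsilon> (cut {t..} h))
        = ten s (\<epsilon> (cut {0..<s} g)) (\<epsilon> (cut {s..} (splice_at t f h)))"
      using f g h by (simp add: spl ten_eps L2_splice)
  qed
  have tens: "P (ten t v w) = ten t (P v) w" if v: "v \<in> past t" and w: "w \<in> future t" for v w
  proof (rule fock_sub_eqI[where M = "\<lambda>v. P (ten t v w)" and M' = "\<lambda>v. ten t (P v) w", OF _ _ _ v])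
    show "bounded_clinear_on (past t) (\<lambda>v. P (ten t v w))"
      by (rule bounded_clinear_on_compose[OF ten_left_linear[OF w] UNIV_I])
        (simp add: bounded_clinear_on_UNIV P)
    show "bounded_clinear_on (past t) (\<lambda>v. ten t (P v) w)"
      by (rule bounded_clinear_on_compose[OF bounded_ops_imp_bounded_clinear_on[OF P(1)] past
            ten_left_linear[OF w]])
    fix f :: "real \<Rightarrow> 'k" assume f: "f \<in> L2"
    note ef = eps_past[OF f, of t]
    show "P (ten t (\<epsilon> (cut {0..<t} f)) w) = ten t (P (\<epsilon> (cut {0..<t} f))) w"
    proof (rule fock_sub_eqI[where M = "\<lambda>w. P (ten t (\<epsilon> (cut {0..<t} f)) w)"
          and M' = "ten t (P (\<epsilon> (cut {0..<t} f)))", OF _ _ _ w])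
      show "bounded_clinear_on (future t) (\<lambda>w. P (ten t (\<epsilon> (cut {0..<t} f)) w))"
        by (rule bounded_clinear_on_compose[OF ten_right_linear[OF ef] UNIV_I])
          (simp add: bounded_clinear_on_UNIV P)
      show "bounded_clinear_on (future t) (ten t (P (\<epsilon> (cut {0..<t} f))))"
        by (rule ten_right_linear[OF past[OF ef]])
      fix h :: "real \<Rightarrow> 'k" assume h: "h \<in> L2"
      have "P (ten t (\<epsilon> (cut {0..<t} f)) (\<epsilon> (cut {t..} h)))
          = P (ten s (\<epsilon> (cut {0..<s} f)) (\<epsilon> (cut {s..} (splice_at t f h))))"
        unfolding dec[OF f] assoc[OF eps_past[OF f] f h] ..
      also have "\<dots> = ten s (P (\<epsilon> (cut {0..<s} f))) (\<epsilon> (cut {s..} (splice_at t f h)))"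
        by (intro P eps_past eps_future L2_splice f h)
      also have "\<dots> = ten t (P (\<epsilon> (cut {0..<t} f))) (\<epsilon> (cut {t..} h))"
        unfolding gen[OF f] by (rule assoc[OF P(2)[OF eps_past[OF f]] f h, symmetric])
      finally show "P (ten t (\<epsilon> (cut {0..<t} f)) (\<epsilon> (cut {t..} h)))
        = ten t (P (\<epsilon> (cut {0..<t} f))) (\<epsilon> (cut {t..} h))" .
    qed
  qed
  show ?thesis using P(1) past tens by (simp add: adapted_def)
qed

text \<open>The operators \<open>P\<close> and \<open>flow t Y\<close> act on different tensor factors of \<open>\<epsilon> f\<close>.\<close>

lemma norm_adapted_flow:
  assumes t: "t \<ge> 0" and P: "adapted t P" and Y: "Y \<in> bounded_ops" and f: "f \<in> L2"
  shows "norm (P (flow t Y (\<epsilon> f))) * norm (\<epsilon> f) = norm (P (\<epsilon> f)) * norm (flow t Y (\<epsilon> f))"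
proof -
  note P = adaptedD[OF P]
  define v where "v = \<epsilon> (cut {0..<t} f)"
  define x where "x = \<epsilon> (left_shift t f)"
  have v: "v \<in> past t" unfolding v_def by (rule eps_past[OF f])
  have e: "\<epsilon> f = ten t v (shift t x)" unfolding v_def x_def by (rule eps_ten_shift[OF t f])
  show ?thesis unfolding e
    using t Y v by (simp add: flow_ten P shift_future norm_ten norm_shift)
qed

text \<open>A shifted vector is vacuum before \<open>t\<close>, so \<open>P\<close> meets only
  \<open>vac\<close>. As this holds for every \<open>y\<close>, the stopped shift is treated on all
  vectors directly.\<close>

lemma norm_adapted_shift:
  assumes t: "t \<ge> 0" and P: "adapted t P"
  shows "norm (P (shift t y)) = norm (P vac) * norm y"
proof -
  have "P (shift t y) = P (ten t vac (shift t y))" using shift_eq_ten[OF t] by simp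
  also have "\<dots> = ten t (P vac) (shift t y)" by (intro adaptedD[OF P] vac_past shift_future t)
  finally show ?thesis using t by (simp add: norm_ten adaptedD(2)[OF P] vac_past shift_future norm_shift)
qed

section \<open>Strong continuity of the shift and of the flow\<close>

lemma eps_tendsto:
  assumes u: "\<forall>\<^sub>F n in F. u n \<in> L2" and v: "v \<in> L2"
    and lim: "((\<lambda>n. L2_sq (\<lambda>s. u n s - v s)) \<longlongrightarrow> 0) F"
  shows "((\<lambda>n. \<epsilon> (u n)) \<longlongrightarrow> \<epsilon> v) F"
proof -
  \<comment> \<open>The squared distance of two exponential vectors, written as a continuous
    expression in inner products of the functions.\<close>
  have "((\<lambda>n. Re (exp (L2_inner (u n) (u n))) + Re (exp (L2_inner v v)) - 2 * Re (exp (L2_inner (u n) v)))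
      \<longlongrightarrow> Re (exp (L2_inner v v)) + Re (exp (L2_inner v v)) - 2 * Re (exp (L2_inner v v))) F"
    by (intro tendsto_intros L2_inner_tendsto(1)[OF u v v lim] L2_inner_tendsto_self[OF u v lim])
  moreover have "\<forall>\<^sub>F n in F. Re (exp (L2_inner (u n) (u n))) + Re (exp (L2_inner v v))
      - 2 * Re (exp (L2_inner (u n) v)) = (norm (\<epsilon> (u n) - \<epsilon> v))\<^sup>2"
    using u by eventually_elim (simp only: norm_sq_diff, simp only: norm_sq_cinner eps_inner v)
  ultimately have "((\<lambda>n. (norm (\<epsilon> (u n) - \<epsilon> v))\<^sup>2) \<longlongrightarrow> 0) F"
    by (simp add: tendsto_cong)
  then have "((\<lambda>n. sqrt ((norm (\<epsilon> (u n) - \<epsilon> v))\<^sup>2)) \<longlongrightarrow> sqrt 0) F" by (rule tendsto_real_sqrt)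
  then have "((\<lambda>n. norm (\<epsilon> (u n) - \<epsilon> v)) \<longlongrightarrow> 0) F" by simp
  then show ?thesis by (simp add: tendsto_norm_zero_iff LIM_zero_iff)
qed

lemma shift_tendsto: "((\<lambda>t. shift t x) \<longlongrightarrow> x) (at 0 within {0..})"
proof (rule strong_tendsto_on_total[where K = 1 and L = "\<lambda>x. x", OF _ bounded_clinear_on_ident eps_total])
  have nonneg: "\<forall>\<^sub>F t in at 0 within {0..}. t \<in> {0::real..}" by (simp add: eventually_at_filter)
  then show "\<forall>\<^sub>F t in at 0 within {0..}. bounded_clinear_on UNIV (shift t) \<and> (\<forall>x. norm (shift t x) \<le> 1 * norm x)"
    by eventually_elim (simp add: bounded_clinear_on_UNIV shift_ops norm_shift)
  fix a assume "a \<in> \<epsilon> ` L2"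
  then obtain f where f: "f \<in> L2" "a = \<epsilon> f" by blast
  have "((\<lambda>t. \<epsilon> (right_shift t f)) \<longlongrightarrow> \<epsilon> f) (at 0 within {0..})"
    by (rule eps_tendsto[OF _ f(1) tendsto_right_shift[OF f(1)]])
      (use nonneg in eventually_elim, simp add: L2_right_shift f)
  moreover have "\<forall>\<^sub>F t in at 0 within {0..}. \<epsilon> (right_shift t f) = shift t a"
    using nonneg by eventually_elim (simp add: shift_eps f)
  ultimately show "((\<lambda>t. shift t a) \<longlongrightarrow> a) (at 0 within {0..})"
    unfolding f(2) by (rule Lim_transform_eventually)
qed

text \<open>The past factor of the inner product is eliminated as a quotient, with a denominator
  that never vanishes. Time then enters only through left shifts, whose continuity is known.\<close>

lemma flow_cinner_eps:
  assumes t: "t \<ge> 0" and X: "X \<in> bounded_ops" and f: "f \<in> L2" and g: "g \<in> L2"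
  shows "cinner (\<epsilon> f) (flow t X (\<epsilon> g)) = cinner (\<epsilon> f) (\<epsilon> g) *
    cinner (\<epsilon> (left_shift t f)) (X (\<epsilon> (left_shift t g))) / cinner (\<epsilon> (left_shift t f)) (\<epsilon> (left_shift t g))"
proof -
  define c where "c = cinner (\<epsilon> (cut {0..<t} f)) (\<epsilon> (cut {0..<t} g))"
  have inn: "cinner (\<epsilon> f) (ten t (\<epsilon> (cut {0..<t} g)) (shift t y)) = c * cinner (\<epsilon> (left_shift t f)) y" for y
    by (subst eps_ten_shift[OF t f])
      (simp add: ten_inner eps_past shift_future shift_inner t f g c_def)
  have nz: "cinner (\<epsilon> (left_shift t f)) (\<epsilon> (left_shift t g)) \<noteq> 0"
    using t f g by (simp add: eps_inner L2_left_shift)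
  have "cinner (\<epsilon> f) (\<epsilon> g) = c * cinner (\<epsilon> (left_shift t f)) (\<epsilon> (left_shift t g))"
    by (subst eps_ten_shift[OF t g]) (rule inn)
  moreover have "cinner (\<epsilon> f) (flow t X (\<epsilon> g)) = c * cinner (\<epsilon> (left_shift t f)) (X (\<epsilon> (left_shift t g)))"
    by (subst eps_ten_shift[OF t g]) (simp add: flow_ten t X eps_past g inn)
  ultimately show ?thesis using nz by simp
qed

text \<open>Weak continuity for \<open>X\<close> and for \<open>X\<^sup>* X\<close> gives strong continuity, since the flow is
  a \<open>*\<close>-homomorphism.\<close>

lemma flow_continuous:
  assumes X: "X \<in> bounded_ops" and g: "g \<in> L2"
  shows "continuous_on {0..} (\<lambda>t. flow t X (\<epsilon> g))"
  unfolding continuous_on_def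
proof
  fix s :: real assume "s \<in> {0..}"
  then have s: "s \<ge> 0" by simp
  let ?F = "at s within {0..}"
  have nonneg: "\<forall>\<^sub>F t in ?F. t \<in> {0..}" by (simp add: eventually_at_filter)
  have ls: "((\<lambda>t. \<epsilon> (left_shift t f)) \<longlongrightarrow> \<epsilon> (left_shift s f)) ?F" if f: "f \<in> L2" for f
    by (rule eps_tendsto[OF _ L2_left_shift[OF s f] tendsto_left_shift[OF f s]])
      (use nonneg in eventually_elim, simp add: L2_left_shift f)
  have weak: "((\<lambda>t. cinner z (flow t Y (\<epsilon> g))) \<longlongrightarrow> cinner z (flow s Y (\<epsilon> g))) ?F"
    if Y: "Y \<in> bounded_ops" for Y z
  proof -
    obtain K where K: "K > 0" "\<And>x. norm (Y x) \<le> K * norm x" using bounded_ops_bound[OF Y] by metis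
    show ?thesis
    proof (rule weak_tendsto_on_total[OF eps_total, where K = "K * norm (\<epsilon> g)"])
      show "\<forall>\<^sub>F t in ?F. norm (flow t Y (\<epsilon> g)) \<le> K * norm (\<epsilon> g)"
        using nonneg by eventually_elim (use Y K in \<open>auto intro: flow_norm\<close>)
      fix a assume "a \<in> \<epsilon> ` L2"
      then obtain f where f: "f \<in> L2" "a = \<epsilon> f" by blast
      have "((\<lambda>t. cinner (\<epsilon> f) (\<epsilon> g) * cinner (\<epsilon> (left_shift t f)) (Y (\<epsilon> (left_shift t g)))
            / cinner (\<epsilon> (left_shift t f)) (\<epsilon> (left_shift t g))) \<longlongrightarrow>
          cinner (\<epsilon> f) (\<epsilon> g) * cinner (\<epsilon> (left_shift s f)) (Y (\<epsilon> (left_shift s g)))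
            / cinner (\<epsilon> (left_shift s f)) (\<epsilon> (left_shift s g))) ?F"
        by (rule tendsto_divide[OF tendsto_mult[OF tendsto_const
            tendsto_cinner[OF ls[OF f(1)] bounded_ops_tendsto[OF Y ls[OF g]]]]
            tendsto_cinner[OF ls[OF f(1)] ls[OF g]]])
          (simp add: eps_inner L2_left_shift s f g)
      moreover have "\<forall>\<^sub>F t in ?F. cinner (\<epsilon> f) (\<epsilon> g) * cinner (\<epsilon> (left_shift t f)) (Y (\<epsilon> (left_shift t g)))
            / cinner (\<epsilon> (left_shift t f)) (\<epsilon> (left_shift t g)) = cinner a (flow t Y (\<epsilon> g))"
        using nonneg by eventually_elim (simp add: flow_cinner_eps Y f g)
      ultimately have "((\<lambda>t. cinner a (flow t Y (\<epsilon> g))) \<longlongrightarrow>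
          cinner (\<epsilon> f) (\<epsilon> g) * cinner (\<epsilon> (left_shift s f)) (Y (\<epsilon> (left_shift s g)))
            / cinner (\<epsilon> (left_shift s f)) (\<epsilon> (left_shift s g))) ?F"
        by (rule Lim_transform_eventually)
      then show "((\<lambda>t. cinner a (flow t Y (\<epsilon> g))) \<longlongrightarrow> cinner a (flow s Y (\<epsilon> g))) ?F"
        unfolding f(2) flow_cinner_eps[OF s Y f(1) g] .
    qed
  qed
  let ?u = "\<lambda>t. flow t X (\<epsilon> g)"
  have XX: "adj X \<circ> X \<in> bounded_ops" by (intro bounded_ops_comp adj_bounded X)
  have sq: "cinner (?u t) (?u t) = cinner (\<epsilon> g) (flow t (adj X \<circ> X) (\<epsilon> g))" if "t \<ge> 0" for t
    using that X by (simp add: flow_comp flow_adj adj_bounded adj_cinner' flow_ops)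
  have "((\<lambda>t. Re (cinner (\<epsilon> g) (flow t (adj X \<circ> X) (\<epsilon> g))) + Re (cinner (?u s) (?u s))
        - 2 * Re (cinner (?u s) (?u t))) \<longlongrightarrow>
      Re (cinner (\<epsilon> g) (flow s (adj X \<circ> X) (\<epsilon> g))) + Re (cinner (?u s) (?u s))
        - 2 * Re (cinner (?u s) (?u s))) ?F"
    by (intro tendsto_add tendsto_diff tendsto_mult tendsto_const tendsto_Re weak XX X)
  moreover have "\<forall>\<^sub>F t in ?F. Re (cinner (\<epsilon> g) (flow t (adj X \<circ> X) (\<epsilon> g))) + Re (cinner (?u s) (?u s))
        - 2 * Re (cinner (?u s) (?u t)) = (norm (?u s - ?u t))\<^sup>2"
    using nonneg by eventually_elim (simp only: norm_sq_diff, simp add: norm_sq_cinner sq)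
  ultimately have "((\<lambda>t. (norm (?u s - ?u t))\<^sup>2) \<longlongrightarrow>
      Re (cinner (\<epsilon> g) (flow s (adj X \<circ> X) (\<epsilon> g))) + Re (cinner (?u s) (?u s))
        - 2 * Re (cinner (?u s) (?u s))) ?F"
    by (rule Lim_transform_eventually)
  then have "((\<lambda>t. (norm (?u s - ?u t))\<^sup>2) \<longlongrightarrow> 0) ?F" by (simp add: sq[OF s])
  then have "((\<lambda>t. sqrt ((norm (?u s - ?u t))\<^sup>2)) \<longlongrightarrow> sqrt 0) ?F" by (rule tendsto_real_sqrt)
  then have "((\<lambda>t. norm (?u t - ?u s)) \<longlongrightarrow> 0) ?F" by (simp add: norm_minus_commute)
  then show "(?u \<longlongrightarrow> ?u s) ?F" by (simp add: tendsto_norm_zero_iff LIM_zero_iff)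
qed

text \<open>An orthogonal projection is determined by its range: with equal ranges each of two
  projections fixes the values of the other, and self-adjointness makes them equal.\<close>

lemma shift_infinity: "shift_op \<epsilon> \<infinity> x = cinner vac x *\<^sub>C vac"
proof -
  define Q where "Q x = cinner vac x *\<^sub>C vac" for x
  have vv: "cinner vac vac = 1" by (simp add: cinner_self norm_vac)
  have Q: "orth_projection Q"
    unfolding orth_projection_def
  proof (intro conjI allI)
    show "Q \<in> bounded_ops"
      using cauchy_schwarz[of vac]
      by (intro bounded_opsI[where K = 1])
        (auto simp: Q_def cinner_simps scaleC_add_left scaleC_scaleC norm_vac)
    show "Q \<circ> Q = Q" by (auto simp: Q_def cinner_simps vv)
    show "cinner (Q x) y = cinner x (Q y)" for x y
      by (simp add: Q_def cinner_simps cinner_commute[of x vac] mult.commute)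
  qed
  have rQ: "range Q = range (\<lambda>c. c *\<^sub>C vac)"
  proof (intro equalityI subsetI)
    fix y assume "y \<in> range (\<lambda>c. c *\<^sub>C vac)"
    then obtain c where "y = c *\<^sub>C vac" by blast
    then have "y = Q (c *\<^sub>C vac)" by (simp add: Q_def cinner_simps vv)
    then show "y \<in> range Q" by blast
  qed (auto simp: Q_def)
  have "shift_op \<epsilon> \<infinity> = Q"
    unfolding shift_op_def
  proof (simp, intro the_equality)
    fix P assume P: "orth_projection P \<and> range P = range (\<lambda>c. c *\<^sub>C vac)"
    have PQ: "P (Q x) = Q x" for x
    proof -
      have "Q x \<in> range P" using P rQ by blast
      then obtain z where "Q x = P z" by blast
      then show ?thesis using P by (simp add: orth_projection_idem)
    qed
    have QP: "Q (P x) = P x" for x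
    proof -
      have "P x \<in> range Q" using P rQ by blast
      then obtain z where "P x = Q z" by blast
      then show ?thesis using Q by (simp add: orth_projection_idem)
    qed
    have "cinner z (P x) = cinner z (Q x)" for x z
    proof -
      have "cinner z (P x) = cinner z (Q (P x))" by (simp only: QP)
      also have "\<dots> = cinner (Q z) (P x)" using orth_projection_self_adjoint[OF Q] by simp
      also have "\<dots> = cinner (P (Q z)) x" using orth_projection_self_adjoint[of P] P by simp
      also have "\<dots> = cinner z (Q x)" using PQ orth_projection_self_adjoint[OF Q] by simp
      finally show ?thesis .
    qed
    then show "P = Q" using cinner_ext by blast
  qed (use Q rQ in auto)
  then show ?thesis by (simp add: Q_def)
qed

end

subsection \<open>Partitions\<close>

text \<open>Rounding up to the partition, possible because \<infinity> is one of its points.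
  Refinement becomes a composition of roundings and needs no index arithmetic.\<close>

definition next_point :: "ennreal set \<Rightarrow> ennreal \<Rightarrow> ennreal"
  where "next_point P x = Min {p \<in> P. x \<le> p}"

text \<open>The fibres of rounding up. Time 0 is excluded to match the left-open partition
  intervals.\<close>

definition cell :: "ennreal set \<Rightarrow> ennreal \<Rightarrow> ennreal set"
  where "cell P p = {x. 0 < x \<and> next_point P x = p}"

lemma time_partitionD: "time_partition P \<Longrightarrow> finite P" "time_partition P \<Longrightarrow> 0 \<in> P" "time_partition P \<Longrightarrow> \<infinity> \<in> P"
  by (auto simp: time_partition_def)

lemma next_point_in: "time_partition P \<Longrightarrow> next_point P x \<in> P" and next_point_ge: "time_partition P \<Longrightarrow> x \<le> next_point P x"
proof -
  assume P: "time_partition P"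
  then have "finite {p \<in> P. x \<le> p}" "\<infinity> \<in> {p \<in> P. x \<le> p}" by (auto simp: time_partition_def)
  then have "next_point P x \<in> {p \<in> P. x \<le> p}" unfolding next_point_def by (intro Min_in) auto
  then show "next_point P x \<in> P" "x \<le> next_point P x" by auto
qed

lemma next_point_le: "time_partition P \<Longrightarrow> p \<in> P \<Longrightarrow> x \<le> p \<Longrightarrow> next_point P x \<le> p"
  unfolding next_point_def by (rule Min_le) (auto simp: time_partition_def)

lemma next_point_eqI:
  assumes "time_partition P" "p \<in> P" "x \<le> p" "\<And>q. q \<in> P \<Longrightarrow> x \<le> q \<Longrightarrow> p \<le> q"
  shows "next_point P x = p"
  using assms next_point_in next_point_ge next_point_le by (intro antisym) auto

lemma next_point_self: "time_partition P \<Longrightarrow> p \<in> P \<Longrightarrow> next_point P p = p"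
  by (rule next_point_eqI) auto

lemma next_point_next_point:
  assumes P: "time_partition P" and Q: "time_partition Q" and sub: "P \<subseteq> Q"
  shows "next_point P (next_point Q x) = next_point P x"
proof (rule next_point_eqI[OF P next_point_in[OF P]])
  show "next_point Q x \<le> next_point P x" using sub by (intro next_point_le[OF Q] next_point_ge[OF P]) (use next_point_in[OF P] in auto)
  show "next_point P x \<le> q" if "q \<in> P" "next_point Q x \<le> q" for q
    using next_point_le[OF P that(1)] next_point_ge[OF Q, of x] that(2) by (meson order_trans)
qed

lemma cell_disjoint: "p \<noteq> q \<Longrightarrow> cell P p \<inter> cell P q = {}"
  by (auto simp: cell_def)

lemma UN_cells: "time_partition P \<Longrightarrow> (\<Union>p\<in>P - {0}. cell P p) = {0<..}"
  using next_point_in next_point_ge by (auto simp: cell_def) (metis leD)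

text \<open>Rounding up in \<open>Q\<close> and then in \<open>P\<close> is rounding up in
  \<open>P\<close>, so the fibres of the latter are unions of fibres of the former.\<close>

lemma cell_refine:
  assumes P: "time_partition P" and Q: "time_partition Q" and sub: "P \<subseteq> Q"
  shows "cell P p = (\<Union>q\<in>{q \<in> Q - {0}. next_point P q = p}. cell Q q)"
proof (intro equalityI subsetI)
  fix x assume "x \<in> cell P p"
  then have x: "0 < x" "next_point P x = p" by (simp_all add: cell_def)
  then have "next_point Q x \<noteq> 0" using next_point_ge[OF Q, of x] by (metis leD)
  then have "next_point Q x \<in> {q \<in> Q - {0}. next_point P q = p}"
    using x(2) next_point_next_point[OF P Q sub, of x] next_point_in[OF Q, of x] by simp
  moreover have "x \<in> cell Q (next_point Q x)" using x(1) by (simp add: cell_def)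
  ultimately show "x \<in> (\<Union>q\<in>{q \<in> Q - {0}. next_point P q = p}. cell Q q)" by (rule UN_I)
next
  fix x assume "x \<in> (\<Union>q\<in>{q \<in> Q - {0}. next_point P q = p}. cell Q q)"
  then have "0 < x" "next_point P (next_point Q x) = p" by (auto simp: cell_def)
  then show "x \<in> cell P p" using next_point_next_point[OF P Q sub, of x] by (simp add: cell_def)
qed

text \<open>The dictionary between the increasing enumeration \<open>pt\<close> of the definitions
  and the cells. The point 0 has index 0, so indices from 1 on enumerate the right ends of
  cells.\<close>

lemma time_partition_points:
  assumes P: "time_partition P"
  shows pt_last: "pt P (card P - 1) = \<infinity>" and card_ge_2: "card P \<ge> 2"
    and pt_bij: "bij_betw (pt P) {1..<card P} (P - {0})"
    and cell_pt: "\<And>j. j \<in> {1..<card P} \<Longrightarrow> cell P (pt P j) = {pt P (j - 1)<..pt P j}"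
    and pt_less: "\<And>j. j \<in> {1..<card P} \<Longrightarrow> pt P (j - 1) < pt P j"
    and pt_in: "\<And>j. j < card P \<Longrightarrow> pt P j \<in> P"
proof -
  define l where "l = sorted_list_of_set P"
  have fin: "finite P" using P by (simp add: time_partition_def)
  have l: "sorted l" "distinct l" "set l = P" "length l = card P"
    using fin by (auto simp: l_def)
  have ptl: "pt P j = l ! j" for j by (simp add: pt_def l_def)
  have "card {0, \<infinity> :: ennreal} \<le> card P" using P by (intro card_mono) (auto simp: time_partition_def)
  then show c2: "card P \<ge> 2" by simp
  show in': "pt P j \<in> P" if "j < card P" for j
    using that l nth_mem[of j l] by (simp add: ptl)
  have less: "pt P i < pt P j" if "i < j" "j < card P" for i j
    using sorted_nth_mono[OF l(1), of i j] nth_eq_iff_index_eq[OF l(2), of i j] that l(4)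
    by (simp add: ptl order.strict_iff_order)
  have idx: "\<exists>i<card P. p = pt P i" if "p \<in> P" for p
    using that l by (metis in_set_conv_nth ptl)
  have p0: "pt P 0 = 0"
  proof -
    obtain i where i: "i < card P" "0 = pt P i" using idx[OF time_partitionD(2)[OF P]] by blast
    then show ?thesis using less[of 0 i] by (cases "i = 0") auto
  qed
  show "pt P (card P - 1) = \<infinity>"
  proof -
    obtain i where i: "i < card P" "\<infinity> = pt P i" using idx[OF time_partitionD(3)[OF P]] by blast
    show ?thesis
    proof (cases "i = card P - 1")
      case False
      then have "pt P i < pt P (card P - 1)" using i by (intro less) auto
      then show ?thesis using i(2) by simp
    qed (use i in simp)
  qed
  show "pt P (j - 1) < pt P j" if "j \<in> {1..<card P}" for j using that by (intro less) auto
  show "bij_betw (pt P) {1..<card P} (P - {0})"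
    unfolding bij_betw_def
  proof
    show "inj_on (pt P) {1..<card P}"
      using less by (intro linorder_inj_onI) (auto simp: less_le)
    show "pt P ` {1..<card P} = P - {0}"
    proof (intro equalityI subsetI)
      fix x assume "x \<in> pt P ` {1..<card P}"
      then obtain j where j: "x = pt P j" "1 \<le> j" "j < card P" by auto
      then show "x \<in> P - {0}" using in'[of j] less[of 0 j] p0 by auto
    next
      fix x assume x: "x \<in> P - {0}"
      then obtain i where i: "i < card P" "x = pt P i" using idx by auto
      then have "i \<noteq> 0" using x p0 by (metis DiffD2 singletonI)
      then show "x \<in> pt P ` {1..<card P}" using i by auto
    qed
  qed
  show "cell P (pt P j) = {pt P (j - 1)<..pt P j}" if "j \<in> {1..<card P}" for j
  proof (intro equalityI subsetI)
    fix x assume x: "x \<in> cell P (pt P j)"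
    then have "x \<le> pt P j" using next_point_ge[OF P, of x] by (simp add: cell_def)
    moreover have "\<not> x \<le> pt P (j - 1)"
    proof
      assume "x \<le> pt P (j - 1)"
      then have "next_point P x \<le> pt P (j - 1)" using that by (intro next_point_le[OF P] in') auto
      then have "pt P j \<le> pt P (j - 1)" using x by (simp add: cell_def)
      then show False using less[of "j - 1" j] that by simp
    qed
    ultimately show "x \<in> {pt P (j - 1)<..pt P j}" by simp
  next
    fix x assume x: "x \<in> {pt P (j - 1)<..pt P j}"
    have "next_point P x = pt P j"
    proof (rule next_point_eqI[OF P])
      fix q assume q: "q \<in> P" "x \<le> q"
      obtain i where i: "i < card P" "q = pt P i" using idx q by blast
      then have lt: "pt P (j - 1) < pt P i" using x q by auto
      have "j \<le> i"
      proof (rule ccontr)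
        assume "\<not> j \<le> i"
        then have "i = j - 1 \<or> i < j - 1" by linarith
        moreover have "j - 1 < card P" using that by auto
        ultimately have "pt P i \<le> pt P (j - 1)" using less[of i "j - 1"] by (auto intro: less_imp_le)
        then show False using lt by simp
      qed
      then show "pt P j \<le> q" using less[of j i] i by (cases "i = j") auto
    qed (use x that in' in auto)
    moreover have "0 < x" using x by (auto intro: order_le_less_trans)
    ultimately show "x \<in> cell P (pt P j)" by (simp add: cell_def)
  qed
qed

lemma cell_interval:
  assumes P: "time_partition P" and p: "p \<in> P - {0}"
  obtains a where "a \<in> P" "a < p" "cell P p = {a<..p}"
proof -
  obtain j where j: "j \<in> {1..<card P}" "p = pt P j"
    using pt_bij[OF P] p unfolding bij_betw_def by blast
  show thesis
    by (rule that[of "pt P (j - 1)"]) (use j pt_in[OF P, of "j - 1"] pt_less[OF P] cell_pt[OF P] in auto)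
qed

lemma sum_over_cells:
  assumes P: "time_partition P"
  shows "(\<Sum>j=1..<card P. F {pt P (j - 1)<..pt P j} (pt P j)) = (\<Sum>p\<in>P - {0}. F (cell P p) p)"
  by (rule trans[OF _ sum.reindex_bij_betw[OF pt_bij[OF P], of "\<lambda>p. F (cell P p) p"]])
    (simp add: cell_pt[OF P])

lemma borel_cell: "time_partition P \<Longrightarrow> p \<in> P - {0} \<Longrightarrow> cell P p \<in> sets borel"
  by (erule (1) cell_interval) simp

lemma eventually_time_partition: "\<forall>\<^sub>F P in refinement. time_partition P"
  unfolding eventually_refinement by (intro exI[of _ "{0, \<infinity>}"]) (auto simp: time_partition_def)

lemma eventually_contains: "\<forall>\<^sub>F P in refinement. t \<in> P"
  unfolding eventually_refinement by (intro exI[of _ "{0, t, \<infinity>}"]) (auto simp: time_partition_def)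

text \<open>Partitions need not be comparable, so the Cauchy condition speaks of refinements of a
  single one. Finite unions of the chosen partitions give an increasing sequence, whose limit is
  compared with any later refinement through \<open>P k\<close>.\<close>

lemma refinement_convergent:
  fixes f :: "ennreal set \<Rightarrow> 'a::banach"
  assumes "\<And>e. e > 0 \<Longrightarrow> \<exists>P. time_partition P \<and> (\<forall>Q. time_partition Q \<and> P \<subseteq> Q \<longrightarrow> norm (f Q - f P) \<le> e)"
  shows "\<exists>y. (f \<longlongrightarrow> y) refinement"
proof -
  have "\<forall>n::nat. \<exists>P. time_partition P \<and>
      (\<forall>Q. time_partition Q \<and> P \<subseteq> Q \<longrightarrow> norm (f Q - f P) \<le> inverse (real (Suc n)))"
    using assms by simp
  then obtain P where P: "\<And>n. time_partition (P n)"
    "\<And>n Q. time_partition Q \<Longrightarrow> P n \<subseteq> Q \<Longrightarrow> norm (f Q - f (P n)) \<le> inverse (real (Suc n))"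
    by metis
  define R where "R n = (\<Union>k\<le>n. P k)" for n
  have R: "time_partition (R n)" for n
    using P(1) by (auto simp: R_def time_partition_def)
  have PR: "P k \<subseteq> R n" if "k \<le> n" for k n using that by (auto simp: R_def)
  have close: "norm (f (R n) - f (P k)) \<le> inverse (real (Suc k))" if "k \<le> n" for k n
    using P(2)[OF R PR[OF that]] .
  have "Cauchy (\<lambda>n. f (R n))"
  proof (rule CauchyI)
    fix e :: real assume "e > 0"
    then obtain k where k: "inverse (real (Suc k)) < e / 2" using reals_Archimedean[of "e / 2"] by auto
    have "norm (f (R m) - f (R n)) < e" if "m \<ge> k" "n \<ge> k" for m n
      using close[OF that(1)] close[OF that(2)] k
        norm_triangle_ineq4[of "f (R m) - f (P k)" "f (R n) - f (P k)"] by simp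
    then show "\<exists>M. \<forall>m\<ge>M. \<forall>n\<ge>M. norm (f (R m) - f (R n)) < e" by blast
  qed
  then obtain y where y: "(\<lambda>n. f (R n)) \<longlonglongrightarrow> y" using Cauchy_convergent convergent_def by blast
  have yP: "norm (y - f (P k)) \<le> inverse (real (Suc k))" for k
  proof (rule LIMSEQ_le_const2[OF tendsto_norm[OF tendsto_diff[OF y tendsto_const]]])
    show "\<exists>N. \<forall>n\<ge>N. norm (f (R n) - f (P k)) \<le> inverse (real (Suc k))" using close by blast
  qed
  have "(f \<longlongrightarrow> y) refinement"
  proof (rule tendstoI)
    fix e :: real assume "e > 0"
    then obtain k where k: "inverse (real (Suc k)) < e / 2" using reals_Archimedean[of "e / 2"] by auto
    have "dist (f Q) y < e" if "time_partition Q" "P k \<subseteq> Q" for Q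
      using P(2)[OF that] yP[of k] k norm_triangle_ineq4[of "f Q - f (P k)" "y - f (P k)"]
      by (simp add: dist_norm)
    then show "\<forall>\<^sub>F Q in refinement. dist (f Q) y < e"
      unfolding eventually_refinement using P(1) by blast
  qed
  then show ?thesis by blast
qed

text \<open>Tailored to \<open>riemann_convergent\<close>: up to \<open>N\<close> rounding moves a
  time by less than \<open>d\<close> and does not pass \<open>N\<close>, beyond \<open>N\<close> it
  leads straight to \<infinity>.\<close>

lemma fine_partition:
  assumes d: "d > 0"
  shows "\<exists>P. time_partition P \<and> ennreal (real N) \<in> P \<and>
    (\<forall>q\<ge>0. q \<le> real N \<longrightarrow> (\<exists>p. next_point P (ennreal q) = ennreal p \<and> q \<le> p \<and> p \<le> real N \<and> p - q < d)) \<and>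
    (\<forall>x. ennreal (real N) < x \<longrightarrow> next_point P x = \<infinity>)"
proof -
  obtain m where m: "inverse (real (Suc m)) < d" using reals_Archimedean[OF d] by auto
  define n where "n = real (Suc m)"
  have n: "n > 0" "1 / n < d" using m by (auto simp: n_def inverse_eq_divide)
  \<comment> \<open>Multiples of \<open>1 / n\<close> with \<open>n = real (Suc m)\<close>, so that
    \<open>N\<close> itself is the grid point of index \<open>Suc m * N\<close>.\<close>
  define P where "P = insert \<infinity> ((\<lambda>k. ennreal (real k / n)) ` {..Suc m * N})"
  have P: "time_partition P"
    unfolding time_partition_def P_def using n by (auto intro!: image_eqI[of _ _ 0])
  have "real (Suc m * N) / n = real N" unfolding n_def of_nat_mult by simp
  then have "ennreal (real N) = ennreal (real (Suc m * N) / n)" by simp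
  then have "ennreal (real N) \<in> P" unfolding P_def by blast
  moreover have "\<exists>p. next_point P (ennreal q) = ennreal p \<and> q \<le> p \<and> p \<le> real N \<and> p - q < d"
    if q: "q \<ge> 0" "q \<le> real N" for q
  proof -
    \<comment> \<open>The grid point \<open>k / n\<close> lies in the partition and caps the
      rounding error by \<open>1 / n\<close>; the rounded value is then found between
      \<open>q\<close> and it.\<close>
    define k where "k = nat \<lceil>q * n\<rceil>"
    have qn: "q * n \<ge> 0" using q n by simp
    have k: "q * n \<le> real k" "real k < q * n + 1" using qn by (auto simp: k_def) linarith+
    have "real k < real (Suc m * N) + 1"
    proof -
      have "q * n \<le> real N * n" using q n by (intro mult_right_mono) auto
      moreover have "real (Suc m * N) = real N * n" unfolding n_def of_nat_mult by simp
      ultimately show ?thesis using k(2) by linarith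
    qed
    then have "k \<le> Suc m * N" by linarith
    then have "ennreal (real k / n) \<in> P" by (auto simp: P_def)
    moreover have qk: "q \<le> real k / n" using k n by (simp add: field_simps)
    ultimately have le: "next_point P (ennreal q) \<le> ennreal (real k / n)" by (intro next_point_le[OF P] ennreal_leI)
    then have "next_point P (ennreal q) \<noteq> \<infinity>" by (auto simp: top_unique)
    then obtain j where j: "j \<le> Suc m * N" "next_point P (ennreal q) = ennreal (real j / n)"
      using next_point_in[OF P, of "ennreal q"] unfolding P_def by auto
    have "q \<le> real j / n" using next_point_ge[OF P, of "ennreal q"] n unfolding j(2) by (simp add: ennreal_le_iff)
    moreover have "real j / n \<le> real k / n" using le n unfolding j(2) by (simp add: ennreal_le_iff)
    moreover have "real k / n < q + d"
    proof -
      have "real k / n < (q * n + 1) / n" using k n by (intro divide_strict_right_mono) auto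
      also have "\<dots> = q + 1 / n" using n by (simp add: field_simps)
      finally show ?thesis using n by linarith
    qed
    moreover have "real j / n \<le> real N"
    proof -
      have "real j \<le> real (Suc m * N)" using j(1) by (simp only: of_nat_le_iff)
      then show ?thesis using n by (simp add: n_def field_simps)
    qed
    ultimately show ?thesis using j(2) by (intro exI[of _ "real j / n"]) auto
  qed
  moreover have "next_point P x = \<infinity>" if x: "ennreal (real N) < x" for x
  proof (rule ccontr)
    assume "next_point P x \<noteq> \<infinity>"
    then obtain j where j: "j \<le> Suc m * N" "next_point P x = ennreal (real j / n)"
      using next_point_in[OF P, of x] unfolding P_def by auto
    have "real j / n \<le> real N"
    proof -
      have "real j \<le> real (Suc m * N)" using j(1) by (simp only: of_nat_le_iff)
      then show ?thesis using n by (simp add: n_def field_simps)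
    qed
    then have "next_point P x \<le> ennreal (real N)" unfolding j(2) by (rule ennreal_leI)
    then show False using x next_point_ge[OF P, of x] by (simp add: not_le[symmetric] order_trans)
  qed
  ultimately show ?thesis using P by blast
qed

subsection \<open>Stop times\<close>

locale stop_time = fock +
  fixes S :: "ennreal set \<Rightarrow> 'b \<Rightarrow> 'b"
  assumes stop: "finite_stop_time \<epsilon> S"
begin

lemma S_proj: "A \<in> sets borel \<Longrightarrow> orth_projection (S A)"
  using stop by (simp add: finite_stop_time_def)

lemmas S_ops = orth_projection_bounded_ops[OF S_proj]

lemma S_sums: "range A \<subseteq> sets borel \<Longrightarrow> disjoint_family A \<Longrightarrow>
    (\<lambda>n. cinner x (S (A n) y)) sums cinner x (S (\<Union>n. A n) y)" for A :: "nat \<Rightarrow> ennreal set"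
  using stop unfolding finite_stop_time_def by blast

lemma S_UNIV: "S UNIV = id" and S_zero: "S {0} = (\<lambda>_. 0)" and S_infinity: "S {\<infinity>} = (\<lambda>_. 0)"
  using stop by (simp_all add: finite_stop_time_def)

text \<open>A series with constant terms converges only if the terms are zero.\<close>

lemma S_empty: "S {} x = 0"
proof (rule cinner_ext)
  fix z
  have "(\<lambda>n::nat. cinner z (S {} x)) sums cinner z (S {} x)"
    using S_sums[of "\<lambda>_. {}" z x] by (simp add: disjoint_family_on_def)
  then have "(\<lambda>n::nat. cinner z (S {} x)) \<longlonglongrightarrow> 0" by (intro summable_LIMSEQ_zero sums_summable)
  then show "cinner z (S {} x) = cinner z 0" using LIMSEQ_const_iff by fastforce
qed

lemma S_Un:
  assumes "A \<in> sets borel" "B \<in> sets borel" "A \<inter> B = {}"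
  shows "S (A \<union> B) x = S A x + S B x"
proof (rule cinner_ext)
  fix z
  define C where "C n = (if n = 0 then A else if n = 1 then B else {})" for n :: nat
  have U: "(\<Union>n. C n) = A \<union> B" unfolding C_def by (auto split: if_splits)
  have "(\<lambda>n. cinner z (S (C n) x)) sums cinner z (S (A \<union> B) x)"
    unfolding U[symmetric] using assms by (intro S_sums) (auto simp: C_def disjoint_family_on_def)
  moreover have "(\<lambda>n. cinner z (S (C n) x)) sums (\<Sum>n\<in>{0,1}. cinner z (S (C n) x))"
    by (rule sums_finite) (auto simp: C_def S_empty)
  ultimately have "cinner z (S (A \<union> B) x) = (\<Sum>n\<in>{0,1}. cinner z (S (C n) x))" by (rule sums_unique2)
  then show "cinner z (S (A \<union> B) x) = cinner z (S A x + S B x)"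
    by (simp add: C_def cinner_add_right)
qed

text \<open>For \<open>y\<close> in the range of \<open>S B\<close>, additivity gives
  \<open>S (A \<union> B) y\<close> the squared norm of \<open>S A y\<close> plus that of
  \<open>y\<close>, and a projection cannot enlarge \<open>y\<close>.\<close>

lemma S_orth:
  assumes A: "A \<in> sets borel" and B: "B \<in> sets borel" and AB: "A \<inter> B = {}"
  shows "S A (S B x) = 0"
proof -
  define y where "y = S B x"
  have y: "S B y = y" using orth_projection_idem[OF S_proj[OF B]] by (simp add: y_def)
  have AuB: "A \<union> B \<in> sets borel" using A B by simp
  have "(norm (S (A \<union> B) y))\<^sup>2 = (norm (S A y))\<^sup>2 + (norm (S B y))\<^sup>2"
  proof -
    have "(norm (S (A \<union> B) y))\<^sup>2 = Re (cinner y (S (A \<union> B) y))"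
      by (rule orth_projection_norm[OF S_proj[OF AuB]])
    also have "\<dots> = Re (cinner y (S A y)) + Re (cinner y (S B y))"
      by (simp add: S_Un[OF A B AB] cinner_add_right)
    finally show ?thesis
      using orth_projection_norm[OF S_proj[OF A], of y] orth_projection_norm[OF S_proj[OF B], of y] by simp
  qed
  moreover have "(norm (S (A \<union> B) y))\<^sup>2 \<le> (norm y)\<^sup>2"
    by (intro power_mono orth_projection_contractive S_proj AuB) simp
  ultimately have "(norm (S A y))\<^sup>2 \<le> 0" using y by simp
  then show ?thesis by (simp add: y_def)
qed

lemma S_subset:
  assumes A: "A \<in> sets borel" and B: "B \<in> sets borel" and AB: "A \<subseteq> B"
  shows "S A (S B x) = S A x"
proof -
  have "S B x = S A x + S (B - A) x"
    using S_Un[of A "B - A" x] A B AB by (simp add: Un_absorb1)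
  then show ?thesis
    using A B by (simp add: bounded_ops_add[OF S_ops] S_orth orth_projection_idem[OF S_proj])
qed

lemma S_UN:
  assumes "finite I" "\<And>i. i \<in> I \<Longrightarrow> C i \<in> sets borel" "\<And>i j. i \<in> I \<Longrightarrow> j \<in> I \<Longrightarrow> i \<noteq> j \<Longrightarrow> C i \<inter> C j = {}"
  shows "S (\<Union>i\<in>I. C i) x = (\<Sum>i\<in>I. S (C i) x)"
  using assms
proof (induction I rule: finite_induct)
  case empty
  then show ?case by (simp add: S_empty)
next
  case (insert i I)
  have "C i \<inter> (\<Union>j\<in>I. C j) = {}" using insert.prems(2) insert.hyps by fastforce
  moreover have "(\<Union>j\<in>I. C j) \<in> sets borel" using insert by (intro sets.finite_UN) auto
  ultimately show ?case using insert by (simp add: S_Un)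
qed

lemma S_Ioi_0: "S {0<..} x = x"
proof -
  have "UNIV = {0} \<union> {0::ennreal<..}" by (auto simp: zero_less_iff_neq_zero)
  then have "S UNIV x = S {0} x + S {0<..} x" using S_Un[of "{0}" "{0<..}" x] by simp
  then show ?thesis by (simp add: S_UNIV S_zero)
qed

text \<open>Here finiteness enters: without mass at 0 and at \<infinity>, the intervals between
  consecutive integers exhaust \<open>S\<close>, and countable additivity makes the remainder
  small.\<close>

lemma S_tail:
  assumes e: "e > 0" shows "\<exists>N::nat. norm (S {ennreal (real N)<..} v) < e"
proof -
  define A where "A n = {ennreal (real n)<..ennreal (real (Suc n))}" for n :: nat
  have bA: "A n \<in> sets borel" for n by (simp add: A_def)
  have disj: "A m \<inter> A n = {}" if mn: "m < n" for m n
  proof -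
    have "ennreal (real (Suc m)) \<le> ennreal (real n)" using mn by (intro ennreal_leI) simp
    then show ?thesis by (auto simp: A_def)
  qed
  have dis: "A m \<inter> A n = {}" if "m \<noteq> n" for m n
    using disj[of m n] disj[of n m] that by (cases m n rule: linorder_cases) auto
  have split: "v = S (\<Union>n<N. A n) v + S {ennreal (real N)<..} v" for N
  proof (induction N)
    case 0
    then show ?case by (simp add: S_empty S_Ioi_0)
  next
    case (Suc N)
    have "{ennreal (real N)<..} = A N \<union> {ennreal (real (Suc N))<..}"
    proof -
      have "{a<..} = {a<..b} \<union> {b<..}" if "a < b" for a b :: ennreal
        using that by (auto intro: order.strict_trans)
      moreover have "ennreal (real N) < ennreal (real (Suc N))" by (intro ennreal_lessI) auto
      ultimately show ?thesis unfolding A_def by blast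
    qed
    moreover have "A N \<inter> {ennreal (real (Suc N))<..} = {}" unfolding A_def by fastforce
    ultimately have 1: "S {ennreal (real N)<..} v = S (A N) v + S {ennreal (real (Suc N))<..} v"
      by (simp only: S_Un bA borel_open open_greaterThan)
    have "(\<Union>n<N. A n) \<inter> A N = {}" using disj by fastforce
    then have "S (\<Union>n<Suc N. A n) v = S (\<Union>n<N. A n) v + S (A N) v"
      using S_Un[of "\<Union>n<N. A n" "A N" v] bA by (simp add: lessThan_Suc Un_commute sets.finite_UN)
    then show ?case using Suc unfolding 1 by (metis add.assoc)
  qed
  have U: "(\<Union>n. A n) = {0<..<\<infinity>}"
  proof (intro equalityI subsetI)
    fix x assume x: "x \<in> {0<..<\<infinity> :: ennreal}"
    then obtain r where r: "x = ennreal r" "r > 0" by (cases x) auto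
    \<comment> \<open>Rounding \<open>r\<close> up to an integer; \<open>r > 0\<close> gives it a
      predecessor, whose failure is the strict lower bound.\<close>
    define n where "n = (LEAST n. r \<le> real n)"
    have n: "r \<le> real n" unfolding n_def using real_arch_simple[of r] by (rule LeastI_ex)
    then have "n \<noteq> 0" using r by auto
    then obtain m where m: "n = Suc m" by (cases n) auto
    have "\<not> r \<le> real m" using not_less_Least[of m "\<lambda>n. r \<le> real n"] m unfolding n_def by auto
    moreover have "ennreal r \<le> ennreal (real (Suc m))" using n m by (intro ennreal_leI) simp
    ultimately have "x \<in> A m" using r(1) unfolding A_def by (simp add: ennreal_less_iff)
    then show "x \<in> (\<Union>n. A n)" by blast
  qed (auto simp: A_def intro: order_le_less_trans)
  have "{0<..} = {0<..<\<infinity>} \<union> {\<infinity> :: ennreal}" by (auto simp: not_less top_unique)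
  then have "S {0<..<\<infinity>} v = v"
    using S_Un[of "{0<..<\<infinity>}" "{\<infinity>}" v] S_Ioi_0[of v] by (simp add: S_infinity[simplified])
  then have "(\<lambda>n. cinner v (S (A n) v)) sums cinner v v"
    using S_sums[of A v v] bA dis U by (auto simp: disjoint_family_on_def)
  then have "(\<lambda>N. \<Sum>n<N. cinner v (S (A n) v)) \<longlonglongrightarrow> cinner v v" by (simp add: sums_def)
  then have "(\<lambda>N. Re (cinner v v - (\<Sum>n<N. cinner v (S (A n) v)))) \<longlonglongrightarrow> Re (cinner v v - cinner v v)"
    by (intro tendsto_intros)
  moreover have "Re (cinner v v - (\<Sum>n<N. cinner v (S (A n) v))) = (norm (S {ennreal (real N)<..} v))\<^sup>2" for N
  proof -
    have "cinner v v = cinner v (S (\<Union>n<N. A n) v) + cinner v (S {ennreal (real N)<..} v)"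
      using split[of N] by (metis cinner_add_right)
    moreover have "cinner v (S (\<Union>n<N. A n) v) = (\<Sum>n<N. cinner v (S (A n) v))"
      using dis bA by (simp add: S_UN cinner_sum_right)
    ultimately show ?thesis using orth_projection_norm[OF S_proj, of "{ennreal (real N)<..}" v] by simp
  qed
  ultimately have "(\<lambda>N. (norm (S {ennreal (real N)<..} v))\<^sup>2) \<longlonglongrightarrow> 0" by simp
  then have "\<forall>\<^sub>F N in sequentially. (norm (S {ennreal (real N)<..} v))\<^sup>2 < e\<^sup>2"
    by (rule order_tendstoD) (use e in simp)
  then obtain N where "(norm (S {ennreal (real N)<..} v))\<^sup>2 < e\<^sup>2" by (auto simp: eventually_sequentially)
  then have "norm (S {ennreal (real N)<..} v) < e" by (rule power2_less_imp_less) (use e in simp)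
  then show ?thesis by blast
qed

text \<open>The definition of a stop time speaks of positive times; time 0, which occurs as the left
  end of the first cell, is settled by \<open>S_zero\<close>.\<close>

lemma S_Icc_adapted: "t \<ge> 0 \<Longrightarrow> adapted t (S {0..ennreal t})"
proof (cases "t = 0")
  case True
  have "adapted t (\<lambda>_. 0)"
    unfolding adapted_def
    using bounded_clinear_onD(3)[OF ten_left_linear csubspace_fock_sub]
    by (auto simp: bounded_ops_zero_op csubspaceD[OF csubspace_fock_sub])
  moreover have "{0..ennreal t} = {0}" using True by auto
  ultimately show ?thesis by (simp add: S_zero)
next
  case False
  moreover assume "t \<ge> 0"
  ultimately have "t > 0" by simp
  then obtain A where "A \<in> bounded_ops_on (past t)" "S {0..ennreal t} = tensor_op \<epsilon> t A id"
    using stop unfolding finite_stop_time_def by blast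
  then show ?thesis using adapted_tensor_op by simp
qed

text \<open>A difference of two closed initial intervals, the shorter one lifted from
  \<open>a\<close> to \<open>b\<close> by \<open>adapted_mono\<close>.\<close>

lemma S_Ioc_adapted:
  assumes "0 \<le> a" "a \<le> b" shows "adapted b (S {ennreal a<..ennreal b})"
proof -
  have "{0..ennreal b} = {0..ennreal a} \<union> {ennreal a<..ennreal b}"
    using ennreal_leI[OF assms(2)] by auto
  then have "S {0..ennreal b} x = S {0..ennreal a} x + S {ennreal a<..ennreal b} x" for x
    using S_Un[of "{0..ennreal a}" "{ennreal a<..ennreal b}" x] by fastforce
  then have "S {ennreal a<..ennreal b} = (\<lambda>x. S {0..ennreal b} x - S {0..ennreal a} x)" by auto
  then show ?thesis
    using adapted_diff[OF S_Icc_adapted adapted_mono[OF assms(2) S_Icc_adapted]] assms by simp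
qed

lemma S_cell_cell:
  assumes P: "time_partition P" and p: "p \<in> P - {0}" and q: "q \<in> P - {0}"
  shows "S (cell P p) (S (cell P q) x) = (if p = q then S (cell P p) x else 0)"
  using S_orth[OF borel_cell[OF P p] borel_cell[OF P q] cell_disjoint]
    orth_projection_idem[OF S_proj[OF borel_cell[OF P p]]] by (cases "p = q") auto

lemma S_cell_sum:
  assumes P: "time_partition P" and p: "p \<in> P - {0}"
  shows "S (cell P p) (\<Sum>q\<in>P - {0}. S (cell P q) (v q)) = S (cell P p) (v p)"
proof -
  have "S (cell P p) (\<Sum>q\<in>P - {0}. S (cell P q) (v q)) = (\<Sum>q\<in>P - {0}. S (cell P p) (S (cell P q) (v q)))"
    by (rule bounded_ops_sum[OF S_ops[OF borel_cell[OF P p]]])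
  also have "\<dots> = (\<Sum>q\<in>P - {0}. if q = p then S (cell P p) (v p) else 0)"
    by (intro sum.cong refl) (auto simp: S_cell_cell[OF P p])
  also have "\<dots> = S (cell P p) (v p)" using p time_partitionD(1)[OF P] by simp
  finally show ?thesis .
qed

lemma sum_cells: "time_partition P \<Longrightarrow> (\<Sum>p\<in>P - {0}. S (cell P p) x) = x"
proof -
  assume P: "time_partition P"
  have "S (\<Union>p\<in>P - {0}. cell P p) x = (\<Sum>p\<in>P - {0}. S (cell P p) x)"
    by (rule S_UN) (use P time_partitionD(1)[OF P] borel_cell[OF P] cell_disjoint in auto)
  then show ?thesis using UN_cells[OF P] S_Ioi_0 by simp
qed

lemma norm_sq_sum_cells:
  assumes P: "time_partition P"
  shows "(norm (\<Sum>p\<in>P - {0}. S (cell P p) (v p)))\<^sup>2 = (\<Sum>p\<in>P - {0}. (norm (S (cell P p) (v p)))\<^sup>2)"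
proof (rule norm_sq_sum_orthogonal)
  fix p q assume pq: "p \<in> P - {0}" "q \<in> P - {0}" "p \<noteq> q"
  have "cinner (S (cell P p) (v p)) (S (cell P q) (v q)) = cinner (v p) (S (cell P p) (S (cell P q) (v q)))"
    by (rule orth_projection_self_adjoint[OF S_proj[OF borel_cell[OF P pq(1)]]])
  then show "cinner (S (cell P p) (v p)) (S (cell P q) (v q)) = 0"
    using pq by (simp add: S_cell_cell[OF P pq(1,2)])
qed (use time_partitionD(1)[OF P] in simp)

lemma sum_norm_sq_cells:
  "time_partition P \<Longrightarrow> (\<Sum>p\<in>P - {0}. (norm (S (cell P p) x))\<^sup>2) = (norm x)\<^sup>2"
  using norm_sq_sum_cells[of P "\<lambda>_. x"] sum_cells by simp

text \<open>Riemann sums of \<open>G\<close> against the projection-valued measure, evaluated at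
  right ends of cells; the flow on a vector and the stopped shift are both of this form.\<close>

definition riemann :: "(ennreal \<Rightarrow> 'b) \<Rightarrow> ennreal set \<Rightarrow> 'b"
  where "riemann G P = (\<Sum>p\<in>P - {0}. S (cell P p) (G p))"

text \<open>Fine cells inside a coarse one all carry its right end \<open>next_point P q\<close>, so
  that the difference of two Riemann sums becomes a single sum over the fine cells.\<close>

lemma riemann_refine:
  assumes P: "time_partition P" and Q: "time_partition Q" and sub: "P \<subseteq> Q"
  shows "riemann G P = (\<Sum>q\<in>Q - {0}. S (cell Q q) (G (next_point P q)))"
proof -
  have fin: "finite P" "finite Q" using P Q by (auto simp: time_partition_def)
  have "riemann G P = (\<Sum>p\<in>P - {0}. \<Sum>q\<in>{q \<in> Q - {0}. next_point P q = p}. S (cell Q q) (G (next_point P q)))"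
    unfolding riemann_def
  proof (rule sum.cong[OF refl])
    fix p
    have "S (cell P p) (G p) = (\<Sum>q\<in>{q \<in> Q - {0}. next_point P q = p}. S (cell Q q) (G p))"
      unfolding cell_refine[OF P Q sub, of p]
      by (rule S_UN) (use fin borel_cell[OF Q] cell_disjoint in auto)
    then show "S (cell P p) (G p) = (\<Sum>q\<in>{q \<in> Q - {0}. next_point P q = p}. S (cell Q q) (G (next_point P q)))"
      by simp
  qed
  also have "\<dots> = (\<Sum>q\<in>Q - {0}. S (cell Q q) (G (next_point P q)))"
  proof (rule sum.group)
    show "next_point P ` (Q - {0}) \<subseteq> P - {0}"
    proof (rule image_subsetI)
      fix q assume "q \<in> Q - {0}"
      then have "q \<noteq> 0" by blast
      then have "0 < next_point P q" using next_point_ge[OF P, of q] by (metis not_gr_zero order_less_le_trans)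
      then show "next_point P q \<in> P - {0}" using next_point_in[OF P] by auto
    qed
  qed (use fin in auto)
  finally show ?thesis .
qed

text \<open>The increments \<open>G q - G p\<close> are measured against the same vector \<open>u\<close> on every cell,
  so that the orthogonality of the cells sums up the local estimates.\<close>

lemma riemann_convergent:
  assumes C: "C \<ge> 0"
    and near: "\<And>N::nat. \<And>e. e > 0 \<Longrightarrow> \<exists>d>0. \<forall>a q p. 0 \<le> a \<longrightarrow> a \<le> q \<longrightarrow> q \<le> p \<longrightarrow> p \<le> real N \<longrightarrow> p - q < d \<longrightarrow>
      norm (S {ennreal a<..ennreal q} (G (ennreal q) - G (ennreal p))) \<le> e * norm (S {ennreal a<..ennreal q} u)"
    and tail: "\<And>a q. a < q \<Longrightarrow> norm (S {a<..q} (G q - G \<infinity>)) \<le> C * norm (S {a<..q} u)"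
  shows "\<exists>y. (riemann G \<longlongrightarrow> y) refinement"
proof (rule refinement_convergent)
  fix e :: real assume e: "e > 0"
  \<comment> \<open>The contributions before and after \<open>N\<close> will each be bounded by
    \<open>e / 2\<close>; the summand 1 in \<open>C + 1\<close>, and in \<open>c\<close> below,
    guards against division by zero.\<close>
  obtain N where N: "norm (S {ennreal (real N)<..} u) < e / (2 * (C + 1))"
    using S_tail[of "e / (2 * (C + 1))" u] e C by auto
  define w where "w = S {ennreal (real N)<..} u"
  define c where "c = norm u + 1"
  have c: "c > 0" by (simp add: c_def add_nonneg_pos)
  define e1 where "e1 = e / (2 * c)"
  have e1: "e1 > 0" using e c by (simp add: e1_def)
  obtain d where d: "d > 0" "\<And>a q p. 0 \<le> a \<Longrightarrow> a \<le> q \<Longrightarrow> q \<le> p \<Longrightarrow> p \<le> real N \<Longrightarrow> p - q < d \<Longrightarrow>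
      norm (S {ennreal a<..ennreal q} (G (ennreal q) - G (ennreal p))) \<le> e1 * norm (S {ennreal a<..ennreal q} u)"
    using near[OF e1, of N] by blast
  obtain P where P: "time_partition P" "ennreal (real N) \<in> P"
    "\<And>q. q \<ge> 0 \<Longrightarrow> q \<le> real N \<Longrightarrow> \<exists>p. next_point P (ennreal q) = ennreal p \<and> q \<le> p \<and> p \<le> real N \<and> p - q < d"
    "\<And>x. ennreal (real N) < x \<Longrightarrow> next_point P x = \<infinity>"
    using fine_partition[OF d(1), of N] by blast
  have "norm (riemann G Q - riemann G P) \<le> e" if Q: "time_partition Q" "P \<subseteq> Q" for Q
  proof -
    \<comment> \<open>A cell that ends by \<open>N\<close> is handled by the first summand, a later
      one by the second; with both present a single bound serves the whole sum.\<close>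
    have loc: "norm (S (cell Q q) (G q - G (next_point P q))) \<le> e1 * norm (S (cell Q q) u) + C * norm (S (cell Q q) w)"
      if q: "q \<in> Q - {0}" for q
    proof -
      obtain a where a: "a \<in> Q" "a < q" "cell Q q = {a<..q}" using cell_interval[OF Q(1) q] .
      show ?thesis
      proof (cases "q \<le> ennreal (real N)")
        case True
        then have "q \<noteq> \<infinity>" by (auto simp: top_unique)
        then obtain q' where q': "q = ennreal q'" "q' \<ge> 0" by (cases q) auto
        have "a \<noteq> \<infinity>" using a(2) by auto
        then obtain a' where a': "a = ennreal a'" "a' \<ge> 0" by (cases a) auto
        have "q' \<le> real N" using True q' by (simp add: ennreal_le_iff)
        then obtain p where p: "next_point P q = ennreal p" "q' \<le> p" "p \<le> real N" "p - q' < d"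
          using P(3)[OF q'(2)] q'(1) by blast
        have "a' \<le> q'" using a(2) a' q' by (simp add: ennreal_less_iff)
        then have "norm (S (cell Q q) (G q - G (next_point P q))) \<le> e1 * norm (S (cell Q q) u)"
          unfolding p(1) a(3) unfolding q'(1) a'(1) using a' p by (intro d(2))
        then show ?thesis using C by (simp add: add_increasing2)
      next
        case False
        \<comment> \<open>As \<open>N\<close> belongs to \<open>P\<close> and hence to
          \<open>Q\<close>, no cell of \<open>Q\<close> straddles it.\<close>
        have "ennreal (real N) \<le> a"
        proof (rule ccontr)
          assume "\<not> ennreal (real N) \<le> a"
          then have "ennreal (real N) \<in> cell Q q" using False a(3) by auto
          then have "next_point Q (ennreal (real N)) = q" by (simp add: cell_def)
          then show False using next_point_self[OF Q(1)] P(2) Q(2) False by auto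
        qed
        then have "cell Q q \<subseteq> {ennreal (real N)<..}" using a(3) by auto
        then have "S (cell Q q) w = S (cell Q q) u"
          unfolding w_def by (intro S_subset borel_cell[OF Q(1) q]) auto
        moreover have "norm (S (cell Q q) (G q - G (next_point P q))) \<le> C * norm (S (cell Q q) u)"
          using False P(4)[of q] tail[OF a(2)] a(3) by simp
        ultimately show ?thesis using e1 by (simp add: add_increasing)
      qed
    qed
    have "riemann G Q - riemann G P = (\<Sum>q\<in>Q - {0}. S (cell Q q) (G q - G (next_point P q)))"
      unfolding riemann_refine[OF P(1) Q] unfolding riemann_def
      by (simp add: bounded_ops_diff[OF S_ops[OF borel_cell[OF Q(1)]]] sum_subtractf[symmetric])
    then have "(norm (riemann G Q - riemann G P))\<^sup>2 = (\<Sum>q\<in>Q - {0}. (norm (S (cell Q q) (G q - G (next_point P q))))\<^sup>2)"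
      by (simp add: norm_sq_sum_cells[OF Q(1)])
    \<comment> \<open>Splitting the square at the price of a factor 2 lets both parts be summed over
      the cells; the total is \<open>2 * (e / 2)\<^sup>2\<close> twice, which is
      \<open>e\<^sup>2\<close>.\<close>
    also have "\<dots> \<le> (\<Sum>q\<in>Q - {0}. 2 * e1\<^sup>2 * (norm (S (cell Q q) u))\<^sup>2 + 2 * C\<^sup>2 * (norm (S (cell Q q) w))\<^sup>2)"
    proof (rule sum_mono)
      fix q assume q: "q \<in> Q - {0}"
      define x where "x = e1 * norm (S (cell Q q) u)"
      define y where "y = C * norm (S (cell Q q) w)"
      have "(norm (S (cell Q q) (G q - G (next_point P q))))\<^sup>2 \<le> (x + y)\<^sup>2"
        unfolding x_def y_def using loc[OF q] by (intro power_mono) auto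
      also have "\<dots> \<le> 2 * x\<^sup>2 + 2 * y\<^sup>2" using sum_squares_bound[of x y] by (simp add: power2_sum)
      finally show "(norm (S (cell Q q) (G q - G (next_point P q))))\<^sup>2
        \<le> 2 * e1\<^sup>2 * (norm (S (cell Q q) u))\<^sup>2 + 2 * C\<^sup>2 * (norm (S (cell Q q) w))\<^sup>2"
        by (simp add: x_def y_def power_mult_distrib)
    qed
    also have "\<dots> = 2 * e1\<^sup>2 * (norm u)\<^sup>2 + 2 * C\<^sup>2 * (norm w)\<^sup>2"
      by (simp add: sum.distrib sum_norm_sq_cells[OF Q(1)] flip: sum_distrib_left)
    also have "\<dots> = 2 * (e1 * norm u)\<^sup>2 + 2 * (C * norm w)\<^sup>2" by (simp add: power_mult_distrib)
    also have "\<dots> \<le> 2 * (e / 2)\<^sup>2 + 2 * (e / 2)\<^sup>2"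
    proof -
      have "e1 * norm u \<le> e1 * c" unfolding c_def using e1 by (intro mult_left_mono) auto
      also have "\<dots> = e / 2" using c by (simp add: e1_def)
      finally have 1: "e1 * norm u \<le> e / 2" .
      have "C * norm w \<le> (C + 1) * (e / (2 * (C + 1)))"
        using N C by (intro mult_mono) (auto simp: w_def)
      also have "\<dots> = e / 2"
      proof -
        have "d * (e / (2 * d)) = e / 2" if "d \<noteq> 0" for d :: real using that by simp
        then show ?thesis using C by (metis add_nonneg_pos less_irrefl zero_less_one)
      qed
      finally have 2: "C * norm w \<le> e / 2" .
      show ?thesis using 1 2 C e1 by (intro add_mono mult_left_mono power_mono) auto
    qed
    also have "\<dots> = e\<^sup>2" by (simp add: power_divide)
    finally show ?thesis by (rule power2_le_imp_le) (use e in simp)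
  qed
  then show "\<exists>P. time_partition P \<and> (\<forall>Q. time_partition Q \<and> P \<subseteq> Q \<longrightarrow> norm (riemann G Q - riemann G P) \<le> e)"
    using P(1) by blast
qed

text \<open>Once \<open>N\<close> is a partition point, the last cell lies beyond it. Its
  disappearance repairs linearity and the intertwining relation in the limit.\<close>

lemma last_cell_tendsto: "((\<lambda>P. S (cell P \<infinity>) x) \<longlongrightarrow> 0) refinement"
proof (rule tendstoI)
  fix e :: real assume "e > 0"
  then obtain N where N: "norm (S {ennreal (real N)<..} x) < e" using S_tail by blast
  show "\<forall>\<^sub>F P in refinement. dist (S (cell P \<infinity>) x) 0 < e"
    using eventually_time_partition eventually_contains[of "ennreal (real N)"]
  proof eventually_elim
    case (elim P)
    have i: "\<infinity> \<in> P - {0}" using time_partitionD(3)[OF elim(1)] by simp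
    obtain a where a: "a \<in> P" "a < \<infinity>" "cell P \<infinity> = {a<..\<infinity>}" using cell_interval[OF elim(1) i] .
    have "ennreal (real N) \<le> a"
    proof (rule ccontr)
      assume "\<not> ennreal (real N) \<le> a"
      then have "ennreal (real N) \<in> cell P \<infinity>" using a(3) by auto
      then have "next_point P (ennreal (real N)) = \<infinity>" by (simp add: cell_def)
      then show False using next_point_self[OF elim] by simp
    qed
    then have sub: "cell P \<infinity> \<subseteq> {ennreal (real N)<..}" using a(3) by auto
    have "S (cell P \<infinity>) (S {ennreal (real N)<..} x) = S (cell P \<infinity>) x"
      by (rule S_subset[OF borel_cell[OF elim(1) i] _ sub]) simp
    then have "norm (S (cell P \<infinity>) x) = norm (S (cell P \<infinity>) (S {ennreal (real N)<..} x))"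
      by (simp only:)
    also have "\<dots> \<le> norm (S {ennreal (real N)<..} x)"
      by (intro orth_projection_contractive S_proj borel_cell[OF elim(1) i])
    finally show ?case using N by simp
  qed
qed

subsection \<open>The flow along a partition\<close>

lemma ccr_flow_infinity: "ccr_flow \<epsilon> \<infinity> X = id"
  by (simp add: ccr_flow_def)

lemma ccr_flow_ops: "X \<in> bounded_ops \<Longrightarrow> ccr_flow \<epsilon> p X \<in> bounded_ops"
  by (cases p) (auto simp: flow_ops bounded_ops_id ccr_flow_infinity[simplified])

lemma ccr_flow_id: "ccr_flow \<epsilon> p id = id"
  by (cases p) (auto simp: flow_id ccr_flow_infinity[simplified])

lemma ccr_flow_comp:
  "X \<in> bounded_ops \<Longrightarrow> Y \<in> bounded_ops \<Longrightarrow> ccr_flow \<epsilon> p (X \<circ> Y) = ccr_flow \<epsilon> p X \<circ> ccr_flow \<epsilon> p Y"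
  by (cases p) (auto simp: flow_comp ccr_flow_infinity[simplified])

lemma ccr_flow_adj: "X \<in> bounded_ops \<Longrightarrow> ccr_flow \<epsilon> p (adj X) = adj (ccr_flow \<epsilon> p X)"
proof (cases p)
  case top
  have "adj id = (id :: 'b \<Rightarrow> 'b)" by (rule adj_unique) (auto simp: bounded_ops_id)
  then show ?thesis using top ccr_flow_infinity by simp
qed (simp add: flow_adj)

text \<open>At \<infinity> the flow is the identity even for small \<open>X\<close>, hence
  \<open>K \<ge> 1\<close>.\<close>

lemma ccr_flow_norm:
  assumes "X \<in> bounded_ops" "K \<ge> 1" "\<And>x. norm (X x) \<le> K * norm x"
  shows "norm (ccr_flow \<epsilon> p X z) \<le> K * norm z"
proof (cases p)
  case top
  then show ?thesis
    using ccr_flow_infinity mult_right_mono[OF assms(2) norm_ge_zero[of z]] by simp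
qed (use assms in \<open>auto intro: flow_norm\<close>)

lemma ccr_flow_lin:
  assumes "X \<in> bounded_ops" "Y \<in> bounded_ops" "p \<noteq> \<infinity>"
  shows "ccr_flow \<epsilon> p (\<lambda>x. c *\<^sub>C X x + d *\<^sub>C Y x) x = c *\<^sub>C ccr_flow \<epsilon> p X x + d *\<^sub>C ccr_flow \<epsilon> p Y x"
proof -
  obtain t where t: "p = ennreal t" "t \<ge> 0" using assms(3) by (cases p) auto
  show ?thesis unfolding t(1)
    using flow_add[OF t(2) bounded_ops_scale[OF assms(1)] bounded_ops_scale[OF assms(2)], of c d]
      flow_scale[OF t(2) assms(1), of c] flow_scale[OF t(2) assms(2), of d]
    by simp
qed

text \<open>The reason for taking the flow at the right end: the projection of an interval is
  adapted there, and so acts on the other tensor factor.\<close>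

lemma S_ccr_flow_commute:
  assumes "a < q" "X \<in> bounded_ops"
  shows "S {a<..q} (ccr_flow \<epsilon> q X z) = ccr_flow \<epsilon> q X (S {a<..q} z)"
proof (cases q)
  case top
  then show ?thesis using ccr_flow_infinity by simp
next
  case (real t)
  have "a \<noteq> \<infinity>" using assms(1) by auto
  then obtain r where r: "a = ennreal r" "r \<ge> 0" by (cases a) auto
  have "adapted t (S {a<..q})" unfolding real(2) r(1)
    by (rule S_Ioc_adapted) (use r real assms(1) in \<open>auto simp: ennreal_less_iff\<close>)
  then show ?thesis using adapted_commute real assms(2) by simp
qed

lemma S_cell_commute:
  assumes P: "time_partition P" and p: "p \<in> P - {0}" and X: "X \<in> bounded_ops"
  shows "ccr_flow \<epsilon> p X (S (cell P p) x) = S (cell P p) (ccr_flow \<epsilon> p X x)"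
proof -
  obtain a where a: "a < p" "cell P p = {a<..p}" using cell_interval[OF P p] by blast
  show ?thesis using S_ccr_flow_commute[OF a(1) X] a(2) by simp
qed

lemma partition_flow_cells:
  assumes P: "time_partition P"
  shows "partition_flow \<epsilon> S P X x = (\<Sum>p\<in>P - {0}. ccr_flow \<epsilon> p X (S (cell P p) x))"
  unfolding partition_flow_def by (rule sum_over_cells[OF P, of "\<lambda>A p. ccr_flow \<epsilon> p X (S A x)"])

lemma partition_flow_riemann:
  assumes P: "time_partition P" and X: "X \<in> bounded_ops"
  shows "partition_flow \<epsilon> S P X x = riemann (\<lambda>p. ccr_flow \<epsilon> p X x) P"
  unfolding partition_flow_cells[OF P] riemann_def
  by (rule sum.cong[OF refl S_cell_commute[OF P _ X]])

lemma partition_flow_ops: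
  "time_partition P \<Longrightarrow> X \<in> bounded_ops \<Longrightarrow> partition_flow \<epsilon> S P X \<in> bounded_ops"
proof -
  assume P: "time_partition P" and X: "X \<in> bounded_ops"
  have "(\<lambda>x. \<Sum>p\<in>P - {0}. (ccr_flow \<epsilon> p X \<circ> S (cell P p)) x) \<in> bounded_ops"
    by (intro bounded_ops_sum_ops bounded_ops_comp ccr_flow_ops X S_ops borel_cell[OF P])
  moreover have "partition_flow \<epsilon> S P X = (\<lambda>x. \<Sum>p\<in>P - {0}. (ccr_flow \<epsilon> p X \<circ> S (cell P p)) x)"
    by (rule ext) (simp add: partition_flow_cells[OF P])
  ultimately show ?thesis by simp
qed

lemma partition_flow_norm:
  assumes P: "time_partition P" and X: "X \<in> bounded_ops" and K: "K \<ge> 1" "\<And>x. norm (X x) \<le> K * norm x"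
  shows "norm (partition_flow \<epsilon> S P X x) \<le> K * norm x"
proof -
  have "(norm (partition_flow \<epsilon> S P X x))\<^sup>2 = (\<Sum>p\<in>P - {0}. (norm (S (cell P p) (ccr_flow \<epsilon> p X x)))\<^sup>2)"
    unfolding partition_flow_riemann[OF P X] riemann_def by (rule norm_sq_sum_cells[OF P])
  also have "\<dots> \<le> (\<Sum>p\<in>P - {0}. K\<^sup>2 * (norm (S (cell P p) x))\<^sup>2)"
  proof (rule sum_mono)
    fix p assume p: "p \<in> P - {0}"
    have "norm (S (cell P p) (ccr_flow \<epsilon> p X x)) \<le> K * norm (S (cell P p) x)"
      unfolding S_cell_commute[OF P p X, symmetric] by (rule ccr_flow_norm[OF X K])
    then have "(norm (S (cell P p) (ccr_flow \<epsilon> p X x)))\<^sup>2 \<le> (K * norm (S (cell P p) x))\<^sup>2"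
      by (intro power_mono) auto
    then show "(norm (S (cell P p) (ccr_flow \<epsilon> p X x)))\<^sup>2 \<le> K\<^sup>2 * (norm (S (cell P p) x))\<^sup>2"
      by (simp add: power_mult_distrib)
  qed
  also have "\<dots> = (K * norm x)\<^sup>2"
    by (simp add: sum_norm_sq_cells[OF P] power_mult_distrib flip: sum_distrib_left)
  finally show ?thesis by (rule power2_le_imp_le) (use K in simp)
qed

lemma partition_flow_id: "time_partition P \<Longrightarrow> partition_flow \<epsilon> S P id = id"
  by (rule ext) (simp add: partition_flow_cells ccr_flow_id sum_cells)

lemma partition_flow_comp:
  assumes P: "time_partition P" and X: "X \<in> bounded_ops" and Y: "Y \<in> bounded_ops"
  shows "partition_flow \<epsilon> S P (X \<circ> Y) = partition_flow \<epsilon> S P X \<circ> partition_flow \<epsilon> S P Y"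
proof
  fix x
  have "(partition_flow \<epsilon> S P X \<circ> partition_flow \<epsilon> S P Y) x
      = (\<Sum>p\<in>P - {0}. ccr_flow \<epsilon> p X (S (cell P p) (\<Sum>q\<in>P - {0}. S (cell P q) (ccr_flow \<epsilon> q Y x))))"
    unfolding comp_apply partition_flow_riemann[OF P Y] riemann_def
      partition_flow_cells[OF P, where X = X] ..
  also have "\<dots> = (\<Sum>p\<in>P - {0}. ccr_flow \<epsilon> p (X \<circ> Y) (S (cell P p) x))"
    by (intro sum.cong refl) (simp add: S_cell_sum[OF P] ccr_flow_comp X Y S_cell_commute[OF P _ Y])
  finally show "partition_flow \<epsilon> S P (X \<circ> Y) x = (partition_flow \<epsilon> S P X \<circ> partition_flow \<epsilon> S P Y) x"
    by (simp add: partition_flow_cells[OF P])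
qed

lemma partition_flow_adj_cinner:
  assumes P: "time_partition P" and X: "X \<in> bounded_ops"
  shows "cinner (partition_flow \<epsilon> S P (adj X) x) y = cinner x (partition_flow \<epsilon> S P X y)"
  unfolding partition_flow_riemann[OF P adj_bounded[OF X]] riemann_def
    partition_flow_cells[OF P, where X = X] cinner_sum_left cinner_sum_right
proof (rule sum.cong[OF refl])
  fix p assume p: "p \<in> P - {0}"
  have "cinner (S (cell P p) (ccr_flow \<epsilon> p (adj X) x)) y = cinner (ccr_flow \<epsilon> p (adj X) x) (S (cell P p) y)"
    by (rule orth_projection_self_adjoint[OF S_proj[OF borel_cell[OF P p]]])
  also have "\<dots> = cinner x (ccr_flow \<epsilon> p X (S (cell P p) y))"
    by (simp add: ccr_flow_adj X adj_cinner ccr_flow_ops)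
  finally show "cinner (S (cell P p) (ccr_flow \<epsilon> p (adj X) x)) y = cinner x (ccr_flow \<epsilon> p X (S (cell P p) y))" .
qed

lemma partition_flow_star: "time_partition P \<Longrightarrow> unital_star_multiplicative (partition_flow \<epsilon> S P)"
  unfolding unital_star_multiplicative_def
proof (intro conjI ballI)
  assume P: "time_partition P"
  show "partition_flow \<epsilon> S P X \<in> bounded_ops" if "X \<in> bounded_ops" for X
    using P that by (rule partition_flow_ops)
  show "partition_flow \<epsilon> S P (adj X) = adj (partition_flow \<epsilon> S P X)" if "X \<in> bounded_ops" for X
    by (rule adj_unique[symmetric])
      (use P that in \<open>auto simp: partition_flow_ops adj_bounded partition_flow_adj_cinner\<close>)
qed (simp_all add: partition_flow_id partition_flow_comp)

text \<open>On the last cell the left side is the identity, while the combination on the right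
  yields \<open>c + d\<close> times it; all other cells are linear.\<close>

lemma partition_flow_lin:
  assumes P: "time_partition P" and X: "X \<in> bounded_ops" and Y: "Y \<in> bounded_ops"
  shows "partition_flow \<epsilon> S P (\<lambda>x. c *\<^sub>C X x + d *\<^sub>C Y x) x =
    c *\<^sub>C partition_flow \<epsilon> S P X x + d *\<^sub>C partition_flow \<epsilon> S P Y x + (1 - c - d) *\<^sub>C S (cell P \<infinity>) x"
proof -
  have "ccr_flow \<epsilon> p (\<lambda>x. c *\<^sub>C X x + d *\<^sub>C Y x) (S (cell P p) x) =
      c *\<^sub>C ccr_flow \<epsilon> p X (S (cell P p) x) + d *\<^sub>C ccr_flow \<epsilon> p Y (S (cell P p) x)
      + (if p = \<infinity> then (1 - c - d) *\<^sub>C S (cell P \<infinity>) x else 0)" for p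
  proof (cases "p = \<infinity>")
    case True
    then show ?thesis by (simp add: ccr_flow_infinity[simplified] scaleC_diff_left)
  next
    case False
    then show ?thesis using ccr_flow_lin[OF X Y False] by simp
  qed
  then show ?thesis
    using time_partitionD[OF P]
    by (simp add: partition_flow_cells[OF P] sum.distrib scaleC_sum_right)
qed

lemma last_cell_eq: "time_partition P \<Longrightarrow> cell P \<infinity> = {pt P (card P - 2)<..\<infinity>}"
  using cell_pt[of P "card P - 1"] pt_last[of P] card_ge_2[of P] by (simp add: numeral_2_eq_2)

subsection \<open>Convergence\<close>

lemma flow_riemann_convergent:
  assumes X: "X \<in> bounded_ops" and f: "f \<in> L2"
  shows "\<exists>y. (riemann (\<lambda>p. ccr_flow \<epsilon> p X (\<epsilon> f)) \<longlongrightarrow> y) refinement"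
proof -
  obtain K where K: "K > 0" "\<And>x. norm (X x) \<le> K * norm x" using bounded_ops_bound[OF X] by metis
  have ef: "norm (\<epsilon> f) > 0" using f by (rule eps_nonzero)
  show ?thesis
  \<comment> \<open>In the tail the flow is compared with its value at \<infinity>, the identity:
    \<open>K\<close> bounds the former and 1 the latter.\<close>
  proof (rule riemann_convergent[where C = "K + 1" and u = "\<epsilon> f"])
    fix N :: nat and e :: real assume e: "e > 0"
    have "uniformly_continuous_on {0..real N} (\<lambda>t. flow t X (\<epsilon> f))"
      by (intro compact_uniformly_continuous continuous_on_subset[OF flow_continuous[OF X f]]) auto
    \<comment> \<open>The factor cancels the \<open>norm (\<epsilon> f)\<close> that appears in
      \<open>norm_adapted_flow\<close>.\<close>
    moreover have "e * norm (\<epsilon> f) > 0" using e ef by simp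
    ultimately obtain d where d: "d > 0" "\<And>s t. s \<in> {0..real N} \<Longrightarrow> t \<in> {0..real N} \<Longrightarrow> dist t s < d \<Longrightarrow>
        dist (flow t X (\<epsilon> f)) (flow s X (\<epsilon> f)) < e * norm (\<epsilon> f)"
      unfolding uniformly_continuous_on_def by metis
    have "norm (S {ennreal a<..ennreal q} (flow q X (\<epsilon> f) - flow p X (\<epsilon> f))) \<le> e * norm (S {ennreal a<..ennreal q} (\<epsilon> f))"
      if apq: "0 \<le> a" "a \<le> q" "q \<le> p" "p \<le> real N" "p - q < d" for a q p
    proof -
      have q: "q \<ge> 0" "p - q \<ge> 0" using apq by auto
      define Y where "Y = (\<lambda>x. X x + (-1) *\<^sub>C flow (p - q) X x)"
      have fY: "flow (p - q) X \<in> bounded_ops" using q X by (intro flow_ops)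
      have Y: "Y \<in> bounded_ops" unfolding Y_def by (intro bounded_ops_plus bounded_ops_scale fY X)
      have "flow q Y (\<epsilon> f) = flow q X (\<epsilon> f) + (-1) *\<^sub>C flow q (flow (p - q) X) (\<epsilon> f)"
        unfolding Y_def flow_add[OF q(1) X bounded_ops_scale[OF fY]] flow_scale[OF q(1) fY] ..
      also have "flow q (flow (p - q) X) = flow p X" using flow_semigroup[OF q X] by simp
      finally have Yf: "flow q Y (\<epsilon> f) = flow q X (\<epsilon> f) - flow p X (\<epsilon> f)"
        using scaleC_of_real[of "-1" "flow p X (\<epsilon> f)"] by simp
      have "norm (flow q Y (\<epsilon> f)) \<le> e * norm (\<epsilon> f)"
        using d(2)[of p q] apq unfolding Yf by (simp add: dist_norm)
      then have "norm (S {ennreal a<..ennreal q} (\<epsilon> f)) * norm (flow q Y (\<epsilon> f))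
          \<le> norm (S {ennreal a<..ennreal q} (\<epsilon> f)) * (e * norm (\<epsilon> f))" by (intro mult_left_mono) auto
      then have "norm (S {ennreal a<..ennreal q} (flow q Y (\<epsilon> f))) * norm (\<epsilon> f)
          \<le> (e * norm (S {ennreal a<..ennreal q} (\<epsilon> f))) * norm (\<epsilon> f)"
        using norm_adapted_flow[OF q(1) S_Ioc_adapted[OF apq(1,2)] Y f] by (simp add: algebra_simps)
      then show ?thesis using ef unfolding Yf by simp
    qed
    then show "\<exists>d>0. \<forall>a q p. 0 \<le> a \<longrightarrow> a \<le> q \<longrightarrow> q \<le> p \<longrightarrow> p \<le> real N \<longrightarrow> p - q < d \<longrightarrow>
        norm (S {ennreal a<..ennreal q} (flow q X (\<epsilon> f) - flow p X (\<epsilon> f))) \<le> e * norm (S {ennreal a<..ennreal q} (\<epsilon> f))"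
      using d(1) by blast
  next
    fix a q :: ennreal assume aq: "a < q"
    have A: "{a<..q} \<in> sets borel" by simp
    have "norm (S {a<..q} (ccr_flow \<epsilon> q X (\<epsilon> f) - ccr_flow \<epsilon> \<infinity> X (\<epsilon> f)))
      = norm (ccr_flow \<epsilon> q X (S {a<..q} (\<epsilon> f)) - S {a<..q} (\<epsilon> f))"
      using S_ccr_flow_commute[OF aq X] ccr_flow_infinity by (simp add: bounded_ops_diff[OF S_ops[OF A]])
    also have "\<dots> \<le> (K + 1) * norm (S {a<..q} (\<epsilon> f))"
    proof (cases q)
      case top
      then show ?thesis using ccr_flow_infinity K by simp
    next
      case (real t)
      have "norm (flow t X (S {a<..q} (\<epsilon> f))) \<le> K * norm (S {a<..q} (\<epsilon> f))"
        using real X K by (intro flow_norm) auto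
      then show ?thesis
        using norm_triangle_ineq4[of "flow t X (S {a<..q} (\<epsilon> f))" "S {a<..q} (\<epsilon> f)"] real
        by (simp add: algebra_simps)
    qed
    finally show "norm (S {a<..q} (ccr_flow \<epsilon> q X (\<epsilon> f) - ccr_flow \<epsilon> \<infinity> X (\<epsilon> f)))
      \<le> (K + 1) * norm (S {a<..q} (\<epsilon> f))" .
  qed (use K in simp)
qed

lemma bounded_ops_bound_ge_1:
  assumes "X \<in> bounded_ops" obtains K where "K \<ge> 1" "\<And>x. norm (X x) \<le> K * norm x"
proof -
  obtain K where K: "K > 0" "\<And>x. norm (X x) \<le> K * norm x" using bounded_ops_bound[OF assms] by metis
  have "norm (X x) \<le> (K + 1) * norm x" for x
    using K(2)[of x] norm_ge_zero[of x] unfolding distrib_right mult_1 by linarith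
  then show thesis using K(1) by (intro that[of "K + 1"]) auto
qed

lemma partition_flow_uniform:
  assumes "X \<in> bounded_ops"
  shows "\<exists>K. \<forall>\<^sub>F P in refinement. bounded_clinear_on UNIV (partition_flow \<epsilon> S P X) \<and>
    (\<forall>x. norm (partition_flow \<epsilon> S P X x) \<le> K * norm x)"
proof -
  obtain K where K: "K \<ge> 1" "\<And>x. norm (X x) \<le> K * norm x" using bounded_ops_bound_ge_1[OF assms] by metis
  have "\<forall>\<^sub>F P in refinement. bounded_clinear_on UNIV (partition_flow \<epsilon> S P X) \<and>
    (\<forall>x. norm (partition_flow \<epsilon> S P X x) \<le> K * norm x)"
    using eventually_time_partition
    by eventually_elim (simp add: bounded_clinear_on_UNIV partition_flow_ops partition_flow_norm assms K)
  then show ?thesis by blast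
qed

text \<open>Convergence on exponential vectors spreads to all vectors because one bound serves every
  partition. Only then is \<open>Lim\<close> in \<open>stopped_flow\<close> a genuine limit.\<close>

lemma partition_flow_tendsto:
  assumes X: "X \<in> bounded_ops"
  shows "((\<lambda>P. partition_flow \<epsilon> S P X x) \<longlongrightarrow> stopped_flow \<epsilon> S X x) refinement"
proof -
  obtain K where K: "\<forall>\<^sub>F P in refinement. bounded_clinear_on UNIV (partition_flow \<epsilon> S P X) \<and>
    (\<forall>x. norm (partition_flow \<epsilon> S P X x) \<le> K * norm x)" using partition_flow_uniform[OF X] by blast
  have "\<exists>y. ((\<lambda>P. partition_flow \<epsilon> S P X x) \<longlongrightarrow> y) refinement"
  proof (rule strong_convergent_on_total[OF refinement_neq_bot K eps_total])
    fix a assume "a \<in> \<epsilon> ` L2"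
    then obtain f where f: "f \<in> L2" "a = \<epsilon> f" by blast
    obtain y where y: "(riemann (\<lambda>p. ccr_flow \<epsilon> p X a) \<longlongrightarrow> y) refinement"
      using flow_riemann_convergent[OF X f(1)] f(2) by blast
    have "\<forall>\<^sub>F P in refinement. riemann (\<lambda>p. ccr_flow \<epsilon> p X a) P = partition_flow \<epsilon> S P X a"
      using eventually_time_partition by eventually_elim (simp add: partition_flow_riemann X)
    from Lim_transform_eventually[OF y this]
    show "\<exists>y. ((\<lambda>P. partition_flow \<epsilon> S P X a) \<longlongrightarrow> y) refinement" by blast
  qed
  then obtain y where y: "((\<lambda>P. partition_flow \<epsilon> S P X x) \<longlongrightarrow> y) refinement" by blast
  then show ?thesis unfolding stopped_flow_def using tendsto_Lim[OF refinement_neq_bot y] by simp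
qed

text \<open>The uniform bound lets a moving argument be replaced by its limit. Multiplicativity and
  the intertwining relation both need operator and vector to vary together.\<close>

lemma partition_flow_tendsto_compose:
  assumes X: "X \<in> bounded_ops" and v: "(v \<longlongrightarrow> w) refinement"
  shows "((\<lambda>P. partition_flow \<epsilon> S P X (v P)) \<longlongrightarrow> stopped_flow \<epsilon> S X w) refinement"
proof -
  obtain K where K: "\<forall>\<^sub>F P in refinement. bounded_clinear_on UNIV (partition_flow \<epsilon> S P X) \<and>
    (\<forall>x. norm (partition_flow \<epsilon> S P X x) \<le> K * norm x)" using partition_flow_uniform[OF X] by blast
  have "((\<lambda>P. partition_flow \<epsilon> S P X (v P) - partition_flow \<epsilon> S P X w) \<longlongrightarrow> 0) refinement"
  proof (rule Lim_null_comparison)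
    show "\<forall>\<^sub>F P in refinement. norm (partition_flow \<epsilon> S P X (v P) - partition_flow \<epsilon> S P X w) \<le> K * norm (v P - w)"
      using K eventually_time_partition
      by eventually_elim (simp flip: bounded_ops_diff[OF partition_flow_ops[OF _ X]])
    have "((\<lambda>P. K * norm (v P - w)) \<longlongrightarrow> K * norm (w - w)) refinement" by (intro tendsto_intros v)
    then show "((\<lambda>P. K * norm (v P - w)) \<longlongrightarrow> 0) refinement" by simp
  qed
  from tendsto_add[OF this partition_flow_tendsto[OF X, of w]] show ?thesis by simp
qed

lemma tendsto_unique_refinement:
  "(f \<longlongrightarrow> a) refinement \<Longrightarrow> (f \<longlongrightarrow> b) refinement \<Longrightarrow> a = b" for a b :: "'c::t2_space"
  by (rule tendsto_unique[OF refinement_neq_bot])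

text \<open>Each partition misses linearity by a multiple of the last cell, which tends to
  0.\<close>

lemma stopped_flow_lin:
  assumes X: "X \<in> bounded_ops" and Y: "Y \<in> bounded_ops"
  shows "stopped_flow \<epsilon> S (\<lambda>x. c *\<^sub>C X x + d *\<^sub>C Y x) x = c *\<^sub>C stopped_flow \<epsilon> S X x + d *\<^sub>C stopped_flow \<epsilon> S Y x"
proof (rule tendsto_unique_refinement)
  show "((\<lambda>P. partition_flow \<epsilon> S P (\<lambda>x. c *\<^sub>C X x + d *\<^sub>C Y x) x) \<longlongrightarrow>
      stopped_flow \<epsilon> S (\<lambda>x. c *\<^sub>C X x + d *\<^sub>C Y x) x) refinement"
    by (intro partition_flow_tendsto bounded_ops_plus bounded_ops_scale X Y)
  have "((\<lambda>P. c *\<^sub>C partition_flow \<epsilon> S P X x + d *\<^sub>C partition_flow \<epsilon> S P Y x + (1 - c - d) *\<^sub>C S (cell P \<infinity>) x)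
      \<longlongrightarrow> c *\<^sub>C stopped_flow \<epsilon> S X x + d *\<^sub>C stopped_flow \<epsilon> S Y x + (1 - c - d) *\<^sub>C 0) refinement"
    by (intro tendsto_add tendsto_scaleC partition_flow_tendsto last_cell_tendsto X Y)
  moreover have "\<forall>\<^sub>F P in refinement. c *\<^sub>C partition_flow \<epsilon> S P X x + d *\<^sub>C partition_flow \<epsilon> S P Y x
      + (1 - c - d) *\<^sub>C S (cell P \<infinity>) x = partition_flow \<epsilon> S P (\<lambda>x. c *\<^sub>C X x + d *\<^sub>C Y x) x"
    using eventually_time_partition by eventually_elim (simp add: partition_flow_lin X Y)
  ultimately have "((\<lambda>P. partition_flow \<epsilon> S P (\<lambda>x. c *\<^sub>C X x + d *\<^sub>C Y x) x) \<longlongrightarrow>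
      c *\<^sub>C stopped_flow \<epsilon> S X x + d *\<^sub>C stopped_flow \<epsilon> S Y x + (1 - c - d) *\<^sub>C 0) refinement"
    by (rule Lim_transform_eventually)
  then show "((\<lambda>P. partition_flow \<epsilon> S P (\<lambda>x. c *\<^sub>C X x + d *\<^sub>C Y x) x) \<longlongrightarrow>
      c *\<^sub>C stopped_flow \<epsilon> S X x + d *\<^sub>C stopped_flow \<epsilon> S Y x) refinement" by simp
qed

lemma stopped_flow_ops:
  assumes X: "X \<in> bounded_ops" shows "stopped_flow \<epsilon> S X \<in> bounded_ops"
proof -
  obtain K where K: "K \<ge> 1" "\<And>x. norm (X x) \<le> K * norm x" using bounded_ops_bound_ge_1[OF X] by metis
  note lim = partition_flow_tendsto[OF X]
  show ?thesis
  proof (rule bounded_opsI[where K = K])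
    fix x y c
    have "\<forall>\<^sub>F P in refinement. partition_flow \<epsilon> S P X x + partition_flow \<epsilon> S P X y = partition_flow \<epsilon> S P X (x + y)"
      using eventually_time_partition by eventually_elim (simp add: bounded_ops_add partition_flow_ops X)
    from Lim_transform_eventually[OF tendsto_add[OF lim lim] this]
    show "stopped_flow \<epsilon> S X (x + y) = stopped_flow \<epsilon> S X x + stopped_flow \<epsilon> S X y"
      by (rule tendsto_unique_refinement[OF lim])
    have "\<forall>\<^sub>F P in refinement. c *\<^sub>C partition_flow \<epsilon> S P X x = partition_flow \<epsilon> S P X (c *\<^sub>C x)"
      using eventually_time_partition by eventually_elim (simp add: bounded_ops_scaleC partition_flow_ops X)
    from Lim_transform_eventually[OF tendsto_scaleC[OF lim] this]
    show "stopped_flow \<epsilon> S X (c *\<^sub>C x) = c *\<^sub>C stopped_flow \<epsilon> S X x"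
      by (rule tendsto_unique_refinement[OF lim])
    show "norm (stopped_flow \<epsilon> S X x) \<le> K * norm x"
    proof (rule tendsto_upperbound[OF tendsto_norm[OF lim] _ refinement_neq_bot])
      show "\<forall>\<^sub>F P in refinement. norm (partition_flow \<epsilon> S P X x) \<le> K * norm x"
        using eventually_time_partition by eventually_elim (rule partition_flow_norm[OF _ X K])
    qed
  qed
qed

lemma stopped_flow_id: "stopped_flow \<epsilon> S id = id"
proof
  fix x
  have "\<forall>\<^sub>F P in refinement. x = partition_flow \<epsilon> S P id x"
    using eventually_time_partition by eventually_elim (simp add: partition_flow_id)
  from Lim_transform_eventually[OF tendsto_const this]
  show "stopped_flow \<epsilon> S id x = id x"
    using tendsto_unique_refinement[OF partition_flow_tendsto[OF bounded_ops_id]] by simp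
qed

lemma stopped_flow_comp:
  assumes X: "X \<in> bounded_ops" and Y: "Y \<in> bounded_ops"
  shows "stopped_flow \<epsilon> S (X \<circ> Y) = stopped_flow \<epsilon> S X \<circ> stopped_flow \<epsilon> S Y"
proof
  fix x
  have "\<forall>\<^sub>F P in refinement. partition_flow \<epsilon> S P X (partition_flow \<epsilon> S P Y x) = partition_flow \<epsilon> S P (X \<circ> Y) x"
    using eventually_time_partition by eventually_elim (simp add: partition_flow_comp X Y)
  from Lim_transform_eventually[OF partition_flow_tendsto_compose[OF X partition_flow_tendsto[OF Y]] this]
  show "stopped_flow \<epsilon> S (X \<circ> Y) x = (stopped_flow \<epsilon> S X \<circ> stopped_flow \<epsilon> S Y) x"
    using tendsto_unique_refinement[OF partition_flow_tendsto[OF bounded_ops_comp[OF X Y]]] by simp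
qed

lemma stopped_flow_adj:
  assumes X: "X \<in> bounded_ops"
  shows "stopped_flow \<epsilon> S (adj X) = adj (stopped_flow \<epsilon> S X)"
proof (rule adj_unique[symmetric])
  show "stopped_flow \<epsilon> S (adj X) \<in> bounded_ops" by (intro stopped_flow_ops adj_bounded X)
  fix x y
  have "\<forall>\<^sub>F P in refinement. cinner (partition_flow \<epsilon> S P (adj X) x) y = cinner x (partition_flow \<epsilon> S P X y)"
    using eventually_time_partition by eventually_elim (rule partition_flow_adj_cinner[OF _ X])
  from Lim_transform_eventually[OF tendsto_cinner[OF partition_flow_tendsto[OF adj_bounded[OF X]] tendsto_const] this]
  show "cinner (stopped_flow \<epsilon> S (adj X) x) y = cinner x (stopped_flow \<epsilon> S X y)"
    by (rule tendsto_unique_refinement[OF _ tendsto_cinner[OF tendsto_const partition_flow_tendsto[OF X]]])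
qed

lemma stopped_flow_hom: "unital_star_hom (stopped_flow \<epsilon> S)"
  unfolding unital_star_hom_def unital_star_multiplicative_def
proof (intro conjI ballI allI)
  fix X Y :: "'b \<Rightarrow> 'b" and c assume X: "X \<in> bounded_ops"
  \<comment> \<open>Homogeneity is the linear combination with coefficients \<open>c\<close> and
    0.\<close>
  show "stopped_flow \<epsilon> S (\<lambda>x. c *\<^sub>C X x) = (\<lambda>x. c *\<^sub>C stopped_flow \<epsilon> S X x)"
    using stopped_flow_lin[OF X X, of c 0] by auto
  assume Y: "Y \<in> bounded_ops"
  show "stopped_flow \<epsilon> S (\<lambda>x. X x + Y x) = (\<lambda>x. stopped_flow \<epsilon> S X x + stopped_flow \<epsilon> S Y x)"
    using stopped_flow_lin[OF X Y, of 1 1] by auto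
qed (simp_all add: stopped_flow_ops stopped_flow_id stopped_flow_comp stopped_flow_adj)

section \<open>The stopped shift and its intertwining with the stopped flow\<close>

lemma shift_riemann_tendsto:
  "((riemann (\<lambda>p. shift_op \<epsilon> p x)) \<longlongrightarrow> stopped_shift \<epsilon> S x) refinement"
proof -
  have "\<exists>y. (riemann (\<lambda>p. shift_op \<epsilon> p x) \<longlongrightarrow> y) refinement"
  \<comment> \<open>One \<open>norm x\<close> comes from the shift at a finite time, the other from
    the projection onto the vacuum at \<infinity>.\<close>
  proof (rule riemann_convergent[where C = "2 * norm x" and u = vac])
    fix N :: nat and e :: real assume e: "e > 0"
    obtain d where d: "d > 0" "\<And>r. r \<in> {0..} \<Longrightarrow> r \<noteq> 0 \<Longrightarrow> dist r 0 < d \<Longrightarrow> dist (shift r x) x < e"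
      using tendstoD[OF shift_tendsto e] unfolding eventually_at by blast
    have "norm (S {ennreal a<..ennreal q} (shift q x - shift p x)) \<le> e * norm (S {ennreal a<..ennreal q} vac)"
      if apq: "0 \<le> a" "a \<le> q" "q \<le> p" "p \<le> real N" "p - q < d" for a q p
    \<comment> \<open>The limit of the shift at 0 makes no claim at 0 itself, so equal times are
      treated apart.\<close>
    proof (cases "p = q")
      case True
      then show ?thesis using e by (simp add: bounded_ops_zero[OF S_ops])
    next
      case False
      have q: "q \<ge> 0" "p - q \<ge> 0" using apq by auto
      have "shift q x - shift p x = shift q (x - shift (p - q) x)"
        using shift_add[OF q, of x] by (simp add: bounded_ops_diff[OF shift_ops[OF q(1)]])
      then have "norm (S {ennreal a<..ennreal q} (shift q x - shift p x))
          = norm (S {ennreal a<..ennreal q} vac) * norm (x - shift (p - q) x)"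
        using norm_adapted_shift[OF q(1) S_Ioc_adapted[OF apq(1,2)]] by simp
      moreover have "norm (x - shift (p - q) x) \<le> e"
        using d(2)[of "p - q"] apq False q by (simp add: dist_norm norm_minus_commute)
      ultimately show ?thesis
        using mult_right_mono[of "norm (x - shift (p - q) x)" e "norm (S {ennreal a<..ennreal q} vac)"]
        by (simp add: mult.commute)
    qed
    then show "\<exists>d>0. \<forall>a q p. 0 \<le> a \<longrightarrow> a \<le> q \<longrightarrow> q \<le> p \<longrightarrow> p \<le> real N \<longrightarrow> p - q < d \<longrightarrow>
        norm (S {ennreal a<..ennreal q} (shift q x - shift p x)) \<le> e * norm (S {ennreal a<..ennreal q} vac)"
      using d(1) by blast
  next
    fix a q :: ennreal assume aq: "a < q"
    have A: "S {a<..q} \<in> bounded_ops" by (intro S_ops) simp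
    show "norm (S {a<..q} (shift_op \<epsilon> q x - shift_op \<epsilon> \<infinity> x)) \<le> 2 * norm x * norm (S {a<..q} vac)"
    proof (cases q)
      case top
      then show ?thesis using bounded_ops_zero[OF A] by simp
    next
      case (real t)
      have "a \<noteq> \<infinity>" using aq by auto
      then obtain r where r: "a = ennreal r" "r \<ge> 0" by (cases a) auto
      have ad: "adapted t (S {a<..q})" unfolding real(2) r(1)
        by (rule S_Ioc_adapted) (use r real aq in \<open>auto simp: ennreal_less_iff\<close>)
      have 1: "norm (S {a<..q} (shift_op \<epsilon> q x)) = norm (S {a<..q} vac) * norm x"
        using norm_adapted_shift[OF real(1) ad] real(2) by simp
      have "cmod (cinner vac x) \<le> norm x" using cauchy_schwarz[of vac x] by (simp add: norm_vac)
      then have 2: "norm (S {a<..q} (shift_op \<epsilon> \<infinity> x)) \<le> norm x * norm (S {a<..q} vac)"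
        unfolding shift_infinity by (simp add: bounded_ops_scaleC[OF A] mult_right_mono)
      show ?thesis
        using 1 2 norm_triangle_ineq4[of "S {a<..q} (shift_op \<epsilon> q x)" "S {a<..q} (shift_op \<epsilon> \<infinity> x)"]
        unfolding bounded_ops_diff[OF A] by (simp add: algebra_simps)
    qed
  qed simp
  then obtain y where y: "(riemann (\<lambda>p. shift_op \<epsilon> p x) \<longlongrightarrow> y) refinement" by blast
  have "\<forall>\<^sub>F P in refinement. riemann (\<lambda>p. shift_op \<epsilon> p x) P
      = (\<Sum>j=1..<card P. S {pt P (j - 1)<..pt P j} (shift_op \<epsilon> (pt P j) x))"
    using eventually_time_partition
    by eventually_elim (simp only: riemann_def sum_over_cells[of _ "\<lambda>A p. S A (shift_op \<epsilon> p x)"])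
  from Lim_transform_eventually[OF y this] have "stopped_shift \<epsilon> S x = y"
    unfolding stopped_shift_def by (rule tendsto_Lim[OF refinement_neq_bot])
  then show ?thesis using y by simp
qed

text \<open>Orthogonality leaves one product per cell, and at finite times the flow of
  \<open>X\<close> slides through the shift by \<open>flow_shift\<close>. At \<infinity> the flow is
  the identity and \<open>X\<close> is lost, which the last summand corrects.\<close>

lemma partition_flow_shift:
  assumes P: "time_partition P" and X: "X \<in> bounded_ops"
  shows "partition_flow \<epsilon> S P X (riemann (\<lambda>p. shift_op \<epsilon> p x) P) =
    riemann (\<lambda>p. shift_op \<epsilon> p (X x)) P + S (cell P \<infinity>) (shift_op \<epsilon> \<infinity> x - shift_op \<epsilon> \<infinity> (X x))"
proof -
  have "partition_flow \<epsilon> S P X (riemann (\<lambda>p. shift_op \<epsilon> p x) P)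
      = (\<Sum>p\<in>P - {0}. S (cell P p) (ccr_flow \<epsilon> p X (shift_op \<epsilon> p x)))"
    unfolding partition_flow_cells[OF P] riemann_def
    by (intro sum.cong refl) (simp add: S_cell_sum[OF P] S_cell_commute[OF P _ X])
  also have "\<dots> = (\<Sum>p\<in>P - {0}. S (cell P p) (shift_op \<epsilon> p (X x)) +
      (if p = \<infinity> then S (cell P \<infinity>) (shift_op \<epsilon> \<infinity> x - shift_op \<epsilon> \<infinity> (X x)) else 0))"
  proof (rule sum.cong[OF refl])
    fix p assume p: "p \<in> P - {0}"
    show "S (cell P p) (ccr_flow \<epsilon> p X (shift_op \<epsilon> p x)) = S (cell P p) (shift_op \<epsilon> p (X x)) +
      (if p = \<infinity> then S (cell P \<infinity>) (shift_op \<epsilon> \<infinity> x - shift_op \<epsilon> \<infinity> (X x)) else 0)"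
    proof (cases "p = \<infinity>")
      case True
      then show ?thesis
        using bounded_ops_diff[OF S_ops[OF borel_cell[OF P p]]] ccr_flow_infinity by simp
    next
      case False
      then obtain t where "p = ennreal t" "t \<ge> 0" by (cases p) auto
      then show ?thesis using False by (simp add: flow_shift X)
    qed
  qed
  also have "\<dots> = riemann (\<lambda>p. shift_op \<epsilon> p (X x)) P
      + S (cell P \<infinity>) (shift_op \<epsilon> \<infinity> x - shift_op \<epsilon> \<infinity> (X x))"
    using time_partitionD[OF P] by (simp add: sum.distrib riemann_def)
  finally show ?thesis .
qed

text \<open>The relation for partitions is passed to the limit with flow and argument moving
  together, while the defect on the last cell dies out.\<close>

lemma stopped_flow_shift:
  assumes X: "X \<in> bounded_ops"
  shows "stopped_flow \<epsilon> S X (stopped_shift \<epsilon> S x) = stopped_shift \<epsilon> S (X x)"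
proof (rule tendsto_unique_refinement)
  show "((\<lambda>P. partition_flow \<epsilon> S P X (riemann (\<lambda>p. shift_op \<epsilon> p x) P)) \<longlongrightarrow>
      stopped_flow \<epsilon> S X (stopped_shift \<epsilon> S x)) refinement"
    by (rule partition_flow_tendsto_compose[OF X shift_riemann_tendsto])
  have "\<forall>\<^sub>F P in refinement. riemann (\<lambda>p. shift_op \<epsilon> p (X x)) P
      + S (cell P \<infinity>) (shift_op \<epsilon> \<infinity> x - shift_op \<epsilon> \<infinity> (X x))
      = partition_flow \<epsilon> S P X (riemann (\<lambda>p. shift_op \<epsilon> p x) P)"
    using eventually_time_partition by eventually_elim (simp only: partition_flow_shift[OF _ X])
  from Lim_transform_eventually[OF tendsto_add[OF shift_riemann_tendsto last_cell_tendsto] this]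
  show "((\<lambda>P. partition_flow \<epsilon> S P X (riemann (\<lambda>p. shift_op \<epsilon> p x) P)) \<longlongrightarrow>
      stopped_shift \<epsilon> S (X x)) refinement" by simp
qed

end

theorem theorem5p2:
  fixes \<epsilon> :: "(real \<Rightarrow> 'k::complex_hilbert) \<Rightarrow> 'f::complex_hilbert"
    and S :: "ennreal set \<Rightarrow> 'f \<Rightarrow> 'f"
  assumes "fock_space \<epsilon>"
    and "finite_stop_time \<epsilon> S"
  shows "(\<forall>P. time_partition P \<longrightarrow>
        unital_star_multiplicative (partition_flow \<epsilon> S P) \<and>
        (\<forall>X\<in>bounded_ops. \<forall>Y\<in>bounded_ops. \<forall>c d.
          partition_flow \<epsilon> S P (\<lambda>x. c *\<^sub>C X x + d *\<^sub>C Y x) =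
            (\<lambda>x. c *\<^sub>C partition_flow \<epsilon> S P X x + d *\<^sub>C partition_flow \<epsilon> S P Y x
              + (1 - c - d) *\<^sub>C S {pt P (card P - 2)<..\<infinity>} x))) \<and>
    (\<forall>X\<in>bounded_ops. stopped_flow \<epsilon> S X \<in> bounded_ops \<and>
      (\<forall>x. ((\<lambda>P. partition_flow \<epsilon> S P X x) \<longlongrightarrow> stopped_flow \<epsilon> S X x) refinement)) \<and>
    unital_star_hom (stopped_flow \<epsilon> S) \<and>
    (\<forall>X\<in>bounded_ops. stopped_flow \<epsilon> S X \<circ> stopped_shift \<epsilon> S = stopped_shift \<epsilon> S \<circ> X)"
proof -
  interpret stop_time \<epsilon> S by unfold_locales fact+
  show ?thesis
  proof (intro conjI allI impI ballI ext)
    fix P and X Y :: "'f \<Rightarrow> 'f" and c d x assume P: "time_partition P" and XY: "X \<in> bounded_ops" "Y \<in> bounded_ops"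
    show "partition_flow \<epsilon> S P (\<lambda>x. c *\<^sub>C X x + d *\<^sub>C Y x) x =
        c *\<^sub>C partition_flow \<epsilon> S P X x + d *\<^sub>C partition_flow \<epsilon> S P Y x
          + (1 - c - d) *\<^sub>C S {pt P (card P - 2)<..\<infinity>} x"
      unfolding last_cell_eq[OF P, symmetric] by (rule partition_flow_lin[OF P XY])
  qed (simp_all add: partition_flow_star stopped_flow_ops partition_flow_tendsto stopped_flow_hom
      stopped_flow_shift)
qed

end
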